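(* Let $T>0$ and let $\boldsymbol{h}=(h_1,\dots,h_d)^T\in[W^{1,\infty}(\mathbb{R}^d)]^d$ be positive. Assume that $u_0\in H^2(\mathbb{R}^d)$ and $u_1\in H^1(\mathbb{R}^d)$, and consider the Cauchy problem $$u_{tt}(t,x)-\sum_{j=1}^{d}\partial_{x_j}\left(h_j(x)\partial_{x_j}u(t,x)\right)=0,\quad (t,x)\in[0,T]\times\mathbb{R}^d,\qquad u(0,x)=u_0(x),\quad u_t(0,x)=u_1(x),\quad x\in\mathbb{R}^d.$$ Let $(u_\varepsilon)_\varepsilon$ be a very weak solution of this problem. Then, for any regularising families $h_{j,\varepsilon}=h_j*\psi_{1,\varepsilon}$ ($j=1,\dots,d$), $u_{0,\varepsilon}=u_0*\psi_{2,\varepsilon}$ and $u_{1,\varepsilon}=u_1*\psi_{3,\varepsilon}$, with any $\psi_k\in C_0^\infty(\mathbb{R}^d)$, $\psi_k\ge0$, $\int\psi_k=1$, $k=1,2,3$, the net $(u_\varepsilon)_\varepsilon$ converges to the classical solution $u$ of the Cauchy problem in $L^2$ as $\varepsilon\to0$, that is, $\|u_\varepsilon(t,\cdot)-u(t,\cdot)\|_{L^2}\to0$ as $\varepsilon\to0$ for all $t\in[0,T]$.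
   Context: $\boldsymbol{h}$ is positive if there is $c_0>0$ with $0<c_0\le h_j$ (almost everywhere) for all $j=1,\dots,d$. $W^{1,\infty}(\mathbb{R}^d)$ is the space of measurable $f$ with $\|f\|_{W^{1,\infty}}:=\|f\|_{L^\infty}+\|\nabla f\|_{L^\infty}<\infty$. For $\varepsilon\in(0,1]$, $\psi_{k,\varepsilon}(x)=\varepsilon^{-d}\psi_k(x/\varepsilon)$. The classical solution is the solution $u\in C([0,T];H^2(\mathbb{R}^d))\cap C^1([0,T];H^1(\mathbb{R}^d))$ of the Cauchy problem. Moderateness (with $a\lesssim b$ meaning $a\le cb$, $c>0$ independent of $\varepsilon$ and $t$): a net $(f_\varepsilon)_\varepsilon$ is $X$-moderate, for $X\in\{H^1,H^2,W^{1,\infty}\}$, if $\|f_\varepsilon\|_X\lesssim\varepsilon^{-N}$ for some $N\in\mathbb{N}_0$; a net $(u_\varepsilon)_\varepsilon$ from $C([0,T];H^2(\mathbb{R}^d))\cap C^1([0,T];H^1(\mathbb{R}^d))$ is $C^1$-moderate if for some $N\in\mathbb{N}_0$, $\|u_\varepsilon(t,\cdot)\|_{L^2}+\|\sum_{j=1}^d\partial_{x_j}u_\varepsilon(t,\cdot)\|_{L^2}+\|\Delta u_\varepsilon(t,\cdot)\|_{L^2}\lesssim\varepsilon^{-N}$ for all $t\in[0,T]$. Very weak solution: a net $(u_\varepsilon)_\varepsilon$ in $C([0,T];H^1(\mathbb{R}^d))\cap C^1([0,T];L^2(\mathbb{R}^d))$ is a very weak solution if, for some $W^{1,\infty}$-moderate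 regularisations $h_{j,\varepsilon}$ of $h_j$, $H^2$-moderate regularisation $u_{0,\varepsilon}$ of $u_0$ and $H^1$-moderate regularisation $u_{1,\varepsilon}$ of $u_1$ (regularisations being nets of smooth functions obtained by convolution with mollifiers), $u_\varepsilon$ solves, for all $\varepsilon\in(0,1]$, $$\partial_t^2u_\varepsilon-\sum_{j=1}^{d}\partial_{x_j}\left(h_{j,\varepsilon}(x)\partial_{x_j}u_\varepsilon\right)=0\ \text{ on }[0,T]\times\mathbb{R}^d,\qquad u_\varepsilon(0,x)=u_{0,\varepsilon}(x),\quad\partial_tu_\varepsilon(0,x)=u_{1,\varepsilon}(x),$$ and $(u_\varepsilon)_\varepsilon$ is $C^1$-moderate. In the theorem, $(u_\varepsilon)_\varepsilon$ is the net solving these regularised problems for the regularising families $h_{j,\varepsilon},u_{0,\varepsilon},u_{1,\varepsilon}$ named in the claim. *)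

theory Defs
  imports "HOL-Analysis.Analysis" "HOL-Probability.Essential_Supremum"
begin

text \<open>
  The space dimension is \<open>d = CARD('n)\<close>, and the coordinate directions are indexed by \<open>'n\<close>.
  Elements of \<open>L\<^sup>2\<close>, \<open>H\<^sup>1\<close>, ... are represented by Borel functions; every notion below depends on
  them only up to equality almost everywhere.
\<close>

section \<open>Test functions and weak derivatives\<close>

definition partial_deriv ::
    "'n \<Rightarrow> (real ^ 'n::finite \<Rightarrow> 'b::real_normed_vector) \<Rightarrow> real ^ 'n \<Rightarrow> 'b" where
  "partial_deriv j f x = frechet_derivative f (at x) (axis j 1)"

text \<open>\<open>C\<^sup>\<infinity>\<close>: all iterated partial derivatives exist and are (totally) differentiable everywhere.\<close>

definition smooth :: "(real ^ 'n::finite \<Rightarrow> 'b::real_normed_vector) \<Rightarrow> bool" where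
  "smooth f \<longleftrightarrow> (\<forall>js. foldr partial_deriv js f differentiable_on UNIV)"

definition test_function :: "(real ^ 'n::finite \<Rightarrow> real) \<Rightarrow> bool" where
  "test_function \<phi> \<longleftrightarrow> smooth \<phi> \<and> compact (closure {x. \<phi> x \<noteq> 0})"

definition locally_integrable ::
    "(real ^ 'n::finite \<Rightarrow> 'b::{banach, second_countable_topology}) \<Rightarrow> bool" where
  "locally_integrable f \<longleftrightarrow>
     f \<in> borel_measurable lborel \<and> (\<forall>K. compact K \<longrightarrow> set_integrable lborel K f)"

definition has_weak_partial ::
    "'n \<Rightarrow> (real ^ 'n::finite \<Rightarrow> 'b::{banach, second_countable_topology}) \<Rightarrow>
      (real ^ 'n \<Rightarrow> 'b) \<Rightarrow> bool" where
  "has_weak_partial j f g \<longleftrightarrow> locally_integrable f \<and> locally_integrable g \<and>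
     (\<forall>\<phi>. test_function \<phi> \<longrightarrow>
        (LINT x|lborel. partial_deriv j \<phi> x *\<^sub>R f x) = - (LINT x|lborel. \<phi> x *\<^sub>R g x))"

definition weakly_differentiable ::
    "(real ^ 'n::finite \<Rightarrow> 'b::{banach, second_countable_topology}) \<Rightarrow> bool" where
  "weakly_differentiable f \<longleftrightarrow> (\<forall>j. \<exists>g. has_weak_partial j f g)"

text \<open>Weak derivatives are unique up to null sets; \<open>weak_partial j f\<close> is one representative.\<close>

definition weak_partial ::
    "'n \<Rightarrow> (real ^ 'n::finite \<Rightarrow> 'b::{banach, second_countable_topology}) \<Rightarrow> real ^ 'n \<Rightarrow> 'b" where
  "weak_partial j f = (SOME g. has_weak_partial j f g)"

definition weak_grad :: "(real ^ 'n::finite \<Rightarrow> real) \<Rightarrow> real ^ 'n \<Rightarrow> real ^ 'n" where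
  "weak_grad f x = (\<chi> j. weak_partial j f x)"

section \<open>Function spaces\<close>

definition L2 :: "(real ^ 'n::finite \<Rightarrow> 'b::{banach, second_countable_topology}) \<Rightarrow> bool" where
  "L2 f \<longleftrightarrow> f \<in> borel_measurable lborel \<and> integrable lborel (\<lambda>x. (norm (f x))\<^sup>2)"

definition L2_norm :: "(real ^ 'n::finite \<Rightarrow> 'b::{banach, second_countable_topology}) \<Rightarrow> real" where
  "L2_norm f = sqrt (LINT x|lborel. (norm (f x))\<^sup>2)"

definition Linf :: "(real ^ 'n::finite \<Rightarrow> 'b::{banach, second_countable_topology}) \<Rightarrow> bool" where
  "Linf f \<longleftrightarrow> f \<in> borel_measurable lborel \<and> esssup lborel (\<lambda>x. ereal (norm (f x))) < \<infinity>"

definition Linf_norm :: "(real ^ 'n::finite \<Rightarrow> 'b::{banach, second_countable_topology}) \<Rightarrow> real" where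
  "Linf_norm f = real_of_ereal (esssup lborel (\<lambda>x. ereal (norm (f x))))"

definition W1inf :: "(real ^ 'n::finite \<Rightarrow> real) \<Rightarrow> bool" where
  "W1inf f \<longleftrightarrow> weakly_differentiable f \<and> Linf f \<and> Linf (weak_grad f)"

definition W1inf_norm :: "(real ^ 'n::finite \<Rightarrow> real) \<Rightarrow> real" where
  "W1inf_norm f = Linf_norm f + Linf_norm (weak_grad f)"

definition H1 :: "(real ^ 'n::finite \<Rightarrow> 'b::{banach, second_countable_topology}) \<Rightarrow> bool" where
  "H1 f \<longleftrightarrow> weakly_differentiable f \<and> L2 f \<and> (\<forall>j. L2 (weak_partial j f))"

definition H1_norm :: "(real ^ 'n::finite \<Rightarrow> 'b::{banach, second_countable_topology}) \<Rightarrow> real" where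
  "H1_norm f = sqrt ((L2_norm f)\<^sup>2 + (\<Sum>j\<in>UNIV. (L2_norm (weak_partial j f))\<^sup>2))"

definition H2 :: "(real ^ 'n::finite \<Rightarrow> 'b::{banach, second_countable_topology}) \<Rightarrow> bool" where
  "H2 f \<longleftrightarrow> H1 f \<and> (\<forall>j. H1 (weak_partial j f))"

definition H2_norm :: "(real ^ 'n::finite \<Rightarrow> 'b::{banach, second_countable_topology}) \<Rightarrow> real" where
  "H2_norm f = sqrt ((L2_norm f)\<^sup>2 + (\<Sum>j\<in>UNIV. (L2_norm (weak_partial j f))\<^sup>2)
     + (\<Sum>i\<in>UNIV. \<Sum>j\<in>UNIV. (L2_norm (weak_partial i (weak_partial j f)))\<^sup>2))"

section \<open>Curves in function spaces\<close>

text \<open>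
  In this section \<open>X\<close> is the membership predicate of a function space and \<open>N\<close> its norm.
  The limits at the end points of \<open>[0,T]\<close> are one-sided.
\<close>

definition C_curve ::
    "(('a \<Rightarrow> 'b::real_normed_vector) \<Rightarrow> bool) \<Rightarrow> (('a \<Rightarrow> 'b) \<Rightarrow> real) \<Rightarrow> real \<Rightarrow>
      (real \<Rightarrow> 'a \<Rightarrow> 'b) \<Rightarrow> bool" where
  "C_curve X N T u \<longleftrightarrow>
     (\<forall>t\<in>{0..T}. X (u t) \<and>
        ((\<lambda>s. N (\<lambda>x. u s x - u t x)) \<longlongrightarrow> 0) (at t within {0..T}))"

definition has_curve_deriv ::
    "(('a \<Rightarrow> 'b::real_normed_vector) \<Rightarrow> real) \<Rightarrow> real \<Rightarrow>
      (real \<Rightarrow> 'a \<Rightarrow> 'b) \<Rightarrow> (real \<Rightarrow> 'a \<Rightarrow> 'b) \<Rightarrow> bool" where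
  "has_curve_deriv N T u v \<longleftrightarrow>
     (\<forall>t\<in>{0..T}.
        ((\<lambda>s. N (\<lambda>x. (u s x - u t x) /\<^sub>R (s - t) - v t x)) \<longlongrightarrow> 0) (at t within {0..T}))"

text \<open>\<open>u \<in> C\<^sup>1([0,T]; X)\<close> with time derivative \<open>v\<close>.\<close>

definition C1_curve ::
    "(('a \<Rightarrow> 'b::real_normed_vector) \<Rightarrow> bool) \<Rightarrow> (('a \<Rightarrow> 'b) \<Rightarrow> real) \<Rightarrow> real \<Rightarrow>
      (real \<Rightarrow> 'a \<Rightarrow> 'b) \<Rightarrow> (real \<Rightarrow> 'a \<Rightarrow> 'b) \<Rightarrow> bool" where
  "C1_curve X N T u v \<longleftrightarrow> C_curve X N T u \<and> C_curve X N T v \<and> has_curve_deriv N T u v"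

text \<open>\<open>u \<in> C([0,T]; H\<^sup>2) \<inter> C\<^sup>1([0,T]; H\<^sup>1)\<close>.\<close>

definition C_H2_C1_H1 ::
    "real \<Rightarrow> (real \<Rightarrow> real ^ 'n::finite \<Rightarrow> 'b::{banach, second_countable_topology}) \<Rightarrow> bool" where
  "C_H2_C1_H1 T u \<longleftrightarrow> C_curve H2 H2_norm T u \<and> (\<exists>v. C1_curve H1 H1_norm T u v)"

section \<open>The Cauchy problem\<close>

text \<open>
  \<open>u \<in> C([0,T]; H\<^sup>1) \<inter> C\<^sup>1([0,T]; L\<^sup>2)\<close> solves
  \<open>\<partial>\<^sub>t\<^sup>2 u - (\<Sum>j. \<partial>\<^sub>j (h j \<partial>\<^sub>j u)) = 0\<close>, \<open>u(0) = f\<close>, \<open>\<partial>\<^sub>t u(0) = g\<close>. At every time \<open>t \<in> [0,T]\<close> the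
  equation is understood in the sense of distributions on space: tested against \<open>\<phi>\<close>, it reads
  \<open>d/dt \<langle>\<partial>\<^sub>t u, \<phi>\<rangle> = - (\<Sum>j. \<langle>h j \<partial>\<^sub>j u, \<partial>\<^sub>j \<phi>\<rangle>)\<close>. No further regularity of \<open>\<partial>\<^sub>t\<^sup>2 u\<close> is presupposed.
\<close>

definition solves_wave_eq ::
    "real \<Rightarrow> ('n \<Rightarrow> real ^ 'n::finite \<Rightarrow> real) \<Rightarrow>
      (real ^ 'n \<Rightarrow> 'b::{banach, second_countable_topology}) \<Rightarrow> (real ^ 'n \<Rightarrow> 'b) \<Rightarrow>
      (real \<Rightarrow> real ^ 'n \<Rightarrow> 'b) \<Rightarrow> bool" where
  "solves_wave_eq T h f g u \<longleftrightarrow>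
     C_curve H1 H1_norm T u \<and>
     (\<exists>v. C1_curve L2 L2_norm T u v \<and>
        (AE x in lborel. u 0 x = f x) \<and> (AE x in lborel. v 0 x = g x) \<and>
        (\<forall>\<phi>. test_function \<phi> \<longrightarrow> (\<forall>t\<in>{0..T}.
           ((\<lambda>s. LINT x|lborel. \<phi> x *\<^sub>R v s x) has_vector_derivative
              - (\<Sum>j\<in>UNIV. LINT x|lborel.
                   partial_deriv j \<phi> x *\<^sub>R (h j x *\<^sub>R weak_partial j (u t) x)))
             (at t within {0..T}))))"

definition classical_solution ::
    "real \<Rightarrow> ('n \<Rightarrow> real ^ 'n::finite \<Rightarrow> real) \<Rightarrow>
      (real ^ 'n \<Rightarrow> 'b::{banach, second_countable_topology}) \<Rightarrow> (real ^ 'n \<Rightarrow> 'b) \<Rightarrow>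
      (real \<Rightarrow> real ^ 'n \<Rightarrow> 'b) \<Rightarrow> bool" where
  "classical_solution T h u0 u1 u \<longleftrightarrow> C_H2_C1_H1 T u \<and> solves_wave_eq T h u0 u1 u"

definition positive_coeffs :: "('n \<Rightarrow> real ^ 'n::finite \<Rightarrow> real) \<Rightarrow> bool" where
  "positive_coeffs h \<longleftrightarrow> (\<exists>c>0. \<forall>j. AE x in lborel. c \<le> h j x)"

section \<open>Regularisation and very weak solutions\<close>

definition mollifier :: "(real ^ 'n::finite \<Rightarrow> real) \<Rightarrow> bool" where
  "mollifier \<psi> \<longleftrightarrow> test_function \<psi> \<and> (\<forall>x. 0 \<le> \<psi> x) \<and> (LINT x|lborel. \<psi> x) = 1"

definition scaled :: "(real ^ 'n::finite \<Rightarrow> real) \<Rightarrow> real \<Rightarrow> real ^ 'n \<Rightarrow> real" where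
  "scaled \<psi> \<epsilon> x = \<psi> (x /\<^sub>R \<epsilon>) / \<epsilon> ^ CARD('n)"

definition convol ::
    "(real ^ 'n::finite \<Rightarrow> 'b::{banach, second_countable_topology}) \<Rightarrow> (real ^ 'n \<Rightarrow> real) \<Rightarrow>
      real ^ 'n \<Rightarrow> 'b" where
  "convol f \<psi> x = (LINT y|lborel. \<psi> (x - y) *\<^sub>R f y)"

text \<open>Nets are functions of \<open>\<epsilon>\<close>, of which only the values for \<open>\<epsilon> \<in> (0,1]\<close> matter.\<close>

definition moderate :: "('f \<Rightarrow> bool) \<Rightarrow> ('f \<Rightarrow> real) \<Rightarrow> (real \<Rightarrow> 'f) \<Rightarrow> bool" where
  "moderate X N f \<longleftrightarrow>
     (\<exists>c>0. \<exists>k::nat. \<forall>\<epsilon>\<in>{0<..1}. X (f \<epsilon>) \<and> N (f \<epsilon>) \<le> c / \<epsilon> ^ k)"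

definition C1_moderate ::
    "real \<Rightarrow> (real \<Rightarrow> real \<Rightarrow> real ^ 'n::finite \<Rightarrow> 'b::{banach, second_countable_topology}) \<Rightarrow> bool"
  where
  "C1_moderate T u \<longleftrightarrow>
     (\<forall>\<epsilon>\<in>{0<..1}. C_H2_C1_H1 T (u \<epsilon>)) \<and>
     (\<exists>c>0. \<exists>k::nat. \<forall>\<epsilon>\<in>{0<..1}. \<forall>t\<in>{0..T}.
        L2_norm (u \<epsilon> t)
        + L2_norm (\<lambda>x. \<Sum>j\<in>UNIV. weak_partial j (u \<epsilon> t) x)
        + L2_norm (\<lambda>x. \<Sum>j\<in>UNIV. weak_partial j (weak_partial j (u \<epsilon> t)) x)
        \<le> c / \<epsilon> ^ k)"

text \<open>
  The net \<open>u\<close> is a very weak solution with respect to the regularising families \<open>h'\<close>, \<open>u0'\<close>, \<open>u1'\<close>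
  of the coefficients and of the initial data.
\<close>

definition very_weak_solution ::
    "real \<Rightarrow> ('n \<Rightarrow> real \<Rightarrow> real ^ 'n::finite \<Rightarrow> real) \<Rightarrow>
      (real \<Rightarrow> real ^ 'n \<Rightarrow> 'b::{banach, second_countable_topology}) \<Rightarrow>
      (real \<Rightarrow> real ^ 'n \<Rightarrow> 'b) \<Rightarrow> (real \<Rightarrow> real \<Rightarrow> real ^ 'n \<Rightarrow> 'b) \<Rightarrow> bool" where
  "very_weak_solution T h' u0' u1' u \<longleftrightarrow>
     (\<forall>j. moderate W1inf W1inf_norm (h' j)) \<and>
     moderate H2 H2_norm u0' \<and> moderate H1 H1_norm u1' \<and>
     (\<forall>\<epsilon>\<in>{0<..1}. solves_wave_eq T (\<lambda>j. h' j \<epsilon>) (u0' \<epsilon>) (u1' \<epsilon>) (u \<epsilon>)) \<and>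
     C1_moderate T u"

end

theory Submission
  imports Defs
begin

text \<open>
  Since \<open>h\<close> is Lipschitz, \<open>g = h\<^sub>\<epsilon> - h\<close> is \<open>O(\<epsilon>)\<close> in \<open>L\<^sup>\<infinity>\<close>. The difference
  \<open>w = u\<^sub>\<epsilon> - u\<close> solves the wave equation with coefficients \<open>h\<^sub>\<epsilon>\<close> and source \<open>\<Sum>j. \<partial>\<^sub>j (g\<^sub>j \<partial>\<^sub>j u)\<close>.
  Because \<open>u\<close> is \<open>C\<^sup>1\<close> in time with values in \<open>H\<^sup>1\<close>, integrating the source by parts in time
  instead of space shows that
  \<open>1/2 \<parallel>w\<^sub>t\<parallel>\<^sup>2 + 1/2 (\<Sum>j. \<langle>h\<^sub>\<epsilon>\<^sub>j \<partial>\<^sub>j w, \<partial>\<^sub>j w\<rangle>) + (\<Sum>j. \<langle>g\<^sub>j \<partial>\<^sub>j u, \<partial>\<^sub>j w\<rangle>)\<close> has time derivative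
  \<open>\<Sum>j. \<langle>g\<^sub>j \<partial>\<^sub>j u\<^sub>t, \<partial>\<^sub>j w\<rangle>\<close>. Gronwall's inequality bounds \<open>w\<close> by \<open>\<epsilon>\<close> and the mollification errors
  of the initial data, which tend to 0 in \<open>L\<^sup>2\<close> by continuity of translation.
\<close>

section \<open>Smooth functions and convolution\<close>

text \<open>The source cannot be treated as an L2 right-hand side: expanding
  \<open>\<partial>\<^sub>j (g\<^sub>j \<partial>\<^sub>j u)\<close> produces the gradient of g, and
  for a merely Lipschitz h the gradients of the mollified coefficients need not converge uniformly.
  Bounds must be uniform in \<epsilon>, so all constants come from h and from the gradients of u and
  of its time derivative; the net contributes its equation and its initial data. The second obstacle
  is that the equation holds only against test functions, with no second time derivative at hand.
  The energy identity is therefore extracted from an inequality for increments in time, which,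
  unlike a pointwise derivative, survives the passage from test functions to H1 by density. Finally,
  functions stand for their classes: \<open>weak_partial\<close> is an arbitrary representative and
  h is Lipschitz only after a change on a null set, which forces arguments with relations and almost
  everywhere limits. All test functions are built from the given mollifiers, and vector values are
  handled one basis component at a time.\<close>

lemma partial_derivI:
  assumes "(f has_derivative f') (at x)"
  shows "partial_deriv j f x = f' (axis j 1)"
  using frechet_derivative_at[OF assms] by (simp add: partial_deriv_def)

text \<open>\<open>foldr\<close> stays inside any class closed under partial derivatives, so
  smoothness reduces to exhibiting such a class of differentiable functions. The closure proofs
  below differ mainly in the class chosen.\<close>

lemma smooth_coinduct:
  fixes f :: "real ^ 'n \<Rightarrow> 'b::real_normed_vector"
  assumes "P f"
    and step: "\<And>f. P f \<Longrightarrow> f differentiable_on UNIV \<and> (\<forall>j. P (partial_deriv j f))"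
  shows "smooth f"
proof -
  have "\<forall>f. P f \<longrightarrow> P (foldr partial_deriv js f)" for js
    by (induction js) (use step in auto)
  then show ?thesis
    unfolding smooth_def using assms by blast
qed

lemma smooth_differentiable:
  "smooth f \<Longrightarrow> f differentiable (at x)"
  unfolding smooth_def by (metis UNIV_I differentiable_on_def foldr_Nil id_apply)

lemma smooth_partial:
  assumes "smooth f"
  shows "smooth (partial_deriv j f)"
  unfolding smooth_def
proof
  fix js
  \<comment> \<open>\<open>foldr\<close> applies the last list element first, hence
    \<open>js @ [j]\<close> for a derivative taken before those in \<open>js\<close>.\<close>
  show "foldr partial_deriv js (partial_deriv j f) differentiable_on UNIV"
    using assms[unfolded smooth_def, rule_format, of "js @ [j]"] by simp
qed

lemma smooth_continuous: "smooth f \<Longrightarrow> continuous_on UNIV f"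
  unfolding continuous_on_eq_continuous_within
  by (auto intro: differentiable_imp_continuous_within smooth_differentiable)

lemma vec_axis_sum: "(\<Sum>j\<in>UNIV. (k $ j) *\<^sub>R axis j (1::real)) = (k::real^'n::finite)"
  by (simp add: vec_eq_iff axis_def sum.delta if_distrib cong: if_cong)

lemma smooth_has_derivative:
  fixes f :: "real ^ 'n \<Rightarrow> real"
  assumes "f differentiable (at x)"
  shows "(f has_derivative (\<lambda>k. \<Sum>j\<in>UNIV. k $ j * partial_deriv j f x)) (at x)"
proof -
  have d: "(f has_derivative frechet_derivative f (at x)) (at x)"
    using assms frechet_derivative_works by blast
  then have l: "linear (frechet_derivative f (at x))"
    using has_derivative_linear by blast
  have "frechet_derivative f (at x) k = (\<Sum>j\<in>UNIV. k $ j * partial_deriv j f x)" for k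
  proof -
    have "frechet_derivative f (at x) k
        = frechet_derivative f (at x) (\<Sum>j\<in>UNIV. (k $ j) *\<^sub>R axis j 1)"
      by (simp add: vec_axis_sum)
    also have "\<dots> = (\<Sum>j\<in>UNIV. k $ j * partial_deriv j f x)"
      by (simp add: linear_sum[OF l] linear_scale[OF l] partial_deriv_def)
    finally show ?thesis .
  qed
  then have "frechet_derivative f (at x) = (\<lambda>k. \<Sum>j\<in>UNIV. k $ j * partial_deriv j f x)" by auto
  with d show ?thesis by simp
qed

text \<open>The outer factor \<open>k\<close> and the inner factor \<open>a\<close> cover with one
  rule the rescaled mollifiers, the reflections y \<mapsto> x - y and the dilated cutoffs.\<close>

lemma partial_deriv_affine:
  fixes f :: "real ^ 'n \<Rightarrow> real"
  assumes "f differentiable (at (a *\<^sub>R x + c))"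
  shows "(\<lambda>x. k * f (a *\<^sub>R x + c)) differentiable (at x)"
    and "partial_deriv j (\<lambda>x. k * f (a *\<^sub>R x + c)) x = k * a * partial_deriv j f (a *\<^sub>R x + c)"
proof -
  have f: "(f has_derivative frechet_derivative f (at (a *\<^sub>R x + c))) (at (a *\<^sub>R x + c))"
    using assms frechet_derivative_works by blast
  have g: "((\<lambda>x. a *\<^sub>R x + c) has_derivative (\<lambda>y. a *\<^sub>R y)) (at x)"
    by (auto intro!: derivative_eq_intros)
  have "((\<lambda>x. k * f (a *\<^sub>R x + c)) has_derivative
      (\<lambda>y. k * frechet_derivative f (at (a *\<^sub>R x + c)) (a *\<^sub>R y))) (at x)"
    using has_derivative_mult_right[OF has_derivative_compose[OF g f]] by simp
  from differentiableI[OF this] partial_derivI[OF this, of j]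
  show "(\<lambda>x. k * f (a *\<^sub>R x + c)) differentiable (at x)"
    and "partial_deriv j (\<lambda>x. k * f (a *\<^sub>R x + c)) x = k * a * partial_deriv j f (a *\<^sub>R x + c)"
    using linear_scale[OF has_derivative_linear[OF f]] by (auto simp: partial_deriv_def)
qed

lemma smooth_affine:
  fixes f :: "real ^ 'n \<Rightarrow> real"
  assumes "smooth f"
  shows "smooth (\<lambda>x. k * f (a *\<^sub>R x + c))"
\<comment> \<open>Both \<open>f\<close> and \<open>k\<close> vary over the class, since a derivative
  has the same shape with \<open>partial_deriv j f\<close> and factor \<open>k * a\<close>.\<close>
proof (rule smooth_coinduct[where P = "\<lambda>F. \<exists>(f :: real ^ 'n \<Rightarrow> real) k. smooth f \<and> F = (\<lambda>x. k * f (a *\<^sub>R x + c))"])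
  fix F :: "real ^ 'n \<Rightarrow> real" assume "\<exists>f k. smooth f \<and> F = (\<lambda>x. k * f (a *\<^sub>R x + c))"
  then obtain f k where f: "smooth f" and F: "F = (\<lambda>x. k * f (a *\<^sub>R x + c))" by blast
  have "partial_deriv j F = (\<lambda>x. k * a * partial_deriv j f (a *\<^sub>R x + c))" for j
    unfolding F by (rule ext) (rule partial_deriv_affine(2)[OF smooth_differentiable[OF f]])
  then show "F differentiable_on UNIV \<and>
      (\<forall>j. \<exists>f k. smooth f \<and> partial_deriv j F = (\<lambda>x. k * f (a *\<^sub>R x + c)))"
    using smooth_partial[OF f] partial_deriv_affine(1)[OF smooth_differentiable[OF f]]
    unfolding differentiable_on_def F by blast
qed (use assms in blast)

lemma partial_deriv_mult:
  fixes f g :: "real ^ 'n \<Rightarrow> real"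
  assumes "f differentiable (at x)" "g differentiable (at x)"
  shows "partial_deriv j (\<lambda>x. f x * g x) x = f x * partial_deriv j g x + partial_deriv j f x * g x"
proof -
  have "((\<lambda>x. f x * g x) has_derivative (\<lambda>k. f x * frechet_derivative g (at x) k
      + frechet_derivative f (at x) k * g x)) (at x)"
    using assms by (intro has_derivative_mult) (simp_all add: frechet_derivative_works)
  from partial_derivI[OF this] show ?thesis by (simp add: partial_deriv_def)
qed

lemma partial_deriv_add:
  fixes f g :: "real ^ 'n \<Rightarrow> real"
  assumes "f differentiable (at x)" "g differentiable (at x)"
  shows "partial_deriv j (\<lambda>x. f x + g x) x = partial_deriv j f x + partial_deriv j g x"
proof -
  have "((\<lambda>x. f x + g x) has_derivative (\<lambda>k. frechet_derivative f (at x) k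
      + frechet_derivative g (at x) k)) (at x)"
    using assms by (intro has_derivative_add) (simp_all add: frechet_derivative_works)
  from partial_derivI[OF this] show ?thesis by (simp add: partial_deriv_def)
qed

text \<open>Differentiating one product gives a sum of two, so products alone are not closed under
  derivatives; their finite sums are.\<close>

inductive product_sum :: "(real ^ 'n \<Rightarrow> real) \<Rightarrow> bool" where
  mult: "smooth f \<Longrightarrow> smooth g \<Longrightarrow> product_sum (\<lambda>x. f x * g x)"
| add: "product_sum f \<Longrightarrow> product_sum g \<Longrightarrow> product_sum (\<lambda>x. f x + g x)"

lemma smooth_mult:
  fixes f g :: "real ^ 'n \<Rightarrow> real"
  assumes "smooth f" "smooth g"
  shows "smooth (\<lambda>x. f x * g x)"
proof (rule smooth_coinduct[where P = product_sum])
  fix f :: "real ^ 'n \<Rightarrow> real" assume "product_sum f"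
  then show "f differentiable_on UNIV \<and> (\<forall>j. product_sum (partial_deriv j f))"
  proof induction
    case (mult f g)
    have "partial_deriv j (\<lambda>x. f x * g x) = (\<lambda>x. f x * partial_deriv j g x + partial_deriv j f x * g x)" for j
      by (rule ext) (intro partial_deriv_mult smooth_differentiable mult)
    then show ?case
      using mult smooth_differentiable
      by (auto simp: differentiable_on_def intro!: product_sum.intros smooth_partial differentiable_mult)
  next
    case (add f g)
    have "partial_deriv j (\<lambda>x. f x + g x) = (\<lambda>x. partial_deriv j f x + partial_deriv j g x)" for j
      by (rule ext) (use add in \<open>auto intro!: partial_deriv_add simp: differentiable_on_def\<close>)
    then show ?case
      using add by (auto simp: differentiable_on_def intro!: product_sum.intros differentiable_add)
  qed
qed (rule product_sum.mult[OF assms])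

section \<open>Test functions: support, boundedness, integrability\<close>

lemma test_function_iff:
  "test_function f \<longleftrightarrow> smooth f \<and> (\<exists>R. \<forall>x. norm x > R \<longrightarrow> f x = 0)"
proof -
  have "compact (closure {x. f x \<noteq> 0}) \<longleftrightarrow> (\<exists>R. \<forall>x. norm x > R \<longrightarrow> f x = 0)"
    unfolding compact_closure bounded_iff by (simp; meson not_le)
  then show ?thesis by (simp add: test_function_def)
qed

text \<open>The strict inequality makes the region open, so f agrees with 0 on a neighbourhood of
  x.\<close>

lemma partial_deriv_outside_support:
  fixes f :: "real ^ 'n \<Rightarrow> real"
  assumes R: "\<And>x. norm x > R \<Longrightarrow> f x = 0" and x: "norm x > R"
  shows "partial_deriv j f x = 0"
proof -
  have "open {x::real^'n. norm x > R}"
    by (intro open_Collect_less continuous_intros)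
  with has_derivative_const[of 0 "at x"] have "(f has_derivative (\<lambda>_. 0)) (at x)"
    by (rule has_derivative_transform_within_open) (use x R in auto)
  then show ?thesis by (simp add: partial_derivI)
qed

lemma test_function_partial:
  assumes "test_function f"
  shows "test_function (partial_deriv j f)"
  using assms smooth_partial partial_deriv_outside_support unfolding test_function_iff by metis

lemma test_function_mult:
  fixes f g :: "real ^ 'n \<Rightarrow> real"
  assumes "test_function f" "smooth g"
  shows "test_function (\<lambda>x. f x * g x)"
  using assms smooth_mult by (auto simp: test_function_iff)

lemma test_function_affine:
  assumes "test_function f" "a \<noteq> 0"
  shows "test_function (\<lambda>x. k * f (a *\<^sub>R x + c))"
proof -
  from assms obtain R where s: "smooth f" and R: "\<And>x. norm x > R \<Longrightarrow> f x = 0"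
    by (auto simp: test_function_iff)
  have "f (a *\<^sub>R x + c) = 0" if x: "norm x > (R + norm c) / \<bar>a\<bar>" for x
  proof (rule R)
    have "R + norm c < norm (a *\<^sub>R x)"
      using x assms(2) by (simp add: field_simps)
    also have "\<dots> \<le> norm (a *\<^sub>R x + c) + norm c"
      by (metis add_diff_cancel norm_triangle_ineq4)
    finally show "R < norm (a *\<^sub>R x + c)" by simp
  qed
  then show ?thesis unfolding test_function_iff using smooth_affine[OF s] by auto
qed

lemma test_function_bounded:
  assumes "test_function f"
  obtains K R where "K \<ge> 0" "R \<ge> 0" "\<And>x. \<bar>f x\<bar> \<le> K" "\<And>x. norm x > R \<Longrightarrow> f x = 0"
proof -
  from assms obtain R where s: "smooth f" and R: "\<And>x. norm x > R \<Longrightarrow> f x = 0"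
    by (auto simp: test_function_iff)
  have "compact (f ` cball 0 (max R 0))"
    by (intro compact_continuous_image continuous_on_subset[OF smooth_continuous[OF s]]) auto
  then have "bounded (f ` cball 0 (max R 0))" by (rule compact_imp_bounded)
  then obtain K where K: "\<And>x. x \<in> cball 0 (max R 0) \<Longrightarrow> \<bar>f x\<bar> \<le> K"
    unfolding bounded_iff by (metis imageI real_norm_def)
  have "\<bar>f x\<bar> \<le> max K 0" for x
    using K[of x] R[of x] by (cases "norm x > R") (auto simp: le_max_iff_disj)
  then show ?thesis using R by (intro that[of "max K 0" "max R 0"]) auto
qed

lemma test_function_measurable:
  "test_function f \<Longrightarrow> f \<in> borel_measurable borel"
  using smooth_continuous test_function_def borel_measurable_continuous_onI by blast

lemma test_function_uniformly_continuous:
  assumes "test_function f" "e > 0"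
  obtains d where "d > 0" "\<And>x y. norm (x - y) < d \<Longrightarrow> \<bar>f x - f y\<bar> < e"
proof -
  from assms obtain R where s: "smooth f" and R: "\<And>x. norm x > R \<Longrightarrow> f x = 0"
    by (auto simp: test_function_iff)
  \<comment> \<open>The collar of width 1 goes with \<open>min d 1\<close>: if one of two points
    that close lies outside the larger ball, both lie outside the support.\<close>
  have "uniformly_continuous_on (cball 0 (R + 1)) f"
    by (intro compact_uniformly_continuous continuous_on_subset[OF smooth_continuous[OF s]]) auto
  then obtain d where d: "d > 0"
    "\<And>x y. x \<in> cball 0 (R+1) \<Longrightarrow> y \<in> cball 0 (R+1) \<Longrightarrow> dist y x < d \<Longrightarrow> dist (f y) (f x) < e"
    using assms(2) unfolding uniformly_continuous_on_def by meson
  have "\<bar>f x - f y\<bar> < e" if xy: "norm (x - y) < min d 1" for x y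
  proof (cases "norm x \<le> R + 1 \<and> norm y \<le> R + 1")
    case True
    then show ?thesis using d(2)[of y x] xy by (auto simp: dist_norm)
  next
    case False
    have "norm x \<le> norm y + norm (x - y)" "norm y \<le> norm x + norm (x - y)"
      by (metis norm_triangle_sub add.commute, metis norm_triangle_sub norm_minus_commute add.commute)
    then show ?thesis using False xy R[of x] R[of y] assms(2) by auto
  qed
  then show ?thesis using d(1) by (intro that[of "min d 1"]) auto
qed

lemma integrable_bounded_support_scaleR:
  fixes f :: "real ^ 'n \<Rightarrow> 'b::{banach, second_countable_topology}"
  assumes f: "locally_integrable f" and p: "p \<in> borel_measurable borel"
    and K: "\<And>x. \<bar>p x\<bar> \<le> K" and R: "\<And>x. norm x > R \<Longrightarrow> p x = 0"
  shows "integrable lborel (\<lambda>x. p x *\<^sub>R f x)"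
proof -
  have [measurable]: "f \<in> borel_measurable borel" "p \<in> borel_measurable borel"
    using f p unfolding locally_integrable_def by auto
  have i: "integrable lborel (\<lambda>x. indicator (cball 0 R) x *\<^sub>R f x)"
    using f compact_cball unfolding locally_integrable_def set_integrable_def by blast
  show ?thesis
  proof (rule Bochner_Integration.integrable_bound[OF integrable_scaleR_right[OF i, of K]])
    show "AE x in lborel. norm (p x *\<^sub>R f x) \<le> norm (K *\<^sub>R indicat_real (cball 0 R) x *\<^sub>R f x)"
    proof (rule AE_I2)
      fix x
      have "K \<ge> 0" using K[of x] by linarith
      then show "norm (p x *\<^sub>R f x) \<le> norm (K *\<^sub>R indicat_real (cball 0 R) x *\<^sub>R f x)"
        using K[of x] R[of x] by (cases "norm x > R") (auto simp: indicator_def intro!: mult_right_mono)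
    qed
  qed measurable
qed

lemma integrable_test_scaleR:
  fixes f :: "real ^ 'n \<Rightarrow> 'b::{banach, second_countable_topology}"
  assumes "locally_integrable f" "test_function p"
  shows "integrable lborel (\<lambda>x. p x *\<^sub>R f x)"
  using test_function_bounded[OF assms(2)] test_function_measurable[OF assms(2)]
    integrable_bounded_support_scaleR[OF assms(1)] by metis

section \<open>Convolution with a test function\<close>

lemma test_function_reflect:
  assumes "test_function p"
  shows "test_function (\<lambda>y. p (x - y))"
    using test_function_affine[OF assms, of "-1" 1 x] by simp

lemma integrable_convol:
  fixes f :: "real ^ 'n \<Rightarrow> 'b::{banach, second_countable_topology}"
  assumes "locally_integrable f" "test_function p"
  shows "integrable lborel (\<lambda>y. p (x - y) *\<^sub>R f y)"
  by (rule integrable_test_scaleR[OF assms(1) test_function_reflect[OF assms(2)]])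

text \<open>Since the partial derivatives of \<open>p\<close> are uniformly continuous, the
  linearisation error of \<open>p\<close> is at most a small multiple of the norm of the increment,
  uniformly in the base point. Near x all integrands vanish outside one ball, over which f is
  integrable.\<close>

lemma convol_has_derivative:
  fixes f :: "real ^ 'n \<Rightarrow> real"
  assumes f: "locally_integrable f" and p: "test_function p"
  shows "(convol f p has_derivative (\<lambda>k. \<Sum>j\<in>UNIV. k $ j * convol f (partial_deriv j p) x)) (at x)"
  unfolding has_derivative_at_alt
proof (intro conjI allI impI)
  show "bounded_linear (\<lambda>k. \<Sum>j\<in>UNIV. k $ j * convol f (partial_deriv j p) x)"
    by (intro bounded_linear_sum bounded_linear_mult_left[THEN bounded_linear_compose] bounded_linear_vec_nth)
  fix e :: real assume e: "e > 0"
  obtain K R where R: "\<And>x. norm x > R \<Longrightarrow> p x = 0" "R \<ge> 0"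
    using test_function_bounded[OF p] by metis
  define q where "q j = partial_deriv j p" for j
  have q: "test_function (q j)" for j unfolding q_def by (rule test_function_partial[OF p])
  \<comment> \<open>Beyond this radius both x - y and x' - y leave the support of \<open>p\<close>
    when x' is within distance 1 of x.\<close>
  define B where "B = R + 1 + norm x"
  have iB: "integrable lborel (\<lambda>y. indicator (cball 0 B) y *\<^sub>R f y)"
    using f compact_cball unfolding locally_integrable_def set_integrable_def by blast
  define I where "I = (LINT y|lborel. norm (indicat_real (cball 0 B) y *\<^sub>R f y))"
  have I: "I \<ge> 0" unfolding I_def by simp
  \<comment> \<open>The remainder integrates to at most norm k times \<eta> times
    \<open>CARD('n)\<close> times \<open>I\<close>, which must not exceed e times norm k. The
    denominator \<open>I + 1\<close> allows \<open>I = 0\<close>.\<close>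
  define \<eta> where "\<eta> = e / (I + 1) / real CARD('n)"
  have \<eta>: "\<eta> > 0" "\<eta> * real CARD('n) * I \<le> e"
  proof -
    show "\<eta> > 0" unfolding \<eta>_def using e I by (intro divide_pos_pos mult_pos_pos) auto
    have "\<eta> * real CARD('n) * I = e * (I / (I + 1))" by (simp add: \<eta>_def)
    also have "\<dots> \<le> e * 1" using e I by (intro mult_left_mono) auto
    finally show "\<eta> * real CARD('n) * I \<le> e" by simp
  qed
  have "\<exists>d>0. \<forall>x y. norm (x - y) < d \<longrightarrow> \<bar>q j x - q j y\<bar> < \<eta>" for j
    using test_function_uniformly_continuous[OF q \<eta>(1)] by metis
  then obtain D where D: "\<And>j. D j > 0" "\<And>j x y. norm (x - y) < D j \<Longrightarrow> \<bar>q j x - q j y\<bar> < \<eta>"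
    by metis
  define d where "d = min 1 (Min (range D))"
  have d: "d > 0" "d \<le> 1" "d \<le> D j" for j
    using D(1) by (auto simp: d_def min_le_iff_disj)
  have rem: "\<bar>p (z + k) - p z - (\<Sum>j\<in>UNIV. k $ j * q j z)\<bar> \<le> norm k * (\<eta> * real CARD('n))"
    if k: "norm k < d" for z k
  proof -
    \<comment> \<open>Mean value inequality for \<open>p\<close> minus its linearisation at z: on
      the ball each partial derivative differs from its value at z by less than \<eta>.\<close>
    have "norm (p (z + k) - p z - (\<Sum>j\<in>UNIV. (z + k - z) $ j * q j z)) \<le> norm (z + k - z) * (\<eta> * real CARD('n))"
    proof (rule differentiable_bound_linearization[where S = "ball z d"
          and f' = "\<lambda>x k. \<Sum>j\<in>UNIV. k $ j * q j x"])
      fix t :: real assume t: "t \<in> {0..1}"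
      have "\<bar>t\<bar> * norm k \<le> 1 * norm k" using t by (intro mult_right_mono) auto
      then show "z + t *\<^sub>R (z + k - z) \<in> ball z d" using k by (simp add: dist_norm)
    next
      fix y assume "y \<in> ball z d"
      have "p differentiable (at y)" using p smooth_differentiable test_function_def by blast
      from smooth_has_derivative[OF this]
      show "(p has_derivative (\<lambda>k. \<Sum>j\<in>UNIV. k $ j * q j y)) (at y within ball z d)"
        unfolding q_def by (rule has_derivative_at_withinI)
    next
      fix y assume y: "y \<in> ball z d"
      show "onorm ((\<lambda>k. \<Sum>j\<in>UNIV. k $ j * q j y) - (\<lambda>k. \<Sum>j\<in>UNIV. k $ j * q j z)) \<le> \<eta> * real CARD('n)"
      proof (rule onorm_le)
        fix k :: "real^'n"
        have "norm (((\<lambda>k. \<Sum>j\<in>UNIV. k $ j * q j y) - (\<lambda>k. \<Sum>j\<in>UNIV. k $ j * q j z)) k)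
            = \<bar>\<Sum>j\<in>UNIV. k $ j * (q j y - q j z)\<bar>"
          by (simp add: sum_subtractf[symmetric] algebra_simps)
        also have "\<dots> \<le> (\<Sum>j\<in>(UNIV::'n set). norm k * \<eta>)"
        proof (rule order_trans[OF sum_abs], rule sum_mono)
          fix j
          have "\<bar>q j y - q j z\<bar> < \<eta>" using y d(3)[of j] by (intro D(2)) (auto simp: dist_norm norm_minus_commute)
          then show "\<bar>k $ j * (q j y - q j z)\<bar> \<le> norm k * \<eta>"
            unfolding abs_mult by (intro mult_mono component_le_norm_cart) auto
        qed
        finally show "norm (((\<lambda>k. \<Sum>j\<in>UNIV. k $ j * q j y) - (\<lambda>k. \<Sum>j\<in>UNIV. k $ j * q j z)) k)
            \<le> \<eta> * real CARD('n) * norm k" by (simp add: algebra_simps)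
      qed
    qed (use d in auto)
    then show ?thesis by simp
  qed
  show "\<exists>d>0. \<forall>y. norm (y - x) < d \<longrightarrow> norm (convol f p y - convol f p x
      - (\<Sum>j\<in>UNIV. (y - x) $ j * convol f (partial_deriv j p) x)) \<le> e * norm (y - x)"
  proof (intro exI conjI allI impI)
    show "d > 0" by (rule d)
    fix x' assume x': "norm (x' - x) < d"
    define k where "k = x' - x"
    have nk: "norm k < d" using x' k_def by simp
    define r where "r y = p (x' - y) - p (x - y) - (\<Sum>j\<in>UNIV. k $ j * q j (x - y))" for y
    have i1: "integrable lborel (\<lambda>y. p (x' - y) * f y)" "integrable lborel (\<lambda>y. p (x - y) * f y)"
      "integrable lborel (\<lambda>y. q j (x - y) * f y)" for j
      using integrable_convol[OF f p] integrable_convol[OF f q] by auto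
    have ir: "(\<lambda>y. r y * f y) = (\<lambda>y. p (x' - y) * f y - p (x - y) * f y - (\<Sum>j\<in>UNIV. k $ j * (q j (x - y) * f y)))"
      by (rule ext) (simp add: r_def algebra_simps sum_distrib_left sum_distrib_right)
    have eq: "convol f p x' - convol f p x - (\<Sum>j\<in>UNIV. k $ j * convol f (q j) x) = (LINT y|lborel. r y * f y)"
      unfolding ir convol_def
      by (subst Bochner_Integration.integral_diff Bochner_Integration.integral_sum;
        (intro Bochner_Integration.integrable_diff Bochner_Integration.integrable_sum integrable_mult_right i1)?)+
        (simp add: i1)
    have rb: "\<bar>r y * f y\<bar> \<le> norm k * (\<eta> * real CARD('n)) * norm (indicat_real (cball 0 B) y *\<^sub>R f y)" for y
    proof (cases "y \<in> cball 0 B")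
      case True
      have "r y = p (x - y + k) - p (x - y) - (\<Sum>j\<in>UNIV. k $ j * q j (x - y))"
        by (simp add: r_def k_def algebra_simps)
      then have "\<bar>r y\<bar> \<le> norm k * (\<eta> * real CARD('n))" using rem[OF nk, of "x - y"] by simp
      then show ?thesis using True by (simp add: abs_mult mult_right_mono)
    next
      case False
      then have y: "norm y > R + 1 + norm x" by (simp add: B_def)
      have 1: "norm (x - y) > R + 1" using y norm_triangle_ineq2[of y x] by (simp add: norm_minus_commute)
      have "norm (x - y) \<le> norm (x' - y) + norm (x' - x)"
        using norm_triangle_ineq4[of "x' - y" "x' - x"] by simp
      then have 2: "norm (x' - y) > R" using 1 x' d by linarith
      have "q j (x - y) = 0" for j
        unfolding q_def by (rule partial_deriv_outside_support[OF R(1)]) (use 1 in auto)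
      then have "r y = 0" using R(1)[OF 2] R(1)[of "x-y"] 1 by (simp add: r_def)
      then show ?thesis using \<eta>(1) by simp
    qed
    have irf: "integrable lborel (\<lambda>y. r y * f y)"
      unfolding ir
      by (intro Bochner_Integration.integrable_diff Bochner_Integration.integrable_sum integrable_mult_right i1)
    have "\<bar>LINT y|lborel. r y * f y\<bar> \<le> (LINT y|lborel. norm k * (\<eta> * real CARD('n)) * norm (indicat_real (cball 0 B) y *\<^sub>R f y))"
    proof (rule order_trans[OF integral_abs_bound], rule integral_mono)
      show "integrable lborel (\<lambda>y. \<bar>r y * f y\<bar>)" using irf by (rule integrable_abs)
    qed (use iB rb in auto)
    also have "\<dots> = norm k * (\<eta> * real CARD('n)) * I" by (simp add: I_def)
    also have "\<dots> = norm k * (\<eta> * real CARD('n) * I)" by simp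
    also have "\<dots> \<le> norm k * e" using \<eta>(2) by (intro mult_left_mono) auto
    finally show "norm (convol f p x' - convol f p x
      - (\<Sum>j\<in>UNIV. (x' - x) $ j * convol f (partial_deriv j p) x)) \<le> e * norm (x' - x)"
      using eq by (simp add: k_def q_def mult.commute)
  qed
qed

lemma partial_deriv_convol:
  fixes f :: "real ^ 'n \<Rightarrow> real"
  assumes f: "locally_integrable f" and p: "test_function p"
  shows "partial_deriv j (convol f p) = convol f (partial_deriv j p)"
proof
  fix x
  have "(\<Sum>i\<in>UNIV. axis j (1::real) $ i * convol f (partial_deriv i p) x) = (\<Sum>i\<in>{j}. convol f (partial_deriv i p) x)"
    by (rule sum.mono_neutral_cong_right) (auto simp: axis_def)
  then show "partial_deriv j (convol f p) x = convol f (partial_deriv j p) x"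
    by (simp add: partial_derivI[OF convol_has_derivative[OF assms]])
qed

text \<open>Every derivative falls on the test function, so the convolutions of a fixed f with
  arbitrary test functions form a closed class.\<close>

lemma smooth_convol:
  fixes f :: "real ^ 'n \<Rightarrow> real"
  assumes f: "locally_integrable f" and p: "test_function p"
  shows "smooth (convol f p)"
proof (rule smooth_coinduct[where P = "\<lambda>F. \<exists>p. test_function p \<and> F = convol f p"])
  fix F assume "\<exists>p. test_function p \<and> F = convol f p"
  then show "F differentiable_on UNIV \<and> (\<forall>j. \<exists>p. test_function p \<and> partial_deriv j F = convol f p)"
    using differentiableI[OF convol_has_derivative[OF f]] partial_deriv_convol[OF f] test_function_partial
    unfolding differentiable_on_def by blast
qed (use p in blast)

lemma test_function_convol:
  fixes f :: "real ^ 'n \<Rightarrow> real"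
  assumes f: "locally_integrable f" and p: "test_function p" and R: "\<And>x. norm x > R \<Longrightarrow> f x = 0"
  shows "test_function (convol f p)"
proof -
  obtain K Q where Q: "\<And>x. norm x > Q \<Longrightarrow> p x = 0"
    using test_function_bounded[OF p] by metis
  have "convol f p x = 0" if x: "norm x > R + Q" for x
  proof -
    have z: "p (x - y) *\<^sub>R f y = 0" for y
    proof -
      have "norm x \<le> norm (x - y) + norm y" by (metis norm_triangle_sub add.commute)
      then have "norm (x - y) > Q \<or> norm y > R" using x by linarith
      then show ?thesis using Q R by auto
    qed
    show ?thesis unfolding convol_def by (subst z) simp
  qed
  then show ?thesis using smooth_convol[OF f p] by (auto simp: test_function_iff)
qed

section \<open>Continuity of translation\<close>

lemma nn_integral_lborel_affine:
  fixes f :: "'a::euclidean_space \<Rightarrow> ennreal"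
  assumes [measurable]: "f \<in> borel_measurable borel" and c: "c \<noteq> 0"
  shows "(\<integral>\<^sup>+x. f x \<partial>lborel) = ennreal (\<bar>c\<bar> ^ DIM('a)) * (\<integral>\<^sup>+x. f (t + c *\<^sub>R x) \<partial>lborel)"
  by (subst lborel_affine[OF c, of t])
     (simp add: nn_integral_density nn_integral_distr nn_integral_cmult ennreal_power)

lemma integral_lborel_affine:
  fixes f :: "'a::euclidean_space \<Rightarrow> real"
  assumes [measurable]: "f \<in> borel_measurable borel" and c: "c \<noteq> 0"
  shows "(LINT x|lborel. f x) = \<bar>c\<bar> ^ DIM('a) * (LINT x|lborel. f (t + c *\<^sub>R x))"
proof -
  have "(LINT x|lborel. f x) = (LINT x|density (distr lborel borel (\<lambda>x. t + c *\<^sub>R x)) (\<lambda>_. ennreal (\<bar>c\<bar>^DIM('a))). f x)"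
    by (subst lborel_affine[OF c, of t]) (simp add: ennreal_power)
  also have "\<dots> = \<bar>c\<bar> ^ DIM('a) * (LINT x|lborel. f (t + c *\<^sub>R x))"
    by (simp add: integral_density integral_distr)
  finally show ?thesis .
qed

lemma integrable_lborel_translate:
  fixes f :: "'a::euclidean_space \<Rightarrow> real"
  assumes "integrable lborel f"
  shows "integrable lborel (\<lambda>x. f (x + z))"
proof -
  have [measurable]: "f \<in> borel_measurable borel" using assms by auto
  have "(\<integral>\<^sup>+x. ennreal (norm (f (x + z))) \<partial>lborel) = (\<integral>\<^sup>+x. ennreal (norm (f x)) \<partial>lborel)"
    by (subst nn_integral_lborel_affine[of "\<lambda>x. ennreal (norm (f x))" 1 z]) (auto simp: add.commute)
  then show ?thesis using assms by (simp add: integrable_iff_bounded)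
qed

lemma integral_lborel_translate:
  fixes f :: "'a::euclidean_space \<Rightarrow> real"
  assumes "f \<in> borel_measurable borel"
  shows "(LINT x|lborel. f (x + z)) = (LINT x|lborel. f x)"
  using integral_lborel_affine[OF assms, of 1 z] by (simp add: add.commute)

text \<open>For an open set, translation is lower semicontinuous pointwise, and the two one-sided
  differences have equal integrals because translation preserves the measure.\<close>

lemma translation_continuous_open:
  fixes U :: "'a::euclidean_space set"
  assumes U: "open U" "emeasure lborel U < \<infinity>"
  shows "((\<lambda>z. LINT x|lborel. \<bar>indicat_real U (x + z) - indicat_real U x\<bar>) \<longlongrightarrow> 0) (at 0)"
  unfolding tendsto_at_iff_sequentially
proof (intro allI impI)
  fix Z :: "nat \<Rightarrow> 'a" assume "\<forall>i. Z i \<in> UNIV - {0}" and Z: "Z \<longlonglongrightarrow> 0"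
  have [measurable]: "U \<in> sets borel" using U by auto
  have iU: "integrable lborel (indicat_real U)" using U by simp
  note iz = integrable_lborel_translate[OF iU]
  \<comment> \<open>Only this loss part is dominated by the fixed integrable function
    \<open>indicat_real U\<close>; the gain part has a moving support and is recovered from the
    equality of the two integrals.\<close>
  define g where "g z x = max 0 (indicat_real U x - indicat_real U (x + z))" for z x
  have [measurable]: "g z \<in> borel_measurable borel" for z unfolding g_def by measurable
  have ig: "integrable lborel (g z)" for z
    unfolding g_def by (intro integrable_max Bochner_Integration.integrable_diff iU iz) auto
  have eq: "(LINT x|lborel. \<bar>indicat_real U (x + z) - indicat_real U x\<bar>) = 2 * (LINT x|lborel. g z x)" for z
  proof -
    have "(LINT x|lborel. \<bar>indicat_real U (x + z) - indicat_real U x\<bar>)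
        = (LINT x|lborel. 2 * g z x - (indicat_real U x - indicat_real U (x + z)))"
      by (rule Bochner_Integration.integral_cong) (auto simp: g_def max_def)
    also have "\<dots> = 2 * (LINT x|lborel. g z x) - ((LINT x|lborel. indicat_real U x) - (LINT x|lborel. indicat_real U (x + z)))"
      by (simp only: Bochner_Integration.integral_diff[OF integrable_mult_right[OF ig] Bochner_Integration.integrable_diff[OF iU iz]]
            Bochner_Integration.integral_diff[OF iU iz] integral_mult_right_zero)
    also have "\<dots> = 2 * (LINT x|lborel. g z x)"
      by (subst integral_lborel_translate) simp_all
    finally show ?thesis .
  qed
  have "(\<lambda>i. LINT x|lborel. g (Z i) x) \<longlonglongrightarrow> (LINT x|(lborel::'a measure). 0)"
  proof (rule integral_dominated_convergence[where w = "indicat_real U"])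
    show "AE x in lborel. (\<lambda>i. g (Z i) x) \<longlonglongrightarrow> 0"
    proof (rule AE_I2)
      fix x
      show "(\<lambda>i. g (Z i) x) \<longlonglongrightarrow> 0"
      proof (cases "x \<in> U")
        case True
        have "(\<lambda>i. x + Z i) \<longlonglongrightarrow> x" using tendsto_add[OF tendsto_const Z, of x] by simp
        then have "\<forall>\<^sub>F i in sequentially. x + Z i \<in> U" using U(1) True topological_tendstoD by blast
        then have "\<forall>\<^sub>F i in sequentially. g (Z i) x = 0"
          by eventually_elim (auto simp: g_def True)
        then show ?thesis by (rule tendsto_eventually)
      next
        case False
        then show ?thesis by (simp add: g_def)
      qed
    qed
    show "AE x in lborel. norm (g (Z i) x) \<le> indicat_real U x" for i
      by (rule AE_I2) (auto simp: g_def indicator_def)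
  qed (use iU in auto)
  then have "(\<lambda>i. 2 * (LINT x|lborel. g (Z i) x)) \<longlonglongrightarrow> 0"
    using tendsto_mult_right_zero[of _ _ 2] by simp
  then show "((\<lambda>z. LINT x|lborel. \<bar>indicat_real U (x + z) - indicat_real U x\<bar>) \<circ> Z) \<longlonglongrightarrow> 0"
    by (simp add: eq o_def)
qed

text \<open>Continuity of translation is stable under L1 approximation: replacing f by g costs the
  approximation error twice, at x and at x + z, and the shifted error has the same integral by
  translation invariance.\<close>

lemma translation_continuous_perturb:
  fixes f :: "'a::euclidean_space \<Rightarrow> real"
  assumes f: "integrable lborel f"
    and ex: "\<And>e. e > 0 \<Longrightarrow> \<exists>g. integrable lborel g \<and> (LINT x|lborel. \<bar>f x - g x\<bar>) < e \<and>
      ((\<lambda>z. LINT x|lborel. \<bar>g (x + z) - g x\<bar>) \<longlongrightarrow> 0) (at 0)"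
  shows "((\<lambda>z. LINT x|lborel. \<bar>f (x + z) - f x\<bar>) \<longlongrightarrow> 0) (at 0)"
proof (rule tendstoI)
  fix e :: real assume "e > 0"
  then obtain g where g: "integrable lborel g" and d: "(LINT x|lborel. \<bar>f x - g x\<bar>) < e / 3"
    and lim: "((\<lambda>z. LINT x|lborel. \<bar>g (x + z) - g x\<bar>) \<longlongrightarrow> 0) (at 0)"
    using ex[of "e / 3"] by auto
  have fz: "integrable lborel (\<lambda>x. f (x + z))" and gz: "integrable lborel (\<lambda>x. g (x + z))" for z
    using f g integrable_lborel_translate by blast+
  have le: "(LINT x|lborel. \<bar>f (x + z) - f x\<bar>)
      \<le> 2 * (LINT x|lborel. \<bar>f x - g x\<bar>) + (LINT x|lborel. \<bar>g (x + z) - g x\<bar>)" for z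
  proof -
    have i: "integrable lborel (\<lambda>x. \<bar>f (x + z) - g (x + z)\<bar>)" "integrable lborel (\<lambda>x. \<bar>f x - g x\<bar>)"
      "integrable lborel (\<lambda>x. \<bar>g (x + z) - g x\<bar>)"
      using f g fz gz by auto
    have "(LINT x|lborel. \<bar>f (x + z) - f x\<bar>)
      \<le> (LINT x|lborel. \<bar>f (x + z) - g (x + z)\<bar> + \<bar>f x - g x\<bar> + \<bar>g (x + z) - g x\<bar>)"
      by (rule integral_mono) (use f g fz gz in auto)
    also have "\<dots> = (LINT x|lborel. \<bar>f (x + z) - g (x + z)\<bar>) + (LINT x|lborel. \<bar>f x - g x\<bar>)
        + (LINT x|lborel. \<bar>g (x + z) - g x\<bar>)"
      using i by simp
    also have "(LINT x|lborel. \<bar>f (x + z) - g (x + z)\<bar>) = (LINT x|lborel. \<bar>f x - g x\<bar>)"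
      using integral_lborel_translate[of "\<lambda>x. \<bar>f x - g x\<bar>" z] f g by simp
    finally show ?thesis by simp
  qed
  have "\<forall>\<^sub>F z in at 0. \<bar>LINT x|lborel. \<bar>g (x + z) - g x\<bar>\<bar> < e / 3"
    using tendstoD[OF lim, of "e / 3"] \<open>e > 0\<close> by (simp add: dist_real_def)
  then show "\<forall>\<^sub>F z in at 0. dist (LINT x|lborel. \<bar>f (x + z) - f x\<bar>) 0 < e"
  proof eventually_elim
    case (elim z)
    have "0 \<le> (LINT x|lborel. \<bar>f (x + z) - f x\<bar>)" by simp
    then show ?case using elim le[of z] d by (simp add: dist_real_def)
  qed
qed

text \<open>Induction over integrable functions. Outer regularity extends the case of open sets to
  indicators, and the perturbation lemma carries the claim to limits.\<close>

lemma L1_translation_continuous: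
  fixes f :: "'a::euclidean_space \<Rightarrow> real"
  assumes "integrable lborel f"
  shows "((\<lambda>z. LINT x|lborel. \<bar>f (x + z) - f x\<bar>) \<longlongrightarrow> 0) (at 0)"
  using assms
proof (induction rule: integrable_induct)
  case (base A c)
  have [measurable]: "A \<in> sets borel" using base by simp
  have iA: "integrable lborel (indicat_real A)" using base by simp
  have 1: "((\<lambda>z. LINT x|lborel. \<bar>indicat_real A (x + z) - indicat_real A x\<bar>) \<longlongrightarrow> 0) (at 0)"
  proof (rule translation_continuous_perturb[OF iA])
    fix e :: real assume e: "e > 0"
    then obtain U where U: "open U" "A \<subseteq> U" "emeasure lborel (U - A) < e"
      using outer_regular_lborel[of A e] by auto
    have [measurable]: "U \<in> sets borel" using U by auto
    have "emeasure lborel U \<le> emeasure lborel (U - A) + emeasure lborel A"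
      using U by (metis Un_Diff_cancel2 Un_absorb2 emeasure_subadditive sets.Diff sets_lborel \<open>A \<in> sets borel\<close> \<open>U \<in> sets borel\<close>)
    also have "\<dots> < \<infinity>" using base U(3) by (simp add: less_top[symmetric] top.extremum_strict order_less_le_trans[of _ "ennreal e"])
        (metis ennreal_less_top less_trans not_less_iff_gr_or_eq)
    finally have fin: "emeasure lborel U < \<infinity>" .
    have "(LINT x|lborel. \<bar>indicat_real A x - indicat_real U x\<bar>) = (LINT x|lborel. indicat_real (U - A) x)"
      by (rule Bochner_Integration.integral_cong) (use U in \<open>auto simp: indicator_def\<close>)
    also have "\<dots> = measure lborel (U - A)" by simp
    also have "\<dots> < e" using U(3) e
      by (metis emeasure_eq_ennreal_measure ennreal_less_iff less_top_ennreal measure_nonneg top.not_eq_extremum ennreal_less_top less_trans)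
    finally show "\<exists>g. integrable lborel g \<and> (LINT x|lborel. \<bar>indicat_real A x - g x\<bar>) < e \<and>
      ((\<lambda>z. LINT x|lborel. \<bar>g (x + z) - g x\<bar>) \<longlongrightarrow> 0) (at 0)"
      using translation_continuous_open[OF U(1) fin] fin by (intro exI[of _ "indicat_real U"]) auto
  qed
  have "\<bar>indicat_real A (x + z) *\<^sub>R c - indicat_real A x *\<^sub>R c\<bar> = \<bar>c\<bar> * \<bar>indicat_real A (x + z) - indicat_real A x\<bar>" for x z
    by (simp add: abs_mult[symmetric] algebra_simps)
  then show ?case using tendsto_mult_right_zero[OF 1, of "\<bar>c\<bar>"] by simp
next
  case (add f g)
  have fz: "integrable lborel (\<lambda>x. f (x + z))" and gz: "integrable lborel (\<lambda>x. g (x + z))" for z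
    using add integrable_lborel_translate by blast+
  have le: "(LINT x|lborel. \<bar>f (x + z) + g (x + z) - (f x + g x)\<bar>) \<le>
      (LINT x|lborel. \<bar>f (x + z) - f x\<bar>) + (LINT x|lborel. \<bar>g (x + z) - g x\<bar>)" for z
  proof -
    have i: "integrable lborel (\<lambda>x. \<bar>f (x + z) - f x\<bar>)" "integrable lborel (\<lambda>x. \<bar>g (x + z) - g x\<bar>)"
      using add fz gz by auto
    have "(LINT x|lborel. \<bar>f (x + z) + g (x + z) - (f x + g x)\<bar>)
        \<le> (LINT x|lborel. \<bar>f (x + z) - f x\<bar> + \<bar>g (x + z) - g x\<bar>)"
      by (rule integral_mono) (use add fz gz in auto)
    then show ?thesis using i by simp
  qed
  show ?case
    by (rule tendsto_sandwich[OF _ _ tendsto_const tendsto_add_zero[OF add(3,4)]])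
      (use le in auto)
next
  case (lim f s)
  show ?case
  proof (rule translation_continuous_perturb[OF lim.hyps(4)])
    fix e :: real assume e: "e > 0"
    have [measurable]: "f \<in> borel_measurable borel" "s i \<in> borel_measurable borel" for i
      using lim.hyps(1)[of i] lim.hyps(4) by auto
    have "(\<lambda>i. LINT x|lborel. \<bar>f x - s i x\<bar>) \<longlonglongrightarrow> (LINT x|(lborel::'a measure). 0)"
    \<comment> \<open>The induction rule gives norm (s i x) at most twice norm (f x), hence the
      factor 3.\<close>
    proof (rule integral_dominated_convergence[where w = "\<lambda>x. 3 * norm (f x)"])
      show "AE x in lborel. (\<lambda>i. \<bar>f x - s i x\<bar>) \<longlonglongrightarrow> 0"
        using lim.hyps(2) by (intro AE_I2 tendsto_rabs_zero) (simp add: LIM_zero_iff tendsto_diff[of "\<lambda>_. f x" "f x" _ "\<lambda>i. s i x" "f x" for x, simplified])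
      show "AE x in lborel. norm \<bar>f x - s i x\<bar> \<le> 3 * norm (f x)" for i
      proof (rule AE_I2)
        fix x show "norm \<bar>f x - s i x\<bar> \<le> 3 * norm (f x)" using lim.hyps(3)[of x i] by simp
      qed
    qed (use lim.hyps(4) in auto)
    then have "(\<lambda>i. LINT x|lborel. \<bar>f x - s i x\<bar>) \<longlonglongrightarrow> 0" by simp
    from order_tendstoD(2)[OF this e]
    have "\<forall>\<^sub>F i in sequentially. (LINT x|lborel. \<bar>f x - s i x\<bar>) < e" .
    then obtain i where "(LINT x|lborel. \<bar>f x - s i x\<bar>) < e"
      unfolding eventually_sequentially by auto
    then show "\<exists>g. integrable lborel g \<and> (LINT x|lborel. \<bar>f x - g x\<bar>) < e \<and>
      ((\<lambda>z. LINT x|lborel. \<bar>g (x + z) - g x\<bar>) \<longlongrightarrow> 0) (at 0)"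
      using lim.hyps(1) lim.IH by blast
  qed
qed

lemma L2_real_iff:
  fixes f :: "real ^ 'n \<Rightarrow> real"
  shows "L2 f \<longleftrightarrow> f \<in> borel_measurable borel \<and> integrable lborel (\<lambda>x. (f x)\<^sup>2)"
  by (simp add: L2_def)

lemma L2_norm_real: "(L2_norm (f :: real ^ 'n \<Rightarrow> real))\<^sup>2 = (LINT x|lborel. (f x)\<^sup>2)"
  by (simp add: L2_norm_def)

text \<open>The signed square \<open>a * \<bar>a\<bar>\<close> has modulus \<open>a\<^sup>2\<close>,
  so it maps L2 into L1, and this inequality turns L1 continuity of translation into L2 continuity.
  The factor 2 is attained for \<open>b = - a\<close>.\<close>

lemma sq_diff_le:
  "(a - b)\<^sup>2 \<le> 2 * \<bar>a * \<bar>a\<bar> - b * \<bar>b\<bar>\<bar>" for a b :: real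
proof -
  have 1: "(a - b)\<^sup>2 \<le> 2 * \<bar>a * \<bar>a\<bar> - b * \<bar>b\<bar>\<bar>" if "0 \<le> b" "b \<le> a" for a b :: real
  proof -
    have "b * (a - b) \<ge> 0" using that by simp
    moreover have "b * b \<le> a * a" using that by (intro mult_mono) auto
    moreover have "0 \<le> a * a" by simp
    ultimately show ?thesis using that by (simp add: power2_eq_square algebra_simps)
  qed
  have 2: "(a - b)\<^sup>2 \<le> 2 * \<bar>a * \<bar>a\<bar> - b * \<bar>b\<bar>\<bar>" if "0 \<le> a" "b \<le> 0" for a b :: real
  proof -
    have "0 \<le> (a + b)\<^sup>2" by simp
    moreover have "0 \<le> a * a" "0 \<le> b * b" by simp_all
    ultimately show ?thesis using that by (simp add: power2_eq_square algebra_simps)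
  qed
  consider "0 \<le> a" "0 \<le> b" "b \<le> a" | "0 \<le> a" "0 \<le> b" "a \<le> b" | "a \<le> 0" "b \<le> 0" "a \<le> b"
    | "a \<le> 0" "b \<le> 0" "b \<le> a" | "0 \<le> a" "b \<le> 0" | "a \<le> 0" "0 \<le> b" by linarith
  then show ?thesis
  proof cases
    case 1 then show ?thesis using \<open>\<lbrakk>0 \<le> b; b \<le> a\<rbrakk> \<Longrightarrow> _\<close> by blast
  next
    case 2 then show ?thesis using 1[of a b] by (metis power2_commute abs_minus_commute)
  next
    case 3 then show ?thesis using 1[of "-b" "-a"] by (simp add: power2_eq_square algebra_simps abs_minus_commute)
  next
    case 4 then show ?thesis using 1[of "-a" "-b"] by (simp add: power2_eq_square algebra_simps abs_minus_commute)
  next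
    case 5 then show ?thesis by (rule 2)
  next
    case 6 then show ?thesis using 2[of b a] by (metis power2_commute abs_minus_commute)
  qed
qed

lemma L2_translation_continuous:
  fixes f :: "real ^ 'n \<Rightarrow> real"
  assumes f: "L2 f"
  shows "((\<lambda>z. LINT x|lborel. (f (x + z) - f x)\<^sup>2) \<longlongrightarrow> 0) (at 0)"
proof -
  define g where "g x = f x * \<bar>f x\<bar>" for x
  have [measurable]: "f \<in> borel_measurable borel" using f by (simp add: L2_real_iff)
  have ig: "integrable lborel g"
  proof (rule Bochner_Integration.integrable_bound)
    show "integrable lborel (\<lambda>x. (f x)\<^sup>2)" using f by (simp add: L2_real_iff)
    show "AE x in lborel. norm (g x) \<le> norm ((f x)\<^sup>2)"
      by (rule AE_I2) (simp add: g_def power2_eq_square abs_mult)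
  qed (simp add: g_def[abs_def])
  note igz = integrable_lborel_translate[OF ig]
  have le: "(LINT x|lborel. (f (x + z) - f x)\<^sup>2) \<le> 2 * (LINT x|lborel. \<bar>g (x + z) - g x\<bar>)" for z
  proof -
    have i: "integrable lborel (\<lambda>x. 2 * \<bar>g (x + z) - g x\<bar>)" using ig igz by auto
    have "integrable lborel (\<lambda>x. (f (x + z) - f x)\<^sup>2)"
      by (rule Bochner_Integration.integrable_bound[OF i]) (use sq_diff_le in \<open>auto simp: g_def\<close>)
    then have "(LINT x|lborel. (f (x + z) - f x)\<^sup>2) \<le> (LINT x|lborel. 2 * \<bar>g (x + z) - g x\<bar>)"
      by (rule integral_mono[OF _ i]) (use sq_diff_le in \<open>auto simp: g_def\<close>)
    then show ?thesis by simp
  qed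
  show ?thesis
    by (rule tendsto_sandwich[OF _ _ tendsto_const tendsto_mult_right_zero[OF L1_translation_continuous[OF ig], of 2]])
      (use le in auto)
qed

section \<open>Mollification in \<open>L\<^sup>2\<close>\<close>

lemma L2_measurable:
  fixes f :: "real ^ 'n \<Rightarrow> real"
  shows "L2 f \<Longrightarrow> f \<in> borel_measurable borel"
  by (simp add: L2_real_iff)

lemma L2_integrable_mult:
  fixes f g :: "real ^ 'n \<Rightarrow> real"
  assumes f: "L2 f" and g: "L2 g"
  shows "integrable lborel (\<lambda>x. f x * g x)"
proof (rule Bochner_Integration.integrable_bound)
  show "integrable lborel (\<lambda>x. (f x)\<^sup>2 + (g x)\<^sup>2)"
    using f g by (simp add: L2_real_iff)
  show "AE x in lborel. norm (f x * g x) \<le> norm ((f x)\<^sup>2 + (g x)\<^sup>2)"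
  proof (rule AE_I2)
    fix x
    have "0 \<le> (\<bar>f x\<bar> - \<bar>g x\<bar>)\<^sup>2" by simp
    then have "2 * (\<bar>f x\<bar> * \<bar>g x\<bar>) \<le> (f x)\<^sup>2 + (g x)\<^sup>2"
      by (simp add: power2_eq_square algebra_simps)
    moreover have "0 \<le> \<bar>f x\<bar> * \<bar>g x\<bar>" by (intro mult_nonneg_nonneg) auto
    ultimately have "\<bar>f x\<bar> * \<bar>g x\<bar> \<le> (f x)\<^sup>2 + (g x)\<^sup>2" by linarith
    then show "norm (f x * g x) \<le> norm ((f x)\<^sup>2 + (g x)\<^sup>2)" by (simp add: abs_mult)
  qed
qed (use f g in \<open>auto simp: L2_real_iff\<close>)

lemma L2_scale:
  fixes f :: "real ^ 'n \<Rightarrow> real"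
  shows "L2 f \<Longrightarrow> L2 (\<lambda>x. c * f x)"
  by (auto simp: L2_real_iff power_mult_distrib)

lemma L2_add:
  fixes f g :: "real ^ 'n \<Rightarrow> real"
  assumes f: "L2 f" and g: "L2 g"
  shows "L2 (\<lambda>x. f x + g x)"
  using assms L2_integrable_mult[OF assms]
  by (auto simp: L2_real_iff power2_sum mult.assoc)

lemma L2_diff:
  fixes f g :: "real ^ 'n \<Rightarrow> real"
  assumes f: "L2 f" and g: "L2 g"
  shows "L2 (\<lambda>x. f x - g x)"
  using L2_add[OF f L2_scale[OF g, of "-1"]] by simp

lemma L2_locally_integrable:
  fixes f :: "real ^ 'n \<Rightarrow> real"
  assumes f: "L2 f"
  shows "locally_integrable f"
  unfolding locally_integrable_def set_integrable_def
proof (intro conjI allI impI)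
  show "f \<in> borel_measurable lborel" using f by (simp add: L2_real_iff)
  fix K :: "(real^'n) set" assume K: "compact K"
  then have [measurable]: "K \<in> sets borel" by (simp add: borel_compact)
  have "L2 (indicat_real K)"
    using emeasure_compact_finite[OF K]
    by (simp add: L2_real_iff power2_eq_square flip: indicator_inter_arith)
  from L2_integrable_mult[OF this f] show "integrable lborel (\<lambda>x. indicat_real K x *\<^sub>R f x)" by simp
qed

section \<open>The inner product of L2\<close>

definition ip :: "(real ^ 'n \<Rightarrow> real) \<Rightarrow> (real ^ 'n \<Rightarrow> real) \<Rightarrow> real" where
  "ip f g = (LINT x|lborel. f x * g x)"

lemma ip_commute: "ip f g = ip g f"
  by (simp add: ip_def mult.commute)

lemma ip_add_left: "L2 f \<Longrightarrow> L2 g \<Longrightarrow> L2 h \<Longrightarrow> ip (\<lambda>x. f x + g x) h = ip f h + ip g h"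
  by (simp add: ip_def distrib_right L2_integrable_mult)

lemma ip_diff_left: "L2 f \<Longrightarrow> L2 g \<Longrightarrow> L2 h \<Longrightarrow> ip (\<lambda>x. f x - g x) h = ip f h - ip g h"
  by (simp add: ip_def left_diff_distrib L2_integrable_mult)

lemma ip_scale_left: "ip (\<lambda>x. c * f x) h = c * ip f h"
  by (simp add: ip_def mult.assoc)

lemma ip_add_right: "L2 f \<Longrightarrow> L2 g \<Longrightarrow> L2 h \<Longrightarrow> ip h (\<lambda>x. f x + g x) = ip h f + ip h g"
  using ip_add_left[of f g h] by (simp add: ip_commute[of h])

lemma ip_diff_right: "L2 f \<Longrightarrow> L2 g \<Longrightarrow> L2 h \<Longrightarrow> ip h (\<lambda>x. f x - g x) = ip h f - ip h g"
  using ip_diff_left[of f g h] by (simp add: ip_commute[of h])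

lemma ip_scale_right: "ip h (\<lambda>x. c * f x) = c * ip h f"
  using ip_scale_left[of c f h] by (simp add: ip_commute[of h])

lemma L2_norm_ge0 [simp]: "L2_norm f \<ge> 0"
  by (simp add: L2_norm_def)

lemma L2_norm_ip: "(L2_norm f)\<^sup>2 = ip f f"
  unfolding L2_norm_real ip_def by (simp add: power2_eq_square)

lemma ip_bound:
  assumes f: "L2 f" and g: "L2 g"
  shows "\<bar>ip f g\<bar> \<le> L2_norm f * L2_norm g"
proof -
  have "(ip f g)\<^sup>2 \<le> ip f f * ip g g"
  proof -
    have q: "0 \<le> a\<^sup>2 * ip f f - 2 * (a * b * ip f g) + b\<^sup>2 * ip g g" for a b
    proof -
      define k where "k x = a * f x - b * g x" for x
      have "ip k k = a * a * ip f f - a * b * ip f g - b * a * ip g f + b * b * ip g g"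
        unfolding k_def
        by (simp add: ip_diff_left ip_diff_right L2_diff L2_scale f g ip_scale_left ip_scale_right algebra_simps)
      moreover have "0 \<le> ip k k" by (simp add: ip_def)
      ultimately show ?thesis by (simp add: ip_commute[of g f] power2_eq_square algebra_simps)
    qed
    show ?thesis
    proof (cases "ip g g = 0")
      case True
      have "ip f g = 0"
      proof (rule ccontr)
        assume n: "ip f g \<noteq> 0"
        \<comment> \<open>With a vanishing quadratic coefficient the form is affine in
          \<open>b\<close>; this \<open>b\<close> makes it equal to -1 at
          \<open>a = 1\<close>.\<close>
        have "0 \<le> ip f f - 2 * ((ip f f + 1) / (2 * ip f g) * ip f g)"
          using q[of 1 "(ip f f + 1) / (2 * ip f g)"] True by simp
        then show False using n by simp
      qed
      then show ?thesis by (simp add: True)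
    next
      case False
      then have p: "ip g g > 0" by (simp flip: L2_norm_ip)
      \<comment> \<open>The choice \<open>a = ip g g\<close>, \<open>b = ip f g\<close> is the
        minimising ratio, scaled so that nothing is divided.\<close>
      have "0 \<le> ip g g * (ip f f * ip g g - (ip f g)\<^sup>2)"
        using q[of "ip g g" "ip f g"] by (simp add: power2_eq_square algebra_simps)
      then show ?thesis using p by (simp add: zero_le_mult_iff)
    qed
  qed
  also have "\<dots> = (L2_norm f * L2_norm g)\<^sup>2"
    by (simp add: power_mult_distrib L2_norm_ip)
  finally show ?thesis by (simp add: abs_le_square_iff[symmetric])
qed

lemma L2_norm_triangle:
  fixes f g :: "real ^ 'n \<Rightarrow> real"
  assumes f: "L2 f" and g: "L2 g"
  shows "L2_norm (\<lambda>x. f x + g x) \<le> L2_norm f + L2_norm g"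
proof (rule power2_le_imp_le)
  have "(L2_norm (\<lambda>x. f x + g x))\<^sup>2 = ip f f + 2 * ip f g + ip g g"
    by (simp add: L2_norm_ip ip_add_left ip_add_right L2_add f g ip_commute[of g f])
  also have "\<dots> \<le> ip f f + 2 * (L2_norm f * L2_norm g) + ip g g"
    using ip_bound[OF f g] by simp
  also have "\<dots> = (L2_norm f + L2_norm g)\<^sup>2"
    by (simp add: L2_norm_ip[symmetric] power2_eq_square algebra_simps)
  finally show "(L2_norm (\<lambda>x. f x + g x))\<^sup>2 \<le> (L2_norm f + L2_norm g)\<^sup>2" .
qed simp

lemma L2_norm_scale:
  fixes f :: "real ^ 'n \<Rightarrow> real"
  shows "L2_norm (\<lambda>x. c * f x) = \<bar>c\<bar> * L2_norm f"
  by (simp add: L2_norm_def power_mult_distrib real_sqrt_mult)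

lemma L2_norm_triangle_diff:
  fixes f g :: "real ^ 'n \<Rightarrow> real"
  assumes f: "L2 f" and g: "L2 g"
  shows "L2_norm (\<lambda>x. f x - g x) \<le> L2_norm f + L2_norm g"
  using L2_norm_triangle[OF f L2_scale[OF g, of "-1"]] L2_norm_scale[of "-1" g] by simp

lemma L2_weight:
  fixes f m :: "real ^ 'n \<Rightarrow> real"
  assumes f: "L2 f" and m: "m \<in> borel_measurable borel" and b: "AE x in lborel. \<bar>m x\<bar> \<le> M"
  shows "L2 (\<lambda>x. m x * f x)" and "L2_norm (\<lambda>x. m x * f x) \<le> M * L2_norm f"
proof -
  note [measurable] = m L2_measurable[OF f]
  have i: "integrable lborel (\<lambda>x. M\<^sup>2 * (f x)\<^sup>2)" using f by (simp add: L2_real_iff)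
  have le: "AE x in lborel. (m x * f x)\<^sup>2 \<le> M\<^sup>2 * (f x)\<^sup>2"
    using b
  proof eventually_elim
    case (elim x)
    then have "(m x)\<^sup>2 \<le> M\<^sup>2" by (metis abs_le_square_iff abs_ge_zero abs_of_nonneg order_trans)
    then show ?case by (simp add: power_mult_distrib mult_right_mono)
  qed
  have i2: "integrable lborel (\<lambda>x. (m x * f x)\<^sup>2)"
    by (rule Bochner_Integration.integrable_bound[OF i]) (use le in auto)
  then show "L2 (\<lambda>x. m x * f x)" by (simp add: L2_real_iff)
  \<comment> \<open>Nonnegativity of \<open>M\<close> follows from the bound itself: it holds at
    some point because Lebesgue measure is not zero.\<close>
  have M: "M \<ge> 0"
  proof -
    have "\<exists>x. \<bar>m x\<bar> \<le> M"
    proof (rule ccontr)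
      assume "\<nexists>x. \<bar>m x\<bar> \<le> M"
      then have "AE x in (lborel::(real^'n) measure). False" using b by simp
      then show False by (simp add: ae_filter_eq_bot_iff emeasure_lborel_UNIV)
    qed
    then show ?thesis by (meson abs_ge_zero order_trans)
  qed
  have "(L2_norm (\<lambda>x. m x * f x))\<^sup>2 \<le> (M * L2_norm f)\<^sup>2"
    using integral_mono_AE[OF i2 i le] by (simp add: L2_norm_real power_mult_distrib)
  then show "L2_norm (\<lambda>x. m x * f x) \<le> M * L2_norm f"
    by (rule power2_le_imp_le) (simp add: M)
qed

section \<open>Mollifiers as probability densities\<close>

lemma mollifier_shift:
  fixes \<psi> :: "real ^ 'n \<Rightarrow> real"
  assumes "mollifier \<psi>"
  shows "integrable lborel (\<lambda>y. \<psi> (x - y))" "(LINT y|lborel. \<psi> (x - y)) = 1"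
    "(\<integral>\<^sup>+ y. ennreal (\<psi> (x - y)) \<partial>lborel) = 1"
proof -
  have t: "test_function \<psi>" and p: "\<And>x. 0 \<le> \<psi> x" and i: "(LINT x|lborel. \<psi> x) = 1"
    using assms by (auto simp: mollifier_def)
  have "locally_integrable (\<lambda>_::real^'n. 1::real)"
    by (auto simp: locally_integrable_def set_integrable_def borel_compact
        intro!: integrable_real_indicator emeasure_compact_finite[simplified])
  from integrable_convol[OF this t] show 1: "integrable lborel (\<lambda>y. \<psi> (x - y))" by simp
  note [measurable] = test_function_measurable[OF t]
  show 2: "(LINT y|lborel. \<psi> (x - y)) = 1"
    using integral_lborel_affine[of \<psi> "-1" x] i by simp
  show "(\<integral>\<^sup>+ y. ennreal (\<psi> (x - y)) \<partial>lborel) = 1"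
    using nn_integral_eq_integral[OF 1] p 2 by simp
qed

lemma mollifier_scaled:
  fixes \<psi> :: "real ^ 'n \<Rightarrow> real"
  assumes m: "mollifier \<psi>" and e: "\<epsilon> > 0"
  shows "mollifier (scaled \<psi> \<epsilon>)"
proof -
  have t: "test_function \<psi>" and p: "\<And>x. 0 \<le> \<psi> x" and i: "(LINT x|lborel. \<psi> x) = 1"
    using m by (auto simp: mollifier_def)
  note [measurable] = test_function_measurable[OF t]
  have eq: "scaled \<psi> \<epsilon> = (\<lambda>x. (1 / \<epsilon> ^ CARD('n)) * \<psi> (inverse \<epsilon> *\<^sub>R x + 0))"
    by (rule ext) (simp add: scaled_def)
  have ts: "test_function (scaled \<psi> \<epsilon>)"
    unfolding eq by (rule test_function_affine[OF t]) (use e in simp)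
  have J: "(LINT x|lborel. \<psi> (inverse \<epsilon> *\<^sub>R x + 0)) = \<epsilon> ^ CARD('n)"
  proof -
    define J where "J = (LINT x|lborel. \<psi> (inverse \<epsilon> *\<^sub>R x + 0))"
    have "1 = inverse (\<epsilon> ^ CARD('n)) * J"
      using integral_lborel_affine[of \<psi> "inverse \<epsilon>" 0] i e by (simp add: power_inverse J_def)
    then show ?thesis unfolding J_def[symmetric] using e by (simp add: divide_simps split: if_splits)
  qed
  have "(LINT x|lborel. scaled \<psi> \<epsilon> x) = 1"
    unfolding eq integral_mult_right_zero J using e by simp
  moreover have "0 \<le> scaled \<psi> \<epsilon> x" for x using p e by (simp add: scaled_def)
  ultimately show ?thesis using ts by (simp add: mollifier_def)
qed

lemma mollifier_support:
  assumes "mollifier \<psi>"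
  obtains R where "R \<ge> 0" "\<And>x \<epsilon>. \<epsilon> > 0 \<Longrightarrow> norm x > R * \<epsilon> \<Longrightarrow> scaled \<psi> \<epsilon> x = 0"
proof -
  obtain K R where R: "R \<ge> 0" "\<And>x. norm x > R \<Longrightarrow> \<psi> x = 0"
    using assms test_function_bounded unfolding mollifier_def by metis
  have "scaled \<psi> \<epsilon> x = 0" if "\<epsilon> > 0" "norm x > R * \<epsilon>" for x \<epsilon>
    using that R(2)[of "x /\<^sub>R \<epsilon>"] by (simp add: scaled_def field_simps)
  with R that show ?thesis by blast
qed

text \<open>Jensen's inequality for the square under the probability density \<psi>(x - y). The
  variance about the mean is nonnegative, which bounds the squared mean by the second moment;
  expanding around \<open>a\<close> gives the general case.\<close>

lemma mollifier_jensen: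
  fixes f :: "real ^ 'n \<Rightarrow> real"
  assumes f: "L2 f" and m: "mollifier \<psi>"
  shows "integrable lborel (\<lambda>y. \<psi> (x - y) * (f y - a)\<^sup>2)"
    and "(convol f \<psi> x - a)\<^sup>2 \<le> (LINT y|lborel. \<psi> (x - y) * (f y - a)\<^sup>2)"
proof -
  have t: "test_function \<psi>" and p: "\<And>x. 0 \<le> \<psi> x"
    using m by (auto simp: mollifier_def)
  note i0 = mollifier_shift(1,2)[OF m, of x]
  have i1: "integrable lborel (\<lambda>y. \<psi> (x - y) * f y)"
    using integrable_convol[OF L2_locally_integrable[OF f] t] by simp
  have "locally_integrable (\<lambda>x. (f x)\<^sup>2)"
    using f unfolding locally_integrable_def set_integrable_def L2_real_iff
    by (auto simp del: real_scaleR_def intro!: integrable_mult_indicator borel_compact)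
  from integrable_convol[OF this t] have i2: "integrable lborel (\<lambda>y. \<psi> (x - y) * (f y)\<^sup>2)" by simp
  have eq: "\<psi> (x - y) * (f y - a)\<^sup>2 = \<psi> (x - y) * (f y)\<^sup>2 - 2 * a * (\<psi> (x - y) * f y) + a\<^sup>2 * \<psi> (x - y)" for y a
    by (simp add: power2_eq_square algebra_simps)
  show "integrable lborel (\<lambda>y. \<psi> (x - y) * (f y - a)\<^sup>2)"
    unfolding eq using i0 i1 i2 by auto
  define m where "m = convol f \<psi> x"
  have e: "(LINT y|lborel. \<psi> (x - y) * (f y - a)\<^sup>2) = (LINT y|lborel. \<psi> (x - y) * (f y)\<^sup>2) - 2 * a * m + a\<^sup>2" for a
    unfolding eq using i0 i1 i2 by (simp add: m_def convol_def)
  have "0 \<le> (LINT y|lborel. \<psi> (x - y) * (f y - m)\<^sup>2)" using p by simp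
  then have "m\<^sup>2 \<le> (LINT y|lborel. \<psi> (x - y) * (f y)\<^sup>2)"
    unfolding e by (simp add: power2_eq_square)
  then show "(convol f \<psi> x - a)\<^sup>2 \<le> (LINT y|lborel. \<psi> (x - y) * (f y - a)\<^sup>2)"
    unfolding e m_def[symmetric] by (simp add: power2_eq_square algebra_simps)
qed

lemma convol_measurable [measurable]:
  fixes f :: "real ^ 'n \<Rightarrow> real"
  assumes [measurable]: "f \<in> borel_measurable borel" "\<psi> \<in> borel_measurable borel"
  shows "convol f \<psi> \<in> borel_measurable borel"
  unfolding convol_def[abs_def] by measurable

lemma L2_translate:
  fixes f :: "real ^ 'n \<Rightarrow> real"
  shows "L2 f \<Longrightarrow> L2 (\<lambda>x. f (x + z))"
  using integrable_lborel_translate[of "\<lambda>x. (f x)\<^sup>2" z] by (auto simp: L2_real_iff)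

text \<open>By Jensen and Tonelli the squared error is at most an average, over shifts z in the
  reflected support, of the squared L2 distance between f and its translate. The estimate runs in
  nonnegative integrals, so membership in L2 comes out together with the bound.\<close>

lemma convol_L2_bound:
  fixes f :: "real ^ 'n \<Rightarrow> real"
  assumes f: "L2 f" and m: "mollifier \<psi>"
    and r: "\<And>z. norm z > r \<Longrightarrow> \<psi> z = 0"
    and e: "\<And>z. norm z \<le> r \<Longrightarrow> (LINT x|lborel. (f (x + z) - f x)\<^sup>2) \<le> e" and e0: "e \<ge> 0"
  shows "L2 (convol f \<psi>)" and "(L2_norm (\<lambda>x. convol f \<psi> x - f x))\<^sup>2 \<le> e"
proof -
  have t: "test_function \<psi>" and p: "\<And>x. 0 \<le> \<psi> x"
    using m by (auto simp: mollifier_def)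
  note [measurable] = test_function_measurable[OF t] L2_measurable[OF f]
  have "(\<integral>\<^sup>+x. ennreal ((convol f \<psi> x - f x)\<^sup>2) \<partial>lborel)
      \<le> (\<integral>\<^sup>+x. \<integral>\<^sup>+y. ennreal (\<psi> (x - y) * (f y - f x)\<^sup>2) \<partial>lborel \<partial>lborel)"
  proof (rule nn_integral_mono)
    fix x
    have "ennreal ((convol f \<psi> x - f x)\<^sup>2) \<le> ennreal (LINT y|lborel. \<psi> (x - y) * (f y - f x)\<^sup>2)"
      by (rule ennreal_leI) (rule mollifier_jensen(2)[OF f m])
    also have "\<dots> = (\<integral>\<^sup>+y. ennreal (\<psi> (x - y) * (f y - f x)\<^sup>2) \<partial>lborel)"
      by (rule nn_integral_eq_integral[symmetric]) (use mollifier_jensen(1)[OF f m] p in auto)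
    finally show "ennreal ((convol f \<psi> x - f x)\<^sup>2) \<le> (\<integral>\<^sup>+y. ennreal (\<psi> (x - y) * (f y - f x)\<^sup>2) \<partial>lborel)" .
  qed
  also have "\<dots> = (\<integral>\<^sup>+x. \<integral>\<^sup>+z. ennreal (\<psi> (- z) * (f (x + z) - f x)\<^sup>2) \<partial>lborel \<partial>lborel)"
  proof (rule nn_integral_cong)
    fix x
    show "(\<integral>\<^sup>+y. ennreal (\<psi> (x - y) * (f y - f x)\<^sup>2) \<partial>lborel) = (\<integral>\<^sup>+z. ennreal (\<psi> (- z) * (f (x + z) - f x)\<^sup>2) \<partial>lborel)"
      by (subst nn_integral_lborel_affine[of _ 1 x]) simp_all
  qed
  also have "\<dots> = (\<integral>\<^sup>+z. \<integral>\<^sup>+x. ennreal (\<psi> (- z) * (f (x + z) - f x)\<^sup>2) \<partial>lborel \<partial>lborel)"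
    by (rule lborel_pair.Fubini') measurable
  also have "\<dots> \<le> (\<integral>\<^sup>+z. ennreal (\<psi> (- z)) * ennreal e \<partial>lborel)"
  proof (rule nn_integral_mono)
    fix z :: "real^'n"
    have i: "integrable lborel (\<lambda>x. (f (x + z) - f x)\<^sup>2)"
      using L2_diff[OF L2_translate[OF f] f] by (simp add: L2_real_iff)
    have "(\<integral>\<^sup>+x. ennreal (\<psi> (- z) * (f (x + z) - f x)\<^sup>2) \<partial>lborel)
        = ennreal (\<psi> (- z)) * (\<integral>\<^sup>+x. ennreal ((f (x + z) - f x)\<^sup>2) \<partial>lborel)"
      using p by (simp add: ennreal_mult nn_integral_cmult)
    also have "\<dots> = ennreal (\<psi> (- z)) * ennreal (LINT x|lborel. (f (x + z) - f x)\<^sup>2)"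
      using nn_integral_eq_integral[OF i] by simp
    also have "\<dots> \<le> ennreal (\<psi> (- z)) * ennreal e"
    proof (cases "norm z \<le> r")
      case True
      then show ?thesis by (intro mult_left_mono ennreal_leI e) auto
    next
      case False
      then show ?thesis using r[of "- z"] by simp
    qed
    finally show "(\<integral>\<^sup>+x. ennreal (\<psi> (- z) * (f (x + z) - f x)\<^sup>2) \<partial>lborel) \<le> ennreal (\<psi> (- z)) * ennreal e" .
  qed
  also have "\<dots> = ennreal e"
    using mollifier_shift(3)[OF m, of 0] by (simp add: nn_integral_multc)
  finally have le: "(\<integral>\<^sup>+x. ennreal ((convol f \<psi> x - f x)\<^sup>2) \<partial>lborel) \<le> ennreal e" .
  then have i: "integrable lborel (\<lambda>x. (convol f \<psi> x - f x)\<^sup>2)"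
    by (auto simp: integrable_iff_bounded intro: le_less_trans)
  then have "L2 (\<lambda>x. convol f \<psi> x - f x)" by (auto simp: L2_real_iff)
  from L2_add[OF this f] show "L2 (convol f \<psi>)" by simp
  show "(L2_norm (\<lambda>x. convol f \<psi> x - f x))\<^sup>2 \<le> e"
    using le nn_integral_eq_integral[OF i] e0 by (simp add: L2_norm_real)
qed

lemma convol_L2:
  fixes f :: "real ^ 'n \<Rightarrow> real"
  assumes f: "L2 f" and m: "mollifier \<psi>"
  shows "L2 (convol f \<psi>)"
proof -
  obtain K r where r: "\<And>z. norm z > r \<Longrightarrow> \<psi> z = 0"
    using m test_function_bounded unfolding mollifier_def by metis
  \<comment> \<open>A crude bound for all shifts at once; any finite bound yields
    membership.\<close>
  have "(LINT x|lborel. (f (x + z) - f x)\<^sup>2) \<le> (2 * L2_norm f)\<^sup>2" for z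
  proof -
    have "L2_norm (\<lambda>x. f (x + z)) = L2_norm f"
      unfolding L2_norm_def using f by (subst integral_lborel_translate) (auto simp: L2_real_iff)
    then have "L2_norm (\<lambda>x. f (x + z) - f x) \<le> 2 * L2_norm f"
      using L2_norm_triangle_diff[OF L2_translate[OF f] f, of z] by simp
    then show ?thesis unfolding L2_norm_real[symmetric] by (intro power_mono) auto
  qed
  from convol_L2_bound(1)[OF f m r this] show ?thesis by simp
qed

lemma convol_L2_tendsto:
  fixes f :: "real ^ 'n \<Rightarrow> real"
  assumes f: "L2 f" and m: "mollifier \<psi>"
  shows "((\<lambda>\<epsilon>. L2_norm (\<lambda>x. convol f (scaled \<psi> \<epsilon>) x - f x)) \<longlongrightarrow> 0) (at_right 0)"
proof (rule tendstoI)
  fix e :: real assume e: "e > 0"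
  obtain R where R: "R \<ge> 0" "\<And>x \<epsilon>. \<epsilon> > 0 \<Longrightarrow> norm x > R * \<epsilon> \<Longrightarrow> scaled \<psi> \<epsilon> x = 0"
    using mollifier_support[OF m] by metis
  have "\<forall>\<^sub>F z in at 0. (LINT x|lborel. (f (x + z) - f x)\<^sup>2) < (e / 2)\<^sup>2"
    using order_tendstoD(2)[OF L2_translation_continuous[OF f]] e by simp
  then obtain d where d: "d > 0" "\<And>z. z \<noteq> 0 \<Longrightarrow> norm z < d \<Longrightarrow> (LINT x|lborel. (f (x + z) - f x)\<^sup>2) < (e / 2)\<^sup>2"
    by (auto simp: eventually_at)
  \<comment> \<open>\<open>R + 1\<close> in place of \<open>R\<close> covers \<open>R = 0\<close>
    and still gives \<open>R * \<epsilon> < d\<close>.\<close>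
  have "\<forall>\<^sub>F \<epsilon> in at_right 0. \<epsilon> < d / (R + 1)"
    by (rule order_tendstoD(2)[OF tendsto_ident_at]) (use d R in simp)
  then show "\<forall>\<^sub>F \<epsilon> in at_right 0. dist (L2_norm (\<lambda>x. convol f (scaled \<psi> \<epsilon>) x - f x)) 0 < e"
    using eventually_at_right_less[of 0]
  proof eventually_elim
    case (elim \<epsilon>)
    have "R * \<epsilon> < d"
    proof -
      have "R * \<epsilon> \<le> (R + 1) * \<epsilon>" using elim by simp
      also have "\<dots> < d" using elim R by (simp add: field_simps)
      finally show ?thesis .
    qed
    then have "(L2_norm (\<lambda>x. convol f (scaled \<psi> \<epsilon>) x - f x))\<^sup>2 \<le> (e / 2)\<^sup>2"
    proof (intro convol_L2_bound(2)[OF f mollifier_scaled[OF m], where r = "R * \<epsilon>"])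
      fix z :: "real^'n" assume "norm z \<le> R * \<epsilon>" "R * \<epsilon> < d"
      \<comment> \<open>The limit at 0 says nothing about the shift z = 0 itself, where the integral
        vanishes.\<close>
      then show "(LINT x|lborel. (f (x + z) - f x)\<^sup>2) \<le> (e / 2)\<^sup>2"
        using d(2)[of z] by (cases "z = 0") auto
    qed (use elim R in auto)
    then have "L2_norm (\<lambda>x. convol f (scaled \<psi> \<epsilon>) x - f x) \<le> e / 2"
      by (rule power2_le_imp_le) (use e in simp)
    then show ?case using e by simp
  qed
qed

section \<open>Weak derivatives\<close>

lemma L2_tendsto_AE_subseq:
  fixes g :: "nat \<Rightarrow> real ^ 'n \<Rightarrow> real"
  assumes g: "\<And>k. L2 (g k)" and lim: "(\<lambda>k. L2_norm (g k)) \<longlonglongrightarrow> 0"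
  obtains r :: "nat \<Rightarrow> nat" where "strict_mono r" "AE x in lborel. (\<lambda>k. g (r k) x) \<longlonglongrightarrow> 0"
proof -
  have "(\<lambda>k. (L2_norm (g k))\<^sup>2) \<longlonglongrightarrow> 0" using tendsto_power[OF lim, of 2] by simp
  then have "(\<lambda>k. LINT x|lborel. norm ((g k x)\<^sup>2)) \<longlonglongrightarrow> 0" by (simp add: L2_norm_real)
  moreover have "integrable lborel (\<lambda>x. (g k x)\<^sup>2)" for k using g by (simp add: L2_real_iff)
  ultimately obtain r :: "nat \<Rightarrow> nat" where r: "strict_mono r"
    and ae: "AE x in lborel. (\<lambda>k. (g (r k) x)\<^sup>2) \<longlonglongrightarrow> 0"
    using tendsto_L1_AE_subseq[of lborel "\<lambda>k x. (g k x)\<^sup>2"] by metis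
  have "AE x in lborel. (\<lambda>k. g (r k) x) \<longlonglongrightarrow> 0"
    using ae
  proof eventually_elim
    case (elim x)
    then have "(\<lambda>k. sqrt ((g (r k) x)\<^sup>2)) \<longlonglongrightarrow> sqrt 0" by (rule tendsto_real_sqrt)
    then show ?case by (simp add: tendsto_rabs_zero_iff)
  qed
  with r that show ?thesis by blast
qed

lemma locally_integrable_measurable:
  "locally_integrable f \<Longrightarrow> f \<in> borel_measurable borel"
  by (simp add: locally_integrable_def)

lemma locally_integrable_diff:
  "locally_integrable f \<Longrightarrow> locally_integrable g \<Longrightarrow> locally_integrable (\<lambda>x. f x - g x)"
  by (auto simp: locally_integrable_def set_integrable_def scaleR_diff_right)

lemma locally_integrable_scaleR:
  "locally_integrable f \<Longrightarrow> locally_integrable (\<lambda>x. c *\<^sub>R f x)"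
proof -
  have eq: "indicat_real K x *\<^sub>R c *\<^sub>R f x = c *\<^sub>R (indicat_real K x *\<^sub>R f x)" for K x
    by (simp add: mult.commute)
  show "locally_integrable f \<Longrightarrow> locally_integrable (\<lambda>x. c *\<^sub>R f x)"
    unfolding locally_integrable_def set_integrable_def eq by (auto simp del: scaleR_scaleR)
qed

lemma locally_integrable_inner:
  fixes f :: "real ^ 'n \<Rightarrow> 'b::euclidean_space"
  shows "locally_integrable f \<Longrightarrow> locally_integrable (\<lambda>x. f x \<bullet> b)"
proof -
  have eq: "indicat_real K x *\<^sub>R (f x \<bullet> b) = (indicat_real K x *\<^sub>R f x) \<bullet> b" for K x
    by simp
  show "locally_integrable f \<Longrightarrow> locally_integrable (\<lambda>x. f x \<bullet> b)"
    unfolding locally_integrable_def set_integrable_def eq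
    by (auto simp del: inner_scaleR_left real_scaleR_def)
qed

lemma bounded_locally_integrable:
  fixes f :: "real ^ 'n \<Rightarrow> real"
  assumes [measurable]: "f \<in> borel_measurable borel" and b: "AE x in lborel. \<bar>f x\<bar> \<le> M"
  shows "locally_integrable f"
  unfolding locally_integrable_def set_integrable_def
proof (intro conjI allI impI)
  fix K :: "(real^'n) set" assume K: "compact K"
  then have [measurable]: "K \<in> sets borel" by (simp add: borel_compact)
  have i: "integrable lborel (\<lambda>x. M * indicat_real K x)" using emeasure_compact_finite[OF K] by simp
  show "integrable lborel (\<lambda>x. indicat_real K x *\<^sub>R f x)"
  proof (rule Bochner_Integration.integrable_bound[OF i])
    show "AE x in lborel. norm (indicat_real K x *\<^sub>R f x) \<le> norm (M * indicat_real K x)"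
      using b by eventually_elim (auto simp: indicator_def)
  qed measurable
qed measurable

lemma convol_abs_le:
  fixes f :: "real ^ 'n \<Rightarrow> real"
  assumes f: "f \<in> borel_measurable borel" and b: "AE x in lborel. \<bar>f x\<bar> \<le> M" and m: "mollifier \<psi>"
  shows "\<bar>convol f \<psi> x\<bar> \<le> M"
proof -
  have t: "test_function \<psi>" and p: "\<And>x. 0 \<le> \<psi> x"
    using m by (auto simp: mollifier_def)
  have i: "integrable lborel (\<lambda>y. \<psi> (x - y) * f y)"
    using integrable_convol[OF bounded_locally_integrable[OF f b] t] by simp
  have "\<bar>LINT y|lborel. \<psi> (x - y) * f y\<bar> \<le> (LINT y|lborel. M * \<psi> (x - y))"
  proof (rule order_trans[OF integral_abs_bound], rule integral_mono_AE)
    show "AE y in lborel. \<bar>\<psi> (x - y) * f y\<bar> \<le> M * \<psi> (x - y)"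
      using b by eventually_elim (use p in \<open>simp add: abs_mult mult.commute mult_right_mono\<close>)
  qed (use i mollifier_shift(1)[OF m, of x] in auto)
  then show ?thesis using mollifier_shift(2)[OF m, of x] by (simp add: convol_def)
qed

lemma L2_indicator:
  "A \<in> sets borel \<Longrightarrow> emeasure lborel A < \<infinity> \<Longrightarrow> L2 (indicat_real (A :: (real ^ 'n) set))"
  by (simp add: L2_real_iff power2_eq_square flip: indicator_inter_arith)

lemma bounded_support_L2:
  fixes f :: "real ^ 'n \<Rightarrow> real"
  assumes [measurable]: "f \<in> borel_measurable borel" and b: "AE x in lborel. \<bar>f x\<bar> \<le> M"
  shows "L2 (\<lambda>x. indicat_real (cball 0 R) x * f x)"
proof -
  have "L2 (indicat_real (cball (0::real^'n) R))"
    by (intro L2_indicator) (auto simp: emeasure_compact_finite[OF compact_cball, simplified])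
  from L2_weight(1)[OF this assms] show ?thesis by (simp add: mult.commute)
qed

text \<open>Almost everywhere convergence is extracted along sequences, so the net is sampled at
  1/(k+1). These values stay in (0,1], which keeps the supports of the kernels in a common
  ball.\<close>

abbreviation mollify :: "(real ^ 'n \<Rightarrow> real) \<Rightarrow> (real ^ 'n \<Rightarrow> real) \<Rightarrow> nat \<Rightarrow> real ^ 'n \<Rightarrow> real" where
  "mollify \<psi> f k \<equiv> convol f (scaled \<psi> (1 / real (Suc k)))"

lemma inverse_Suc_at_right: "filterlim (\<lambda>k. 1 / real (Suc k)) (at_right 0) sequentially"
  unfolding filterlim_at using LIMSEQ_inverse_real_of_nat by (auto simp: inverse_eq_divide)

lemma mollify_AE_subseq:
  fixes f :: "real ^ 'n \<Rightarrow> real"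
  assumes f: "L2 f" and m: "mollifier \<psi>"
  obtains r :: "nat \<Rightarrow> nat" where "strict_mono r" "AE x in lborel. (\<lambda>k. mollify \<psi> f (r k) x) \<longlonglongrightarrow> f x"
proof -
  have m': "mollifier (scaled \<psi> (1 / real (Suc k)))" for k using mollifier_scaled[OF m] by simp
  have "(\<lambda>k. L2_norm (\<lambda>x. mollify \<psi> f k x - f x)) \<longlonglongrightarrow> 0"
    using filterlim_compose[OF convol_L2_tendsto[OF f m] inverse_Suc_at_right] by simp
  from L2_tendsto_AE_subseq[OF L2_diff[OF convol_L2[OF f m'] f] this]
  obtain r :: "nat \<Rightarrow> nat" where "strict_mono r" and ae: "AE x in lborel. (\<lambda>k. mollify \<psi> f (r k) x - f x) \<longlonglongrightarrow> 0" .
  moreover from ae have "AE x in lborel. (\<lambda>k. mollify \<psi> f (r k) x) \<longlonglongrightarrow> f x"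
    by eventually_elim (simp add: LIM_zero_iff)
  ultimately show ?thesis using that by blast
qed

text \<open>Test with mollifications of the sign of f, truncated to a ball. They are bounded by 1
  and supported in one larger ball, so dominated convergence along an almost everywhere convergent
  subsequence shows that the absolute value of f has integral 0 over the smaller ball. The mollifier
  is a parameter because it supplies these test functions.\<close>

lemma fundamental_lemma:
  fixes \<psi> f :: "real ^ 'n \<Rightarrow> real"
  assumes m: "mollifier \<psi>" and f: "locally_integrable f"
    and z: "\<And>\<phi>. test_function \<phi> \<Longrightarrow> (LINT x|lborel. \<phi> x * f x) = 0"
  shows "AE x in lborel. f x = 0"
proof -
  note [measurable] = locally_integrable_measurable[OF f]
  obtain R where R: "R \<ge> 0" "\<And>x \<epsilon>. \<epsilon> > 0 \<Longrightarrow> norm x > R * \<epsilon> \<Longrightarrow> scaled \<psi> \<epsilon> x = 0"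
    using mollifier_support[OF m] by metis
  have "AE x in lborel. norm x \<le> real n \<longrightarrow> f x = 0" for n
  proof -
    define s where "s x = indicat_real (cball 0 (real n)) x * sgn (f x)" for x
    have [measurable]: "s \<in> borel_measurable borel"
      unfolding s_def[abs_def]
      by (intro borel_measurable_times borel_measurable_indicator borel_closed closed_cball
          measurable_compose[OF locally_integrable_measurable[OF f] borel_measurable_sgn])
    have s1: "\<bar>s x\<bar> \<le> 1" for x by (simp add: s_def sgn_if indicator_def)
    have s2: "L2 s" unfolding s_def[abs_def]
      by (rule bounded_support_L2[where M = 1]) (auto simp: sgn_if[abs_def])
    have s3: "s x = 0" if "norm x > real n" for x using that by (simp add: s_def)
    obtain r :: "nat \<Rightarrow> nat" where "strict_mono r"
      and r: "AE x in lborel. (\<lambda>k. mollify \<psi> s (r k) x) \<longlonglongrightarrow> s x"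
      by (rule mollify_AE_subseq[OF s2 m])
    have m': "mollifier (scaled \<psi> (1 / real (Suc k)))" for k using mollifier_scaled[OF m] by simp
    have t: "test_function (mollify \<psi> s k)" for k
      using test_function_convol[OF L2_locally_integrable[OF s2] _ s3] m' by (simp add: mollifier_def)
    have b: "\<bar>mollify \<psi> s k x\<bar> \<le> 1" for k x
      by (rule convol_abs_le[OF _ _ m']) (use s1 in auto)
    have supp: "mollify \<psi> s k x = 0" if x: "norm x > real n + R" for k x
    proof -
      have z: "scaled \<psi> (1 / real (Suc k)) (x - y) *\<^sub>R s y = 0" for y
      proof (cases "norm y > real n")
        case False
        have "norm x \<le> norm (x - y) + norm y" by (metis norm_triangle_sub add.commute)
        then have "norm (x - y) > R" using x False by linarith
        moreover have "R * (1 / real (Suc k)) \<le> R * 1" using R(1) by (intro mult_left_mono) auto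
        ultimately show ?thesis using R(2)[of "1 / real (Suc k)" "x - y"] by simp
      qed (simp add: s3)
      show ?thesis unfolding convol_def by (subst z) simp
    qed
    have iB: "integrable lborel (\<lambda>x. indicat_real (cball 0 (real n + R)) x *\<^sub>R f x)"
      using f compact_cball unfolding locally_integrable_def set_integrable_def by blast
    note [measurable] = test_function_measurable[OF t]
    have "(\<lambda>k. LINT x|lborel. mollify \<psi> s (r k) x * f x) \<longlonglongrightarrow> (LINT x|lborel. s x * f x)"
    proof (rule integral_dominated_convergence[where w = "\<lambda>x. norm (indicat_real (cball 0 (real n + R)) x *\<^sub>R f x)"])
      show "AE x in lborel. (\<lambda>k. mollify \<psi> s (r k) x * f x) \<longlonglongrightarrow> s x * f x"
        using r by eventually_elim (intro tendsto_intros)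
      show "AE x in lborel. norm (mollify \<psi> s (r k) x * f x) \<le> norm (indicat_real (cball 0 (real n + R)) x *\<^sub>R f x)" for k
      proof (rule AE_I2)
        fix x
        show "norm (mollify \<psi> s (r k) x * f x) \<le> norm (indicat_real (cball 0 (real n + R)) x *\<^sub>R f x)"
        proof (cases "norm x > real n + R")
          case True
          then show ?thesis by (simp only: supp) simp
        next
          case False
          have "\<bar>mollify \<psi> s (r k) x\<bar> * \<bar>f x\<bar> \<le> 1 * \<bar>f x\<bar>" by (intro mult_right_mono b) auto
          then show ?thesis using False by (simp add: abs_mult)
        qed
      qed
    qed (use iB in \<open>auto simp del: of_nat_Suc\<close>)
    then have "(\<lambda>k. 0) \<longlonglongrightarrow> (LINT x|lborel. s x * f x)" using z[OF t] by simp
    then have zero: "(LINT x|lborel. s x * f x) = 0" using LIMSEQ_unique tendsto_const by blast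
    have sf: "s x * f x = \<bar>indicat_real (cball 0 (real n)) x *\<^sub>R f x\<bar>" for x
      by (simp add: s_def sgn_if indicator_def)
    have "integrable lborel (\<lambda>x. indicat_real (cball 0 (real n)) x *\<^sub>R f x)"
      using f compact_cball unfolding locally_integrable_def set_integrable_def by blast
    then have i: "integrable lborel (\<lambda>x. \<bar>indicat_real (cball 0 (real n)) x *\<^sub>R f x\<bar>)"
      by (rule integrable_abs)
    have "AE x in lborel. \<bar>indicat_real (cball 0 (real n)) x *\<^sub>R f x\<bar> = 0"
      using zero unfolding sf by (subst (asm) integral_nonneg_eq_0_iff_AE[OF i]) auto
    then show ?thesis by eventually_elim auto
  qed
  then have "AE x in lborel. \<forall>n. norm x \<le> real n \<longrightarrow> f x = 0" by (intro AE_all_countable[THEN iffD2] allI)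
  then show ?thesis by eventually_elim (meson real_arch_simple)
qed

section \<open>Linearity and uniqueness of weak derivatives, and their convolutions\<close>

lemma has_weak_partial_diff:
  fixes f g :: "real ^ 'n \<Rightarrow> 'b::euclidean_space"
  assumes "has_weak_partial j f f'" "has_weak_partial j g g'"
  shows "has_weak_partial j (\<lambda>x. f x - g x) (\<lambda>x. f' x - g' x)"
  using assms unfolding has_weak_partial_def
  by (auto simp: scaleR_diff_right integrable_test_scaleR test_function_partial locally_integrable_diff)

lemma has_weak_partial_scaleR:
  fixes f g :: "real ^ 'n \<Rightarrow> 'b::euclidean_space"
  assumes "has_weak_partial j f f'"
  shows "has_weak_partial j (\<lambda>x. c *\<^sub>R f x) (\<lambda>x. c *\<^sub>R f' x)"
proof -
  have eq: "a *\<^sub>R c *\<^sub>R y = c *\<^sub>R (a *\<^sub>R y)" for a and y :: 'b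
    by (simp add: mult.commute)
  show ?thesis
    using assms unfolding has_weak_partial_def eq by (simp add: locally_integrable_scaleR del: scaleR_scaleR)
qed

lemma has_weak_partial_inner:
  fixes f g :: "real ^ 'n \<Rightarrow> 'b::euclidean_space"
  assumes "has_weak_partial j f f'"
  shows "has_weak_partial j (\<lambda>x. f x \<bullet> b) (\<lambda>x. f' x \<bullet> b)"
proof -
  have i: "(LINT x|lborel. p x *\<^sub>R (h x \<bullet> b)) = (LINT x|lborel. p x *\<^sub>R h x) \<bullet> b"
    if "test_function p" "locally_integrable h" for p and h :: "real ^ 'n \<Rightarrow> 'b"
    using integral_inner_left[OF integrable_test_scaleR[OF that(2,1)], of b] by simp
  show ?thesis
    using assms unfolding has_weak_partial_def
    by (simp add: i test_function_partial locally_integrable_inner del: real_scaleR_def)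
qed

text \<open>This is what makes \<open>weak_partial\<close> usable: the representative chosen there
  agrees almost everywhere with any other. Vector values reduce to the scalar case through finitely
  many basis components.\<close>

lemma has_weak_partial_unique:
  fixes f g :: "real ^ 'n \<Rightarrow> 'b::euclidean_space"
  assumes m: "mollifier (\<psi> :: real ^ 'n \<Rightarrow> real)"
    and g: "has_weak_partial j f g" and g': "has_weak_partial j f g'"
  shows "AE x in lborel. g x = g' x"
proof -
  have "AE x in lborel. (g x - g' x) \<bullet> b = 0" for b
  proof (rule fundamental_lemma[OF m])
    have l: "locally_integrable g" "locally_integrable g'"
      using g g' by (auto simp: has_weak_partial_def)
    then show "locally_integrable (\<lambda>x. (g x - g' x) \<bullet> b)"
      by (intro locally_integrable_inner locally_integrable_diff)
    fix \<phi> :: "real ^ 'n \<Rightarrow> real" assume t: "test_function \<phi>"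
    have i: "integrable lborel (\<lambda>x. \<phi> x *\<^sub>R g x)" "integrable lborel (\<lambda>x. \<phi> x *\<^sub>R g' x)"
      using l t by (auto intro: integrable_test_scaleR)
    have "(LINT x|lborel. \<phi> x *\<^sub>R g x) = (LINT x|lborel. \<phi> x *\<^sub>R g' x)"
      using g g' t by (simp add: has_weak_partial_def)
    then have "(LINT x|lborel. \<phi> x *\<^sub>R g x - \<phi> x *\<^sub>R g' x) = 0"
      using i by simp
    then have "(LINT x|lborel. (\<phi> x *\<^sub>R g x - \<phi> x *\<^sub>R g' x) \<bullet> b) = 0"
      using integral_inner_left[OF Bochner_Integration.integrable_diff[OF i], of b] by simp
    then show "(LINT x|lborel. \<phi> x * ((g x - g' x) \<bullet> b)) = 0"
      by (simp add: inner_diff_left right_diff_distrib)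
  qed
  then have "AE x in lborel. \<forall>b\<in>Basis. (g x - g' x) \<bullet> b = 0" by (subst AE_ball_countable) (auto intro: countable_finite)
  then show ?thesis by eventually_elim (metis euclidean_all_zero_iff right_minus_eq)
qed

lemma has_weak_partial_weak_partial:
  "has_weak_partial j f g \<Longrightarrow> has_weak_partial j f (weak_partial j f)"
  unfolding weak_partial_def by (rule someI[of "has_weak_partial j f"])

text \<open>The reflected kernel y \<mapsto> p (x - y) is itself a test function for the weak
  derivative. The sign produced by the reflection cancels the one in the integration by
  parts.\<close>

lemma convol_partial:
  fixes f :: "real ^ 'n \<Rightarrow> real"
  assumes w: "has_weak_partial j f g" and p: "test_function p"
  shows "convol f (partial_deriv j p) = convol g p"
proof
  fix x
  define \<phi> where "\<phi> y = 1 * p ((-1) *\<^sub>R y + x)" for y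
  have "p differentiable (at y)" for y using p smooth_differentiable by (auto simp: test_function_def)
  then have d: "partial_deriv j \<phi> y = - partial_deriv j p (x - y)" for y
    using partial_deriv_affine(2)[where f = p and a = "-1" and x = y and c = x and k = 1 and j = j] by (simp add: \<phi>_def[abs_def])
  have t: "test_function \<phi>" unfolding \<phi>_def[abs_def] by (rule test_function_affine[OF p]) simp
  have "(LINT y|lborel. partial_deriv j \<phi> y *\<^sub>R f y) = - (LINT y|lborel. \<phi> y *\<^sub>R g y)"
    using w t by (simp add: has_weak_partial_def)
  then have "(LINT y|lborel. - partial_deriv j p (x - y) *\<^sub>R f y) = - (LINT y|lborel. \<phi> y *\<^sub>R g y)"
    unfolding d .
  then show "convol f (partial_deriv j p) x = convol g p x"
    by (simp add: convol_def \<phi>_def)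
qed

text \<open>The convolution of \<open>p\<close> with the constant 1 has vanishing derivative.\<close>

lemma integral_partial_deriv_test:
  fixes p :: "real ^ 'n \<Rightarrow> real"
  assumes p: "test_function p"
  shows "(LINT x|lborel. partial_deriv j p x) = 0"
proof -
  note [measurable] = test_function_measurable[OF p] test_function_measurable[OF test_function_partial[OF p, of j]]
  have l: "locally_integrable (\<lambda>_::real^'n. 1::real)"
    by (rule bounded_locally_integrable[where M = 1]) auto
  have "convol (\<lambda>_. 1 :: real) p = (\<lambda>_. LINT x|lborel. p x)"
    by (rule ext) (use integral_lborel_affine[of p "-1"] in \<open>simp add: convol_def\<close>)
  then have "partial_deriv j (convol (\<lambda>_. 1 :: real) p) 0 = 0"
    using partial_derivI[of "\<lambda>_. LINT x|lborel. p x" "\<lambda>_. 0" 0 j] by simp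
  then have "convol (\<lambda>_. 1 :: real) (partial_deriv j p) 0 = 0" using partial_deriv_convol[OF l p, of j] by simp
  then show ?thesis
    using integral_lborel_affine[of "partial_deriv j p" "-1" 0] by (simp add: convol_def)
qed

text \<open>The convolution is smooth with classical derivative \<open>convol g p\<close>, so the
  product rule applies to \<phi> times \<open>convol f p\<close>, a test function whose partial
  derivative has integral 0.\<close>

lemma has_weak_partial_convol:
  fixes f :: "real ^ 'n \<Rightarrow> real"
  assumes w: "has_weak_partial j f g" and p: "test_function p"
  shows "has_weak_partial j (convol f p) (convol g p)"
proof -
  have f: "locally_integrable f" and g: "locally_integrable g" using w by (auto simp: has_weak_partial_def)
  have sf: "smooth (convol f p)" and sg: "smooth (convol g p)" using smooth_convol p f g by auto
  have l: "locally_integrable F" if "smooth F" for F :: "real ^ 'n \<Rightarrow> real"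
    unfolding locally_integrable_def set_integrable_def
  proof (intro conjI allI impI)
    show "F \<in> borel_measurable lborel"
      using borel_measurable_continuous_onI[OF smooth_continuous[OF that]] by simp
    show "integrable lborel (\<lambda>x. indicat_real K x *\<^sub>R F x)" if "compact K" for K
      by (rule borel_integrable_compact[OF that])
        (rule continuous_on_subset[OF smooth_continuous[OF \<open>smooth F\<close>] subset_UNIV])
  qed
  show ?thesis
    unfolding has_weak_partial_def
  proof (intro conjI allI impI l sf sg)
    fix \<phi> :: "real ^ 'n \<Rightarrow> real" assume t: "test_function \<phi>"
    have d: "\<phi> differentiable (at x)" for x using t smooth_differentiable by (auto simp: test_function_def)
    have "partial_deriv j (\<lambda>x. \<phi> x * convol f p x) x = \<phi> x * convol g p x + partial_deriv j \<phi> x * convol f p x" for x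
      unfolding partial_deriv_mult[OF d smooth_differentiable[OF sf]]
      using partial_deriv_convol[OF f p] convol_partial[OF w p] by simp
    then have "(LINT x|lborel. \<phi> x * convol g p x + partial_deriv j \<phi> x * convol f p x) = 0"
      using integral_partial_deriv_test[OF test_function_mult[OF t sf], of j] by simp
    moreover have "integrable lborel (\<lambda>x. \<phi> x *\<^sub>R convol g p x)" "integrable lborel (\<lambda>x. partial_deriv j \<phi> x *\<^sub>R convol f p x)"
      using l sf sg t by (auto intro!: integrable_test_scaleR test_function_partial simp del: real_scaleR_def)
    ultimately show "(LINT x|lborel. partial_deriv j \<phi> x *\<^sub>R convol f p x) = - (LINT x|lborel. \<phi> x *\<^sub>R convol g p x)"
      by simp
  qed
qed

section \<open>Mollification of the coefficients\<close>

lemma Linf_AE_bounded: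
  assumes "Linf f"
  obtains M where "AE x in lborel. norm (f x) \<le> M"
proof -
  define e where "e = esssup lborel (\<lambda>x. ereal (norm (f x)))"
  have "e < \<infinity>" using assms by (simp add: Linf_def e_def)
  then obtain M where M: "e \<le> ereal M" by (cases e) auto
  have "AE x in lborel. ereal (norm (f x)) \<le> e" unfolding e_def by (rule esssup_AE)
  then have "AE x in lborel. norm (f x) \<le> M"
    by eventually_elim (use M in \<open>metis ereal_less_eq(3) order_trans\<close>)
  then show ?thesis by (rule that)
qed

text \<open>A bounded function need not lie in L2, so it is truncated to the ball of radius
  \<open>N + R\<close>. From points of norm at most \<open>N\<close>, kernels of scale at most 1 see
  only that ball, so there the mollifications of the truncated and of the original function
  coincide.\<close>

lemma mollify_AE_subseq_bounded:
  fixes h :: "real ^ 'n \<Rightarrow> real"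
  assumes h: "h \<in> borel_measurable borel" and M: "AE x in lborel. \<bar>h x\<bar> \<le> M" and m: "mollifier \<psi>"
  obtains r :: "nat \<Rightarrow> nat"
    where "AE x in lborel. norm x \<le> N \<longrightarrow> (\<lambda>k. mollify \<psi> h (r k) x) \<longlonglongrightarrow> h x"
proof -
  obtain R where R: "R \<ge> 0" "\<And>x \<epsilon>. \<epsilon> > 0 \<Longrightarrow> norm x > R * \<epsilon> \<Longrightarrow> scaled \<psi> \<epsilon> x = 0"
    using mollifier_support[OF m] by metis
  define f where "f x = indicat_real (cball 0 (N + R)) x * h x" for x
  have f: "L2 f" unfolding f_def[abs_def] by (rule bounded_support_L2[OF h M])
  obtain r :: "nat \<Rightarrow> nat" where "strict_mono r" and r: "AE x in lborel. (\<lambda>k. mollify \<psi> f (r k) x) \<longlonglongrightarrow> f x"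
    by (rule mollify_AE_subseq[OF f m])
  have eq: "mollify \<psi> f k x = mollify \<psi> h k x" if x: "norm x \<le> N" for k x
  proof -
    have "scaled \<psi> (1 / real (Suc k)) (x - y) *\<^sub>R f y = scaled \<psi> (1 / real (Suc k)) (x - y) *\<^sub>R h y" for y
    proof (cases "norm y \<le> N + R")
      case False
      have "norm y \<le> norm (x - y) + norm x" by (metis norm_triangle_sub norm_minus_commute add.commute)
      then have "norm (x - y) > R" using x False by linarith
      moreover have "R * (1 / real (Suc k)) \<le> R * 1" using R(1) by (intro mult_left_mono) auto
      ultimately show ?thesis using R(2)[of "1 / real (Suc k)" "x - y"] by simp
    qed (simp add: f_def)
    then show ?thesis unfolding convol_def by (intro Bochner_Integration.integral_cong refl)
  qed
  have "AE x in lborel. norm x \<le> N \<longrightarrow> (\<lambda>k. mollify \<psi> h (r k) x) \<longlonglongrightarrow> h x"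
    using r
  proof eventually_elim
    case (elim x)
    show ?case
    proof
      assume x: "norm x \<le> N"
      then have "f x = h x" using R(1) by (simp add: f_def)
      then show "(\<lambda>k. mollify \<psi> h (r k) x) \<longlonglongrightarrow> h x" using elim by (simp only: eq[OF x])
    qed
  qed
  then show ?thesis by (rule that)
qed

text \<open>The gradient of the mollification is the mollification of the weak gradient and inherits
  its bound. The resulting constant does not depend on the mollifier.\<close>

lemma convol_Lipschitz:
  fixes h :: "real ^ 'n \<Rightarrow> real"
  assumes w: "\<And>j. has_weak_partial j h (g j)" and L: "\<And>j. AE x in lborel. \<bar>g j x\<bar> \<le> L" and m: "mollifier \<psi>"
  shows "\<bar>convol h \<psi> x - convol h \<psi> y\<bar> \<le> real CARD('n) * L * norm (x - y)"
proof -
  have t: "test_function \<psi>" using m by (simp add: mollifier_def)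
  have h: "locally_integrable h" and g: "locally_integrable (g j)" for j using w by (auto simp: has_weak_partial_def)
  have "norm (convol h \<psi> x - convol h \<psi> y) \<le> (real CARD('n) * L) * norm (x - y)"
  proof (rule differentiable_bound[OF convex_UNIV])
    fix z :: "real^'n"
    show "(convol h \<psi> has_derivative (\<lambda>k. \<Sum>j\<in>UNIV. k $ j * convol (g j) \<psi> z)) (at z within UNIV)"
      using convol_has_derivative[OF h t, of z] by (simp add: convol_partial[OF w t])
    show "onorm (\<lambda>k. \<Sum>j\<in>UNIV. k $ j * convol (g j) \<psi> z) \<le> real CARD('n) * L"
    proof (rule onorm_le)
      fix k :: "real^'n"
      have "norm (\<Sum>j\<in>UNIV. k $ j * convol (g j) \<psi> z) \<le> (\<Sum>j\<in>(UNIV::'n set). norm k * L)"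
      proof (rule order_trans[OF norm_sum], rule sum_mono)
        fix j
        have "\<bar>convol (g j) \<psi> z\<bar> \<le> L"
          by (rule convol_abs_le[OF locally_integrable_measurable[OF g] L m])
        then show "norm (k $ j * convol (g j) \<psi> z) \<le> norm k * L"
          unfolding real_norm_def abs_mult by (intro mult_mono component_le_norm_cart) auto
      qed
      then show "norm (\<Sum>j\<in>UNIV. k $ j * convol (g j) \<psi> z) \<le> real CARD('n) * L * norm k"
        by (simp add: mult_ac)
    qed
  qed auto
  then show ?thesis by simp
qed

text \<open>\<open>convol f \<psi> x\<close> is an average of values of f at distance at most
  \<open>r\<close> from x.\<close>

lemma convol_Lipschitz_error:
  fixes f :: "real ^ 'n \<Rightarrow> real"
  assumes m: "mollifier \<psi>" and f: "locally_integrable f" and r: "\<And>x. norm x > r \<Longrightarrow> \<psi> x = 0"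
    and L: "\<And>x y. \<bar>f x - f y\<bar> \<le> L * norm (x - y)" and L0: "L \<ge> 0"
  shows "\<bar>convol f \<psi> x - f x\<bar> \<le> L * r"
proof -
  have t: "test_function \<psi>" and p: "\<And>x. 0 \<le> \<psi> x" using m by (auto simp: mollifier_def)
  have i: "integrable lborel (\<lambda>y. \<psi> (x - y) * f y)"
    using integrable_convol[OF f t] by simp
  note s = mollifier_shift(1,2)[OF m, of x]
  have "convol f \<psi> x - f x = (LINT y|lborel. \<psi> (x - y) * f y - f x * \<psi> (x - y))"
    using i s by (simp add: convol_def)
  also have "\<bar>\<dots>\<bar> \<le> (LINT y|lborel. (L * r) * \<psi> (x - y))"
  proof (rule order_trans[OF integral_abs_bound], rule integral_mono)
    fix y
    have "\<bar>\<psi> (x - y) * f y - f x * \<psi> (x - y)\<bar> = \<psi> (x - y) * \<bar>f y - f x\<bar>"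
    proof -
      have "\<psi> (x - y) * f y - f x * \<psi> (x - y) = \<psi> (x - y) * (f y - f x)" by (simp add: algebra_simps)
      then show ?thesis using p by (simp add: abs_mult)
    qed
    also have "\<dots> \<le> \<psi> (x - y) * (L * r)"
    proof (cases "norm (x - y) > r")
      case False
      then have "L * norm (x - y) \<le> L * r" using L0 by (intro mult_left_mono) auto
      then show ?thesis using L[of y x] p by (intro mult_left_mono) (auto simp: norm_minus_commute)
    qed (simp add: r)
    finally show "\<bar>\<psi> (x - y) * f y - f x * \<psi> (x - y)\<bar> \<le> (L * r) * \<psi> (x - y)" by (simp add: mult.commute)
  qed (use i s in auto)
  finally show ?thesis using s by simp
qed

text \<open>A bounded weak gradient gives h no pointwise Lipschitz bound. Its mollifications
  \<open>g k\<close> are Lipschitz with one common constant, hence have error at most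
  \<open>D * R * \<epsilon>\<close> under convolution at scale \<epsilon>; that bound passes to h as
  k grows. A single \<open>C\<close> serves as the bound of h and as the rate.\<close>

lemma W1inf_mollify:
  fixes h :: "real ^ 'n \<Rightarrow> real"
  assumes h: "W1inf h" and m: "mollifier \<psi>"
  obtains C where "C \<ge> 0" "h \<in> borel_measurable borel" "AE x in lborel. \<bar>h x\<bar> \<le> C"
    "\<And>\<epsilon>. 0 < \<epsilon> \<Longrightarrow> \<epsilon> \<le> 1 \<Longrightarrow> AE x in lborel. \<bar>convol h (scaled \<psi> \<epsilon>) x - h x\<bar> \<le> C * \<epsilon>"
proof -
  have w: "has_weak_partial j h (weak_partial j h)" for j
    using h has_weak_partial_weak_partial unfolding W1inf_def weakly_differentiable_def by blast
  then have lh: "locally_integrable h" by (simp add: has_weak_partial_def)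
  note mh = locally_integrable_measurable[OF lh]
  obtain M where "AE x in lborel. norm (h x) \<le> M"
    using h Linf_AE_bounded unfolding W1inf_def by blast
  then have M: "AE x in lborel. \<bar>h x\<bar> \<le> M" by simp
  obtain L0 where L0: "AE x in lborel. norm (weak_grad h x) \<le> L0"
    using h Linf_AE_bounded unfolding W1inf_def by blast
  \<comment> \<open>The maximum with 0 makes the Lipschitz constant \<open>D\<close> nonnegative, as
    \<open>convol_Lipschitz_error\<close> requires.\<close>
  define L where "L = max 0 L0"
  have L: "AE x in lborel. \<bar>weak_partial j h x\<bar> \<le> L" for j
    using L0
  proof eventually_elim
    case (elim x)
    have "\<bar>weak_grad h x $ j\<bar> \<le> norm (weak_grad h x)" by (rule component_le_norm_cart)
    then show ?case using elim by (simp add: weak_grad_def L_def)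
  qed
  define D where "D = real CARD('n) * L"
  have D: "D \<ge> 0" by (simp add: D_def L_def)
  obtain R where R: "R \<ge> 0" "\<And>x \<epsilon>. \<epsilon> > 0 \<Longrightarrow> norm x > R * \<epsilon> \<Longrightarrow> scaled \<psi> \<epsilon> x = 0"
    using mollifier_support[OF m] by metis
  have main: "AE x in lborel. \<bar>convol h (scaled \<psi> \<epsilon>) x - h x\<bar> \<le> D * R * \<epsilon>" if e: "0 < \<epsilon>" "\<epsilon> \<le> 1" for \<epsilon>
  proof -
    have me: "mollifier (scaled \<psi> \<epsilon>)" by (rule mollifier_scaled[OF m e(1)])
    have te: "test_function (scaled \<psi> \<epsilon>)" and pe: "\<And>x. 0 \<le> scaled \<psi> \<epsilon> x" using me by (auto simp: mollifier_def)
    have mk: "mollifier (scaled \<psi> (1 / real (Suc k)))" for k using mollifier_scaled[OF m] by simp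
    have tk: "test_function (scaled \<psi> (1 / real (Suc k)))" for k using mk by (auto simp: mollifier_def)
    note [measurable] = mh test_function_measurable[OF te] test_function_measurable[OF tk]
    have "AE x in lborel. norm x \<le> real n \<longrightarrow> \<bar>convol h (scaled \<psi> \<epsilon>) x - h x\<bar> \<le> D * R * \<epsilon>" for n
    proof -
      \<comment> \<open>Convolving at a point of norm at most n uses values in the ball of radius n
        + R because \<epsilon> is at most 1, so convergence is requested on that ball.\<close>
      obtain r :: "nat \<Rightarrow> nat"
        where r: "AE x in lborel. norm x \<le> real n + R \<longrightarrow> (\<lambda>k. mollify \<psi> h (r k) x) \<longlonglongrightarrow> h x"
        by (rule mollify_AE_subseq_bounded[OF mh M m])
      define g where "g k = mollify \<psi> h (r k)" for k
      have gL: "\<bar>g k x - g k y\<bar> \<le> D * norm (x - y)" for k x y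
        unfolding g_def D_def by (rule convol_Lipschitz[OF w L mk])
      have gM: "\<bar>g k x\<bar> \<le> M" for k x unfolding g_def by (rule convol_abs_le[OF mh M mk])
      have gm [measurable]: "g k \<in> borel_measurable borel" for k unfolding g_def by measurable
      have gl: "locally_integrable (g k)" for k
        by (rule bounded_locally_integrable[OF gm, where M = M]) (use gM in auto)
      have err: "\<bar>convol (g k) (scaled \<psi> \<epsilon>) x - g k x\<bar> \<le> D * (R * \<epsilon>)" for k x
        by (rule convol_Lipschitz_error[OF me gl _ gL D]) (use R e in auto)
      have conv: "(\<lambda>k. convol (g k) (scaled \<psi> \<epsilon>) x) \<longlonglongrightarrow> convol h (scaled \<psi> \<epsilon>) x" if x: "norm x \<le> real n" for x
        unfolding convol_def
      \<comment> \<open>All \<open>g k\<close> share the bound \<open>M\<close>, so a multiple of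
        the kernel dominates.\<close>
      proof (rule integral_dominated_convergence[where w = "\<lambda>y. M * scaled \<psi> \<epsilon> (x - y)"])
        show "AE y in lborel. (\<lambda>k. scaled \<psi> \<epsilon> (x - y) *\<^sub>R g k y) \<longlonglongrightarrow> scaled \<psi> \<epsilon> (x - y) *\<^sub>R h y"
          using r
        proof eventually_elim
          case (elim y)
          show ?case
          proof (cases "norm y \<le> real n + R")
            case True
            with elim show ?thesis unfolding g_def by (intro tendsto_intros) auto
          next
            case False
            have "norm y \<le> norm (x - y) + norm x" by (metis norm_triangle_sub norm_minus_commute add.commute)
            then have "norm (x - y) > R" using x False by linarith
            moreover have "R * \<epsilon> \<le> R * 1" using R(1) e by (intro mult_left_mono) auto
            ultimately show ?thesis using R(2)[of \<epsilon> "x - y"] e by simp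
          qed
        qed
        show "AE y in lborel. norm (scaled \<psi> \<epsilon> (x - y) *\<^sub>R g k y) \<le> M * scaled \<psi> \<epsilon> (x - y)" for k
          using gM[of k] pe by (intro AE_I2) (simp add: abs_mult mult.commute mult_right_mono)
      qed (use mollifier_shift(1)[OF me, of x] in auto)
      show ?thesis
        using r
      proof eventually_elim
        case (elim x)
        show ?case
        proof
          assume x: "norm x \<le> real n"
          then have "(\<lambda>k. g k x) \<longlonglongrightarrow> h x" using elim R(1) by (simp add: g_def)
          then have "(\<lambda>k. \<bar>convol (g k) (scaled \<psi> \<epsilon>) x - g k x\<bar>) \<longlonglongrightarrow> \<bar>convol h (scaled \<psi> \<epsilon>) x - h x\<bar>"
            by (intro tendsto_intros conv[OF x])
          from LIMSEQ_le_const2[OF this] err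
          show "\<bar>convol h (scaled \<psi> \<epsilon>) x - h x\<bar> \<le> D * R * \<epsilon>" by (auto simp: mult.assoc)
        qed
      qed
    qed
    then have "AE x in lborel. \<forall>n. norm x \<le> real n \<longrightarrow> \<bar>convol h (scaled \<psi> \<epsilon>) x - h x\<bar> \<le> D * R * \<epsilon>"
      by (intro AE_all_countable[THEN iffD2] allI)
    then show ?thesis by eventually_elim (meson real_arch_simple)
  qed
  show ?thesis
  proof (rule that[of "max \<bar>M\<bar> (D * R)"])
    show "AE x in lborel. \<bar>h x\<bar> \<le> max \<bar>M\<bar> (D * R)" using M by eventually_elim auto
    show "AE x in lborel. \<bar>convol h (scaled \<psi> \<epsilon>) x - h x\<bar> \<le> max \<bar>M\<bar> (D * R) * \<epsilon>" if e: "0 < \<epsilon>" "\<epsilon> \<le> 1" for \<epsilon>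
      using main[OF e]
    proof eventually_elim
      case (elim x)
      have "D * R * \<epsilon> \<le> max \<bar>M\<bar> (D * R) * \<epsilon>" using e by (intro mult_right_mono) auto
      with elim show ?case by linarith
    qed
  qed (use mh in auto)
qed

section \<open>Square integrable functions with values in a Euclidean space\<close>

lemma norm_sq_components: "(norm (x :: 'b::euclidean_space))\<^sup>2 = (\<Sum>b\<in>Basis. (x \<bullet> b)\<^sup>2)"
  unfolding power2_norm_eq_inner by (subst euclidean_inner) (simp add: power2_eq_square)

lemma L2_component:
  fixes f :: "real ^ 'n \<Rightarrow> 'b::euclidean_space"
  assumes f: "L2 f" and b: "b \<in> Basis"
  shows "L2 (\<lambda>x. f x \<bullet> b)" and "L2_norm (\<lambda>x. f x \<bullet> b) \<le> L2_norm f"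
proof -
  have [measurable]: "f \<in> borel_measurable borel" and i: "integrable lborel (\<lambda>x. (norm (f x))\<^sup>2)"
    using f by (auto simp: L2_def)
  have le: "(f x \<bullet> b)\<^sup>2 \<le> (norm (f x))\<^sup>2" for x
    using Basis_le_norm[OF b, of "f x"] by (metis abs_norm_cancel abs_le_square_iff)
  have i2: "integrable lborel (\<lambda>x. (f x \<bullet> b)\<^sup>2)"
    by (rule Bochner_Integration.integrable_bound[OF i]) (use le in auto)
  then show "L2 (\<lambda>x. f x \<bullet> b)" by (simp add: L2_real_iff)
  show "L2_norm (\<lambda>x. f x \<bullet> b) \<le> L2_norm f"
    unfolding L2_norm_def by (intro real_sqrt_le_mono) (use integral_mono[OF i2 i le] in simp)
qed

lemma L2_componentsI:
  fixes f :: "real ^ 'n \<Rightarrow> 'b::euclidean_space"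
  assumes f: "\<And>b. b \<in> Basis \<Longrightarrow> L2 (\<lambda>x. f x \<bullet> b)"
  shows "L2 f" and "(L2_norm f)\<^sup>2 = (\<Sum>b\<in>Basis. (L2_norm (\<lambda>x. f x \<bullet> b))\<^sup>2)"
proof -
  have "f \<in> borel_measurable borel"
    using f by (subst borel_measurable_euclidean_space) (auto simp: L2_real_iff)
  moreover have i: "integrable lborel (\<lambda>x. (f x \<bullet> b)\<^sup>2)" if "b \<in> Basis" for b
    using f[OF that] by (simp add: L2_real_iff)
  ultimately show "L2 f" by (auto simp: L2_def norm_sq_components)
  show "(L2_norm f)\<^sup>2 = (\<Sum>b\<in>Basis. (L2_norm (\<lambda>x. f x \<bullet> b))\<^sup>2)"
    using i by (simp add: L2_norm_def norm_sq_components sum_nonneg)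
qed

lemma L2_euclidean_diff:
  fixes f g :: "real ^ 'n \<Rightarrow> 'b::euclidean_space"
  assumes "L2 f" "L2 g"
  shows "L2 (\<lambda>x. f x - g x)"
  by (rule L2_componentsI) (use assms in \<open>simp add: inner_diff_left L2_diff L2_component\<close>)

lemma L2_euclidean_scaleR:
  fixes f g :: "real ^ 'n \<Rightarrow> 'b::euclidean_space"
  assumes "L2 f"
  shows "L2 (\<lambda>x. c *\<^sub>R f x)"
  by (rule L2_componentsI) (use assms in \<open>simp add: L2_scale L2_component\<close>)

lemma L2_euclidean_locally_integrable:
  fixes f :: "real ^ 'n \<Rightarrow> 'b::euclidean_space"
  assumes f: "L2 f"
  shows "locally_integrable f"
proof -
  have [measurable]: "f \<in> borel_measurable borel" using f by (simp add: L2_def)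
  have "L2 (\<lambda>x. norm (f x))" using f by (simp add: L2_real_iff L2_def)
  from L2_locally_integrable[OF this] show ?thesis
    unfolding locally_integrable_def set_integrable_def
  proof (intro conjI allI impI)
    fix K :: "(real^'n) set" assume *: "(\<lambda>x. norm (f x)) \<in> borel_measurable lborel \<and>
      (\<forall>K. compact K \<longrightarrow> integrable lborel (\<lambda>x. indicat_real K x *\<^sub>R norm (f x)))" and K: "compact K"
    then have i: "integrable lborel (\<lambda>x. indicat_real K x *\<^sub>R norm (f x))" by blast
    have [measurable]: "K \<in> sets borel" using K by (simp add: borel_compact)
    show "integrable lborel (\<lambda>x. indicat_real K x *\<^sub>R f x)"
      by (rule Bochner_Integration.integrable_bound[OF i]) auto
  qed measurable
qed

section \<open>Density of test functions\<close>

lemma ip_tendsto: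
  fixes f g :: "'a \<Rightarrow> real ^ 'n \<Rightarrow> real"
  assumes f: "\<forall>\<^sub>F s in F. L2 (f s)" "L2 f0" "((\<lambda>s. L2_norm (\<lambda>x. f s x - f0 x)) \<longlongrightarrow> 0) F"
    and g: "\<forall>\<^sub>F s in F. L2 (g s)" "L2 g0" "((\<lambda>s. L2_norm (\<lambda>x. g s x - g0 x)) \<longlongrightarrow> 0) F"
  shows "((\<lambda>s. ip (f s) (g s)) \<longlongrightarrow> ip f0 g0) F"
proof -
  define a where "a s = L2_norm (\<lambda>x. f s x - f0 x)" for s
  define b where "b s = L2_norm (\<lambda>x. g s x - g0 x)" for s
  have lim: "((\<lambda>s. a s * b s + a s * L2_norm g0 + L2_norm f0 * b s) \<longlongrightarrow> 0 * 0 + 0 * L2_norm g0 + L2_norm f0 * 0) F"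
    unfolding a_def b_def by (intro tendsto_intros f g)
  have "\<forall>\<^sub>F s in F. \<bar>ip (f s) (g s) - ip f0 g0\<bar> \<le> a s * b s + a s * L2_norm g0 + L2_norm f0 * b s"
    using f(1) g(1)
  proof eventually_elim
    case (elim s)
    have d: "L2 (\<lambda>x. f s x - f0 x)" "L2 (\<lambda>x. g s x - g0 x)" using elim f g by (auto intro: L2_diff)
    have "ip (f s) (g s) - ip f0 g0 = ip (\<lambda>x. f s x - f0 x) (\<lambda>x. g s x - g0 x)
        + ip (\<lambda>x. f s x - f0 x) g0 + ip f0 (\<lambda>x. g s x - g0 x)"
      using elim f(2) g(2) by (simp add: ip_diff_left ip_diff_right L2_diff)
    moreover have "\<bar>ip (\<lambda>x. f s x - f0 x) (\<lambda>x. g s x - g0 x)\<bar> \<le> a s * b s"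
      "\<bar>ip (\<lambda>x. f s x - f0 x) g0\<bar> \<le> a s * L2_norm g0" "\<bar>ip f0 (\<lambda>x. g s x - g0 x)\<bar> \<le> L2_norm f0 * b s"
      unfolding a_def b_def using d f(2) g(2) by (auto intro: ip_bound)
    ultimately show ?case by linarith
  qed
  then have "((\<lambda>s. ip (f s) (g s) - ip f0 g0) \<longlongrightarrow> 0) F"
    by (intro Lim_null_comparison[OF _ lim[simplified]]) simp
  then show ?thesis by (simp add: LIM_zero_iff)
qed

lemma L2_norm_tendsto:
  fixes f :: "'a \<Rightarrow> real ^ 'n \<Rightarrow> real"
  assumes f: "\<forall>\<^sub>F s in F. L2 (f s)" "L2 f0" "((\<lambda>s. L2_norm (\<lambda>x. f s x - f0 x)) \<longlongrightarrow> 0) F"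
  shows "((\<lambda>s. L2_norm (f s)) \<longlongrightarrow> L2_norm f0) F"
proof -
  have "((\<lambda>s. sqrt (ip (f s) (f s))) \<longlongrightarrow> sqrt (ip f0 f0)) F"
    by (intro tendsto_real_sqrt ip_tendsto f)
  then show ?thesis by (simp flip: L2_norm_ip)
qed

text \<open>For fixed x the argument of \<zeta> tends to 0, so continuity and the value 1 at the
  origin give pointwise convergence without a plateau. The constant K + 1 bounds the distance of
  \<zeta> from 1 and yields the dominating function.\<close>

lemma cutoff_tendsto:
  fixes \<zeta> G :: "real ^ 'n \<Rightarrow> real"
  assumes t: "test_function \<zeta>" and one: "\<zeta> 0 = 1" and G: "L2 G"
  shows "(\<lambda>n. L2_norm (\<lambda>x. \<zeta> (x /\<^sub>R real (Suc n)) * G x - G x)) \<longlonglongrightarrow> 0"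
proof -
  obtain K R where K: "K \<ge> 0" "\<And>x. \<bar>\<zeta> x\<bar> \<le> K" using test_function_bounded[OF t] by metis
  note [measurable] = test_function_measurable[OF t] L2_measurable[OF G]
  have iG: "integrable lborel (\<lambda>x. (K + 1)\<^sup>2 * (G x)\<^sup>2)" using G by (simp add: L2_real_iff)
  have "(\<lambda>n. LINT x|lborel. (\<zeta> (x /\<^sub>R real (Suc n)) * G x - G x)\<^sup>2) \<longlonglongrightarrow> (LINT x|(lborel :: (real^'n) measure). 0)"
  proof (rule integral_dominated_convergence[where w = "\<lambda>x. (K + 1)\<^sup>2 * (G x)\<^sup>2"])
    show "AE x in lborel. (\<lambda>n. (\<zeta> (x /\<^sub>R real (Suc n)) * G x - G x)\<^sup>2) \<longlonglongrightarrow> 0"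
    proof (rule AE_I2)
      fix x :: "real^'n"
      have "(\<lambda>n. x /\<^sub>R real (Suc n)) \<longlonglongrightarrow> 0 *\<^sub>R x"
        by (intro tendsto_scaleR tendsto_const LIMSEQ_inverse_real_of_nat)
      then have "(\<lambda>n. \<zeta> (x /\<^sub>R real (Suc n))) \<longlonglongrightarrow> \<zeta> 0"
        using smooth_continuous[of \<zeta>] t unfolding test_function_def continuous_on_def
        by (intro isCont_tendsto_compose[of 0 \<zeta>]) (auto simp: isCont_def)
      then have "(\<lambda>n. (\<zeta> (x /\<^sub>R real (Suc n)) * G x - G x)\<^sup>2) \<longlonglongrightarrow> (1 * G x - G x)\<^sup>2"
        unfolding one by (intro tendsto_intros)
      then show "(\<lambda>n. (\<zeta> (x /\<^sub>R real (Suc n)) * G x - G x)\<^sup>2) \<longlonglongrightarrow> 0" by simp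
    qed
    show "AE x in lborel. norm ((\<zeta> (x /\<^sub>R real (Suc n)) * G x - G x)\<^sup>2) \<le> (K + 1)\<^sup>2 * (G x)\<^sup>2" for n
    proof (rule AE_I2)
      fix x :: "real^'n"
      have "\<bar>\<zeta> (x /\<^sub>R real (Suc n)) - 1\<bar> \<le> K + 1" using K(2)[of "x /\<^sub>R real (Suc n)"] by linarith
      then have "(\<zeta> (x /\<^sub>R real (Suc n)) - 1)\<^sup>2 \<le> (K + 1)\<^sup>2"
        using K(1) by (metis abs_le_square_iff abs_of_nonneg add_nonneg_nonneg zero_le_one)
      then have "(\<zeta> (x /\<^sub>R real (Suc n)) - 1)\<^sup>2 * (G x)\<^sup>2 \<le> (K + 1)\<^sup>2 * (G x)\<^sup>2" by (intro mult_right_mono) auto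
      moreover have "(\<zeta> (x /\<^sub>R real (Suc n)) * G x - G x)\<^sup>2 = (\<zeta> (x /\<^sub>R real (Suc n)) - 1)\<^sup>2 * (G x)\<^sup>2"
        by (simp add: power_mult_distrib[symmetric] left_diff_distrib)
      ultimately show "norm ((\<zeta> (x /\<^sub>R real (Suc n)) * G x - G x)\<^sup>2) \<le> (K + 1)\<^sup>2 * (G x)\<^sup>2" by simp
    qed
  qed (use iG in auto)
  then have "(\<lambda>n. sqrt (LINT x|lborel. (\<zeta> (x /\<^sub>R real (Suc n)) * G x - G x)\<^sup>2)) \<longlonglongrightarrow> sqrt 0"
    by (intro tendsto_real_sqrt) simp
  then show ?thesis by (simp add: L2_norm_def)
qed

lemma L2_test: "test_function \<phi> \<Longrightarrow> L2 \<phi>" for \<phi> :: "real ^ 'n \<Rightarrow> real"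
proof -
  assume t: "test_function \<phi>"
  obtain K R where K: "\<And>x. \<bar>\<phi> x\<bar> \<le> K" "\<And>x. norm x > R \<Longrightarrow> \<phi> x = 0"
    using test_function_bounded[OF t] by metis
  have "L2 (\<lambda>x. indicat_real (cball 0 R) x * \<phi> x)"
    by (rule bounded_support_L2[OF test_function_measurable[OF t], of K]) (use K in auto)
  moreover have "indicat_real (cball 0 R) x * \<phi> x = \<phi> x" for x
    using K(2)[of x] by (cases "norm x > R") auto
  ultimately show ?thesis by simp
qed

text \<open>A mollifier is nonzero somewhere, as its integral is 1; translating that point to the
  origin and normalising the value gives a cutoff.\<close>

lemma mollifier_cutoff:
  fixes \<psi> :: "real ^ 'n \<Rightarrow> real"
  assumes m: "mollifier \<psi>"
  obtains \<zeta> :: "real ^ 'n \<Rightarrow> real" where "test_function \<zeta>" "\<zeta> 0 = 1"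
proof -
  have t: "test_function \<psi>" using m by (simp add: mollifier_def)
  have "\<exists>x. \<psi> x \<noteq> 0"
  proof (rule ccontr)
    assume "\<nexists>x. \<psi> x \<noteq> 0"
    then have "\<psi> = (\<lambda>_. 0)" by auto
    then show False using m by (simp add: mollifier_def)
  qed
  then obtain x0 where x0: "\<psi> x0 \<noteq> 0" by blast
  show ?thesis
    by (rule that[OF test_function_affine[OF t, of 1 "1 / \<psi> x0" x0]]) (use x0 in auto)
qed

text \<open>Mollify, then cut off at a growing scale. The product rule leaves the error
  \<open>partial_deriv j (X n) x * F x\<close>, which is of order 1/n in L2 since the derivative of
  a dilated cutoff carries the inverse scale. One \<phi> serves f and all first derivatives because
  there are finitely many directions.\<close>

lemma test_functions_dense:
  fixes f :: "real ^ 'n \<Rightarrow> real"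
  assumes m: "mollifier (\<psi> :: real ^ 'n \<Rightarrow> real)" and f: "L2 f" and g: "\<And>j. L2 (g j)"
    and w: "\<And>j. has_weak_partial j f (g j)" and e: "e > 0"
  shows "\<exists>\<phi>. test_function \<phi> \<and> L2_norm (\<lambda>x. \<phi> x - f x) < e \<and>
    (\<forall>j. L2_norm (\<lambda>x. partial_deriv j \<phi> x - g j x) < e)"
proof -
  have "\<forall>\<^sub>F \<delta> in at_right 0. L2_norm (\<lambda>x. convol f (scaled \<psi> \<delta>) x - f x) < e / 2 \<and>
      (\<forall>j\<in>UNIV. L2_norm (\<lambda>x. convol (g j) (scaled \<psi> \<delta>) x - g j x) < e / 2) \<and> 0 < \<delta>"
    using e by (intro eventually_conj eventually_ball_finite order_tendstoD(2)[OF convol_L2_tendsto]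
        eventually_at_right_less f g m ballI) auto
  then obtain \<delta> where d: "0 < \<delta>" "L2_norm (\<lambda>x. convol f (scaled \<psi> \<delta>) x - f x) < e / 2"
      "\<And>j. L2_norm (\<lambda>x. convol (g j) (scaled \<psi> \<delta>) x - g j x) < e / 2"
    using eventually_happens[of _ "at_right (0::real)"] by (auto simp: trivial_limit_at_right_real)
  define p where "p = scaled \<psi> \<delta>"
  have mp: "mollifier p" unfolding p_def by (rule mollifier_scaled[OF m d(1)])
  then have tp: "test_function p" by (simp add: mollifier_def)
  define F where "F = convol f p"
  define G where "G j = convol (g j) p" for j
  have F: "L2 F" and G: "L2 (G j)" for j unfolding F_def G_def by (rule convol_L2[OF _ mp], rule f g)+
  have lf: "locally_integrable f" by (rule L2_locally_integrable[OF f])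
  have sF: "smooth F" unfolding F_def by (rule smooth_convol[OF lf tp])
  have pF: "partial_deriv j F = G j" for j
    unfolding F_def G_def partial_deriv_convol[OF lf tp] by (rule convol_partial[OF w tp])
  obtain \<zeta> :: "real ^ 'n \<Rightarrow> real" where c: "test_function \<zeta>" "\<zeta> 0 = 1"
    using mollifier_cutoff[OF m] by metis
  define X where "X n x = \<zeta> (x /\<^sub>R real (Suc n))" for n x
  have Xa: "X n = (\<lambda>x. 1 * \<zeta> (inverse (real (Suc n)) *\<^sub>R x + 0))" for n by (simp add: X_def[abs_def])
  have tX: "test_function (X n)" for n
    unfolding Xa by (rule test_function_affine[OF c(1)]) simp
  have dX: "partial_deriv j (X n) x = inverse (real (Suc n)) * partial_deriv j \<zeta> (x /\<^sub>R real (Suc n))" for j n x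
    unfolding Xa using smooth_differentiable[of \<zeta>] c(1)
    by (subst partial_deriv_affine(2)) (auto simp: test_function_def)
  obtain K R where K: "K \<ge> 0" "\<And>x. \<bar>\<zeta> x\<bar> \<le> K" using test_function_bounded[OF c(1)] by metis
  have "\<exists>K. \<forall>x. \<bar>partial_deriv j \<zeta> x\<bar> \<le> K" for j
    using test_function_bounded[OF test_function_partial[OF c(1), of j]] by metis
  then obtain D where D: "\<And>j x. \<bar>partial_deriv j \<zeta> x\<bar> \<le> D j" by metis
  define \<phi> where "\<phi> n x = X n x * F x" for n x
  have t\<phi>: "test_function (\<phi> n)" for n unfolding \<phi>_def[abs_def] by (rule test_function_mult[OF tX sF])
  have d\<phi>: "partial_deriv j (\<phi> n) x = X n x * G j x + partial_deriv j (X n) x * F x" for j n x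
    unfolding \<phi>_def[abs_def] pF[symmetric]
    by (rule partial_deriv_mult) (use smooth_differentiable sF tX test_function_def in auto)
  have L1: "L2 (\<lambda>x. X n x * G j x)" for n j
    using K(2) by (intro L2_weight(1)[OF G test_function_measurable[OF tX]]) (auto simp: X_def)
  have Db: "\<bar>partial_deriv j (X n) x\<bar> \<le> inverse (real (Suc n)) * D j" for j n x
    unfolding dX abs_mult using D by (simp add: mult_left_mono)
  have L2: "L2 (\<lambda>x. partial_deriv j (X n) x * F x)"
    and N2: "L2_norm (\<lambda>x. partial_deriv j (X n) x * F x) \<le> inverse (real (Suc n)) * D j * L2_norm F" for n j
    using L2_weight[OF F test_function_measurable[OF test_function_partial[OF tX]] AE_I2[OF Db]] by auto
  have 1: "(\<lambda>n. L2_norm (\<lambda>x. \<phi> n x - F x)) \<longlonglongrightarrow> 0"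
    unfolding \<phi>_def X_def by (rule cutoff_tendsto[OF c F])
  have 2: "(\<lambda>n. L2_norm (\<lambda>x. partial_deriv j (\<phi> n) x - G j x)) \<longlonglongrightarrow> 0" for j
  proof (rule Lim_null_comparison)
    show "\<forall>\<^sub>F n in sequentially. norm (L2_norm (\<lambda>x. partial_deriv j (\<phi> n) x - G j x))
        \<le> L2_norm (\<lambda>x. X n x * G j x - G j x) + inverse (real (Suc n)) * D j * L2_norm F"
    proof (rule always_eventually, rule allI)
      fix n
      have ia: "L2 (\<lambda>x. X n x * G j x - G j x)" by (rule L2_diff[OF L1 G])
      have ib: "L2 (\<lambda>x. partial_deriv j (X n) x * F x)" by (rule L2)
      have ic: "L2_norm (\<lambda>x. partial_deriv j (X n) x * F x) \<le> inverse (real (Suc n)) * D j * L2_norm F" by (rule N2)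
      have "L2_norm (\<lambda>x. (X n x * G j x - G j x) + partial_deriv j (X n) x * F x)
          \<le> L2_norm (\<lambda>x. X n x * G j x - G j x) + inverse (real (Suc n)) * D j * L2_norm F"
        using L2_norm_triangle[OF ia ib] ic by linarith
      then show "norm (L2_norm (\<lambda>x. partial_deriv j (\<phi> n) x - G j x))
        \<le> L2_norm (\<lambda>x. X n x * G j x - G j x) + inverse (real (Suc n)) * D j * L2_norm F"
        by (simp add: d\<phi> algebra_simps)
    qed
    have "(\<lambda>n. L2_norm (\<lambda>x. X n x * G j x - G j x) + inverse (real (Suc n)) * D j * L2_norm F) \<longlonglongrightarrow> 0 + 0 * D j * L2_norm F"
      unfolding X_def by (intro tendsto_intros cutoff_tendsto[OF c G] LIMSEQ_inverse_real_of_nat)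
    then show "(\<lambda>n. L2_norm (\<lambda>x. X n x * G j x - G j x) + inverse (real (Suc n)) * D j * L2_norm F) \<longlonglongrightarrow> 0" by simp
  qed
  have "\<forall>\<^sub>F n in sequentially. L2_norm (\<lambda>x. \<phi> n x - F x) < e / 2 \<and>
      (\<forall>j\<in>UNIV. L2_norm (\<lambda>x. partial_deriv j (\<phi> n) x - G j x) < e / 2)"
    using e by (intro eventually_conj eventually_ball_finite ballI order_tendstoD(2)[OF 1] order_tendstoD(2)[OF 2]) auto
  then obtain n where n: "L2_norm (\<lambda>x. \<phi> n x - F x) < e / 2"
      "\<And>j. L2_norm (\<lambda>x. partial_deriv j (\<phi> n) x - G j x) < e / 2"
    by (auto simp: eventually_sequentially)
  have tri: "L2_norm (\<lambda>x. a x - c x) < e" if "L2 a" "L2 b" "L2 c"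
      "L2_norm (\<lambda>x. a x - b x) < e / 2" "L2_norm (\<lambda>x. b x - c x) < e / 2" for a b c :: "real^'n \<Rightarrow> real"
    using L2_norm_triangle[OF L2_diff[OF that(1,2)] L2_diff[OF that(2,3)]] that by simp
  show ?thesis
    using tri[OF L2_test[OF t\<phi>] F f n(1)] tri[OF L2_test[OF test_function_partial[OF t\<phi>]] G g n(2)] d(2,3) t\<phi>
    by (intro exI[of _ "\<phi> n"]) (auto simp: F_def G_def p_def)
qed

text \<open>The distributional equation saying that, at each time, the time derivative of v is the
  divergence of \<open>F\<close>. The flux \<open>F\<close> is arbitrary, so the difference of two
  solutions with different coefficients is covered as well.\<close>

definition weak_equation ::
    "real \<Rightarrow> (real \<Rightarrow> real ^ 'n \<Rightarrow> real) \<Rightarrow> ('n \<Rightarrow> real \<Rightarrow> real ^ 'n \<Rightarrow> real) \<Rightarrow> bool" where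
  "weak_equation T v F \<longleftrightarrow> (\<forall>\<phi>. test_function \<phi> \<longrightarrow> (\<forall>t\<in>{0..T}.
     ((\<lambda>s. ip \<phi> (v s)) has_real_derivative - (\<Sum>j\<in>UNIV. ip (partial_deriv j \<phi>) (F j t))) (at t within {0..T})))"

text \<open>Mean value inequality for the pairing minus its tangent at r. The bound contains \<phi>
  only through the L2 norms of its partial derivatives, so it extends by density, whereas
  differentiability of the pairing would not pass to the limit directly.\<close>

lemma weak_equation_increment_test:
  fixes v :: "real \<Rightarrow> real ^ 'n \<Rightarrow> real"
  assumes eq: "weak_equation T v F" and t: "test_function \<phi>"
    and F: "\<And>j t. t \<in> {0..T} \<Longrightarrow> L2 (F j t)" and rs: "r \<in> {0..T}" "s \<in> {0..T}"
    and \<eta>: "\<And>j \<tau>. \<tau> \<in> {0..T} \<Longrightarrow> \<bar>\<tau> - r\<bar> \<le> \<bar>s - r\<bar> \<Longrightarrow> L2_norm (\<lambda>x. F j \<tau> x - F j r x) \<le> \<eta>"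
  shows "\<bar>ip \<phi> (v s) - ip \<phi> (v r) + (s - r) * (\<Sum>j\<in>UNIV. ip (partial_deriv j \<phi>) (F j r))\<bar>
    \<le> \<bar>s - r\<bar> * (\<eta> * (\<Sum>j\<in>UNIV. L2_norm (partial_deriv j \<phi>)))"
proof -
  \<comment> \<open>\<open>s\<close> may lie on either side of \<open>r\<close>; the segment is
    written for both orders.\<close>
  define S where "S = {min r s..max r s}"
  have S: "S \<subseteq> {0..T}" "r \<in> S" "s \<in> S" using rs by (auto simp: S_def)
  define A where "A t = (\<Sum>j\<in>UNIV. ip (partial_deriv j \<phi>) (F j t))" for t
  \<comment> \<open>Adding \<open>t * A r\<close> removes the derivative at \<open>r\<close>; what
    remains is \<open>A r - A z\<close>, whose size is controlled by \<eta>.\<close>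
  have "norm ((ip \<phi> (v s) + s * A r) - (ip \<phi> (v r) + r * A r)) \<le> (\<eta> * (\<Sum>j\<in>UNIV. L2_norm (partial_deriv j \<phi>))) * norm (s - r)"
  proof (rule field_differentiable_bound[where S = S and f' = "\<lambda>t. - A t + A r"])
    show "convex S" by (simp add: S_def)
    fix z assume z: "z \<in> S"
    then have z': "z \<in> {0..T}" "\<bar>z - r\<bar> \<le> \<bar>s - r\<bar>" using S by (auto simp: S_def)
    have "((\<lambda>t. ip \<phi> (v t)) has_real_derivative - A z) (at z within {0..T})"
      using eq t z'(1) by (simp add: A_def weak_equation_def)
    from DERIV_subset[OF this S(1)]
    have "((\<lambda>t. ip \<phi> (v t)) has_real_derivative - A z) (at z within S)" .
    then show "((\<lambda>t. ip \<phi> (v t) + t * A r) has_real_derivative - A z + A r) (at z within S)"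
      by (auto intro!: derivative_eq_intros)
    have "\<bar>A z - A r\<bar> = \<bar>\<Sum>j\<in>UNIV. ip (partial_deriv j \<phi>) (\<lambda>x. F j z x - F j r x)\<bar>"
    proof -
      have "ip (partial_deriv j \<phi>) (\<lambda>x. F j z x - F j r x) = ip (partial_deriv j \<phi>) (F j z) - ip (partial_deriv j \<phi>) (F j r)" for j
        by (intro ip_diff_right F z' rs L2_test[OF test_function_partial[OF t]])
      then show ?thesis by (simp add: A_def sum_subtractf)
    qed
    also have "\<dots> \<le> (\<Sum>j\<in>UNIV. \<eta> * L2_norm (partial_deriv j \<phi>))"
    proof (rule order_trans[OF sum_abs], rule sum_mono)
      fix j
      have "\<bar>ip (partial_deriv j \<phi>) (\<lambda>x. F j z x - F j r x)\<bar> \<le> L2_norm (partial_deriv j \<phi>) * L2_norm (\<lambda>x. F j z x - F j r x)"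
        by (intro ip_bound L2_diff F z' rs L2_test[OF test_function_partial[OF t]])
      also have "\<dots> \<le> L2_norm (partial_deriv j \<phi>) * \<eta>" by (intro mult_left_mono \<eta> z') simp
      finally show "\<bar>ip (partial_deriv j \<phi>) (\<lambda>x. F j z x - F j r x)\<bar> \<le> \<eta> * L2_norm (partial_deriv j \<phi>)"
        by (simp add: mult.commute)
    qed
    finally show "norm (- A z + A r) \<le> \<eta> * (\<Sum>j\<in>UNIV. L2_norm (partial_deriv j \<phi>))"
      by (simp add: sum_distrib_left)
  qed (use S in auto)
  then show ?thesis by (simp add: A_def algebra_simps)
qed

text \<open>Test functions that approximate f together with its weak gradient turn the previous
  inequality into one for f: both sides are continuous in the norms in which the approximation
  holds.\<close>

lemma weak_equation_increment:
  fixes v :: "real \<Rightarrow> real ^ 'n \<Rightarrow> real"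
  assumes m: "mollifier (\<psi> :: real ^ 'n \<Rightarrow> real)"
    and eq: "weak_equation T v F"
    and v: "\<And>t. t \<in> {0..T} \<Longrightarrow> L2 (v t)"
    and F: "\<And>j t. t \<in> {0..T} \<Longrightarrow> L2 (F j t)" and rs: "r \<in> {0..T}" "s \<in> {0..T}"
    and \<eta>: "\<And>j \<tau>. \<tau> \<in> {0..T} \<Longrightarrow> \<bar>\<tau> - r\<bar> \<le> \<bar>s - r\<bar> \<Longrightarrow> L2_norm (\<lambda>x. F j \<tau> x - F j r x) \<le> \<eta>"
    and f: "L2 f" and g: "\<And>j. L2 (g j)" and w: "\<And>j. has_weak_partial j f (g j)"
  shows "\<bar>ip f (v s) - ip f (v r) + (s - r) * (\<Sum>j\<in>UNIV. ip (g j) (F j r))\<bar>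
    \<le> \<bar>s - r\<bar> * (\<eta> * (\<Sum>j\<in>UNIV. L2_norm (g j)))"
proof -
  have "\<exists>\<phi>. test_function \<phi> \<and> L2_norm (\<lambda>x. \<phi> x - f x) < 1 / real (Suc k) \<and>
    (\<forall>j. L2_norm (\<lambda>x. partial_deriv j \<phi> x - g j x) < 1 / real (Suc k))" for k
    by (rule test_functions_dense[OF m f g w]) simp
  then obtain \<phi> where p: "\<And>k. test_function (\<phi> k)"
      "\<And>k. L2_norm (\<lambda>x. \<phi> k x - f x) < 1 / real (Suc k)"
      "\<And>k j. L2_norm (\<lambda>x. partial_deriv j (\<phi> k) x - g j x) < 1 / real (Suc k)"
    by metis
  note Lp = L2_test[OF p(1)] L2_test[OF test_function_partial[OF p(1)]]
  have inv: "(\<lambda>k. 1 / real (Suc k)) \<longlonglongrightarrow> 0"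
    using LIMSEQ_inverse_real_of_nat by (simp add: inverse_eq_divide)
  have l1: "(\<lambda>k. L2_norm (\<lambda>x. \<phi> k x - f x)) \<longlonglongrightarrow> 0"
    by (rule Lim_null_comparison[OF _ inv]) (use p(2) in \<open>auto simp: less_imp_le simp del: of_nat_Suc\<close>)
  have l2: "(\<lambda>k. L2_norm (\<lambda>x. partial_deriv j (\<phi> k) x - g j x)) \<longlonglongrightarrow> 0" for j
    by (rule Lim_null_comparison[OF _ inv]) (use p(3) in \<open>auto simp: less_imp_le simp del: of_nat_Suc\<close>)
  have c: "(\<lambda>k::nat. L2_norm (\<lambda>x. q x - q x)) \<longlonglongrightarrow> 0" for q :: "real^'n \<Rightarrow> real" by (simp add: L2_norm_def)
  have A: "(\<lambda>k. ip (\<phi> k) q) \<longlonglongrightarrow> ip f q" if "L2 q" for q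
    by (rule ip_tendsto) (use Lp f l1 c that in auto)
  have B: "(\<lambda>k. ip (partial_deriv j (\<phi> k)) q) \<longlonglongrightarrow> ip (g j) q" if "L2 q" for j q
    by (rule ip_tendsto) (use Lp g l2 c that in auto)
  have C: "(\<lambda>k. L2_norm (partial_deriv j (\<phi> k))) \<longlonglongrightarrow> L2_norm (g j)" for j
    by (rule L2_norm_tendsto) (use Lp g l2 in auto)
  have l: "(\<lambda>k. \<bar>ip (\<phi> k) (v s) - ip (\<phi> k) (v r) + (s - r) * (\<Sum>j\<in>UNIV. ip (partial_deriv j (\<phi> k)) (F j r))\<bar>)
     \<longlonglongrightarrow> \<bar>ip f (v s) - ip f (v r) + (s - r) * (\<Sum>j\<in>UNIV. ip (g j) (F j r))\<bar>"
    by (intro tendsto_intros A B v F rs)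
  have r: "(\<lambda>k. \<bar>s - r\<bar> * (\<eta> * (\<Sum>j\<in>UNIV. L2_norm (partial_deriv j (\<phi> k)))))
     \<longlonglongrightarrow> \<bar>s - r\<bar> * (\<eta> * (\<Sum>j\<in>UNIV. L2_norm (g j)))"
    by (intro tendsto_intros C)
  show ?thesis
    by (rule LIMSEQ_le[OF l r]) (use weak_equation_increment_test[OF eq p(1) F rs \<eta>] in blast)
qed

section \<open>Curves in \<open>L\<^sup>2\<close>\<close>

abbreviation L2_curve :: "real \<Rightarrow> (real \<Rightarrow> real ^ 'n \<Rightarrow> real) \<Rightarrow> bool" where
  "L2_curve \<equiv> C_curve L2 L2_norm"

abbreviation L2_C1_curve ::
    "real \<Rightarrow> (real \<Rightarrow> real ^ 'n \<Rightarrow> real) \<Rightarrow> (real \<Rightarrow> real ^ 'n \<Rightarrow> real) \<Rightarrow> bool" where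
  "L2_C1_curve \<equiv> C1_curve L2 L2_norm"

lemma L2_curveD:
  assumes "L2_curve T u" "t \<in> {0..T}"
  shows "L2 (u t)" "((\<lambda>s. L2_norm (\<lambda>x. u s x - u t x)) \<longlongrightarrow> 0) (at t within {0..T})"
    "\<forall>\<^sub>F s in at t within {0..T}. L2 (u s)"
  using assms by (auto simp: C_curve_def eventually_at_filter)

lemma L2_curve_diff:
  assumes u: "L2_curve T u" and w: "L2_curve T w"
  shows "L2_curve T (\<lambda>t x. u t x - w t x)"
  unfolding C_curve_def
proof (intro ballI conjI)
  fix t assume t: "t \<in> {0..T}"
  show "L2 (\<lambda>x. u t x - w t x)" using L2_curveD(1) u w t by (blast intro: L2_diff)
  have "\<forall>\<^sub>F s in at t within {0..T}. norm (L2_norm (\<lambda>x. u s x - w s x - (u t x - w t x)))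
      \<le> L2_norm (\<lambda>x. u s x - u t x) + L2_norm (\<lambda>x. w s x - w t x)"
    using L2_curveD(3)[OF u t] L2_curveD(3)[OF w t]
  proof eventually_elim
    case (elim s)
    have "L2_norm (\<lambda>x. (u s x - u t x) - (w s x - w t x)) \<le> L2_norm (\<lambda>x. u s x - u t x) + L2_norm (\<lambda>x. w s x - w t x)"
      using elim L2_curveD(1)[OF u t] L2_curveD(1)[OF w t] by (intro L2_norm_triangle_diff L2_diff)
    then show ?case by (simp add: algebra_simps)
  qed
  then show "((\<lambda>s. L2_norm (\<lambda>x. u s x - w s x - (u t x - w t x))) \<longlongrightarrow> 0) (at t within {0..T})"
    by (rule Lim_null_comparison) (intro tendsto_add_zero L2_curveD(2) u w t)
qed

lemma L2_curve_weight:
  fixes m :: "real ^ 'n \<Rightarrow> real"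
  assumes u: "L2_curve T u" and m: "m \<in> borel_measurable borel" and M: "AE x in lborel. \<bar>m x\<bar> \<le> M"
  shows "L2_curve T (\<lambda>t x. m x * u t x)"
  unfolding C_curve_def
proof (intro ballI conjI)
  fix t assume t: "t \<in> {0..T}"
  show "L2 (\<lambda>x. m x * u t x)" by (rule L2_weight(1)[OF L2_curveD(1)[OF u t] m M])
  have "\<forall>\<^sub>F s in at t within {0..T}. norm (L2_norm (\<lambda>x. m x * u s x - m x * u t x))
      \<le> M * L2_norm (\<lambda>x. u s x - u t x)"
    using L2_curveD(3)[OF u t]
  proof eventually_elim
    case (elim s)
    show ?case
      using L2_weight(2)[OF L2_diff[OF elim L2_curveD(1)[OF u t]] m M] by (simp add: right_diff_distrib)
  qed
  then show "((\<lambda>s. L2_norm (\<lambda>x. m x * u s x - m x * u t x)) \<longlongrightarrow> 0) (at t within {0..T})"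
    by (rule Lim_null_comparison) (intro tendsto_mult_right_zero L2_curveD(2) u t)
qed

lemma has_curve_deriv_real:
  fixes u v :: "real \<Rightarrow> real ^ 'n \<Rightarrow> real"
  shows "has_curve_deriv L2_norm T u v \<longleftrightarrow> (\<forall>t\<in>{0..T}.
    ((\<lambda>s. L2_norm (\<lambda>x. (u s x - u t x) * inverse (s - t) - v t x)) \<longlongrightarrow> 0) (at t within {0..T}))"
  by (simp add: has_curve_deriv_def mult.commute)

lemma L2_C1_curveD:
  assumes "L2_C1_curve T u v"
  shows "L2_curve T u" "L2_curve T v" "t \<in> {0..T} \<Longrightarrow>
    ((\<lambda>s. L2_norm (\<lambda>x. (u s x - u t x) * inverse (s - t) - v t x)) \<longlongrightarrow> 0) (at t within {0..T})"
  using assms unfolding C1_curve_def has_curve_deriv_real by auto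

lemma L2_C1_curve_diff:
  assumes u: "L2_C1_curve T u u'" and w: "L2_C1_curve T w w'"
  shows "L2_C1_curve T (\<lambda>t x. u t x - w t x) (\<lambda>t x. u' t x - w' t x)"
  unfolding C1_curve_def has_curve_deriv_real
proof (intro ballI conjI)
  show "L2_curve T (\<lambda>t x. u t x - w t x)" "L2_curve T (\<lambda>t x. u' t x - w' t x)"
    using u w by (auto intro: L2_curve_diff L2_C1_curveD)
  fix t assume t: "t \<in> {0..T}"
  note c = L2_C1_curveD(1,2)[OF u] L2_C1_curveD(1,2)[OF w]
  have "\<forall>\<^sub>F s in at t within {0..T}. norm (L2_norm (\<lambda>x. (u s x - w s x - (u t x - w t x)) * inverse (s - t) - (u' t x - w' t x)))
      \<le> L2_norm (\<lambda>x. (u s x - u t x) * inverse (s - t) - u' t x) + L2_norm (\<lambda>x. (w s x - w t x) * inverse (s - t) - w' t x)"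
    using L2_curveD(3)[OF c(1) t] L2_curveD(3)[OF c(3) t]
  proof eventually_elim
    case (elim s)
    have "L2 (\<lambda>x. (u s x - u t x) * inverse (s - t) - u' t x)" "L2 (\<lambda>x. (w s x - w t x) * inverse (s - t) - w' t x)"
      unfolding mult.commute[of _ "inverse (s - t)"]
      using elim c[THEN L2_curveD(1), OF t] by (auto intro!: L2_diff L2_scale)
    from L2_norm_triangle_diff[OF this] show ?case by (simp add: algebra_simps)
  qed
  then show "((\<lambda>s. L2_norm (\<lambda>x. (u s x - w s x - (u t x - w t x)) * inverse (s - t) - (u' t x - w' t x))) \<longlongrightarrow> 0) (at t within {0..T})"
    by (rule Lim_null_comparison) (intro tendsto_add_zero L2_C1_curveD(3) u w t)
qed

lemma L2_C1_curve_weight: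
  fixes m :: "real ^ 'n \<Rightarrow> real"
  assumes u: "L2_C1_curve T u v" and m: "m \<in> borel_measurable borel" and M: "AE x in lborel. \<bar>m x\<bar> \<le> M"
  shows "L2_C1_curve T (\<lambda>t x. m x * u t x) (\<lambda>t x. m x * v t x)"
  unfolding C1_curve_def has_curve_deriv_real
proof (intro ballI conjI)
  note c = L2_C1_curveD(1,2)[OF u]
  show "L2_curve T (\<lambda>t x. m x * u t x)" "L2_curve T (\<lambda>t x. m x * v t x)"
    using c by (auto intro: L2_curve_weight m M)
  fix t assume t: "t \<in> {0..T}"
  have "\<forall>\<^sub>F s in at t within {0..T}. norm (L2_norm (\<lambda>x. (m x * u s x - m x * u t x) * inverse (s - t) - m x * v t x))
      \<le> M * L2_norm (\<lambda>x. (u s x - u t x) * inverse (s - t) - v t x)"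
    using L2_curveD(3)[OF c(1) t]
  proof eventually_elim
    case (elim s)
    have "L2 (\<lambda>x. (u s x - u t x) * inverse (s - t) - v t x)"
      unfolding mult.commute[of _ "inverse (s - t)"]
      using elim c[THEN L2_curveD(1), OF t] by (auto intro!: L2_diff L2_scale)
    from L2_weight(2)[OF this m M] show ?case by (simp add: algebra_simps)
  qed
  then show "((\<lambda>s. L2_norm (\<lambda>x. (m x * u s x - m x * u t x) * inverse (s - t) - m x * v t x)) \<longlongrightarrow> 0) (at t within {0..T})"
    by (rule Lim_null_comparison) (intro tendsto_mult_right_zero L2_C1_curveD(3) u t)
qed

lemma ip_has_derivative:
  assumes u: "L2_C1_curve T u u'" and w: "L2_C1_curve T w w'" and t: "t \<in> {0..T}"
  shows "((\<lambda>s. ip (u s) (w s)) has_real_derivative ip (u' t) (w t) + ip (u t) (w' t)) (at t within {0..T})"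
  unfolding has_field_derivative_iff
proof -
  note c = L2_C1_curveD(1,2)[OF u] L2_C1_curveD(1,2)[OF w]
  note L = c[THEN L2_curveD(1), OF t]
  define a where "a s x = (u s x - u t x) * inverse (s - t)" for s x
  define b where "b s x = (w s x - w t x) * inverse (s - t)" for s x
  have ev: "\<forall>\<^sub>F s in at t within {0..T}. L2 (u s) \<and> L2 (w s) \<and> L2 (a s) \<and> L2 (b s)"
    using L2_curveD(3)[OF c(1) t] L2_curveD(3)[OF c(3) t]
  proof eventually_elim
    case (elim s)
    have "L2 (a s)" "L2 (b s)"
      unfolding a_def[abs_def] b_def[abs_def] mult.commute[of _ "inverse (s - t)"]
      using elim L by (auto intro!: L2_diff L2_scale)
    then show ?case using elim by simp
  qed
  have z: "((\<lambda>s. L2_norm (\<lambda>x. u t x - u t x)) \<longlongrightarrow> 0) (at t within {0..T})" by (simp add: L2_norm_def)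
  have "((\<lambda>s. ip (a s) (w s) + ip (u t) (b s)) \<longlongrightarrow> ip (u' t) (w t) + ip (u t) (w' t)) (at t within {0..T})"
  proof (intro tendsto_add ip_tendsto)
    show "((\<lambda>s. L2_norm (\<lambda>x. a s x - u' t x)) \<longlongrightarrow> 0) (at t within {0..T})"
      unfolding a_def by (rule L2_C1_curveD(3)[OF u t])
    show "((\<lambda>s. L2_norm (\<lambda>x. b s x - w' t x)) \<longlongrightarrow> 0) (at t within {0..T})"
      unfolding b_def by (rule L2_C1_curveD(3)[OF w t])
  qed (use ev L z L2_curveD(2)[OF c(3) t] in \<open>auto elim: eventually_mono\<close>)
  moreover have "\<forall>\<^sub>F s in at t within {0..T}.
      ip (a s) (w s) + ip (u t) (b s) = (ip (u s) (w s) - ip (u t) (w t)) / (s - t)"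
    using ev
  proof eventually_elim
    case (elim s)
    have "ip (a s) (w s) = inverse (s - t) * (ip (u s) (w s) - ip (u t) (w s))"
      unfolding a_def[abs_def] mult.commute[of _ "inverse (s - t)"] ip_scale_left
      using elim L by (subst ip_diff_left) auto
    moreover have "ip (u t) (b s) = inverse (s - t) * (ip (u t) (w s) - ip (u t) (w t))"
      unfolding b_def[abs_def] mult.commute[of _ "inverse (s - t)"] ip_scale_right
      using elim L by (subst ip_diff_right) auto
    ultimately show ?case by (simp add: divide_inverse algebra_simps)
  qed
  ultimately show "((\<lambda>s. (ip (u s) (w s) - ip (u t) (w t)) / (s - t)) \<longlongrightarrow> ip (u' t) (w t) + ip (u t) (w' t)) (at t within {0..T})"
    by (rule Lim_transform_eventually)
qed

lemma has_weak_partial_add: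
  fixes f g :: "real ^ 'n \<Rightarrow> real"
  assumes "has_weak_partial j f f'" "has_weak_partial j g g'"
  shows "has_weak_partial j (\<lambda>x. f x + g x) (\<lambda>x. f' x + g' x)"
  using has_weak_partial_diff[OF assms(1) has_weak_partial_scaleR[OF assms(2), of "-1"]] by simp

text \<open>The equation is tested with \<open>v s + v t\<close>, so no second time derivative of the solution is needed.\<close>

lemma kinetic_energy_derivative:
  fixes v :: "real \<Rightarrow> real ^ 'n \<Rightarrow> real"
  assumes m: "mollifier (\<psi> :: real ^ 'n \<Rightarrow> real)"
    and eq: "weak_equation T v F"
    and v: "L2_curve T v" and V: "\<And>j. L2_curve T (V j)" and F: "\<And>j. L2_curve T (F j)"
    and w: "\<And>j t. t \<in> {0..T} \<Longrightarrow> has_weak_partial j (v t) (V j t)" and t: "t \<in> {0..T}"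
  shows "((\<lambda>s. ip (v s) (v s)) has_real_derivative - 2 * (\<Sum>j\<in>UNIV. ip (V j t) (F j t))) (at t within {0..T})"
  unfolding has_field_derivative_iff
proof -
  let ?F = "at t within {0..T}"
  define q where "q s = (ip (v s) (v s) - ip (v t) (v t)) / (s - t)" for s
  \<comment> \<open>Pairing of the gradient of the tested function \<open>v s + v t\<close> with the
    flux at \<open>t\<close>; as s tends to t it approaches twice the pairing of
    \<open>V j t\<close> with \<open>F j t\<close>, summed over j.\<close>
  define A where "A s = (\<Sum>j\<in>UNIV. ip (\<lambda>x. V j s x + V j t x) (F j t))" for s
  have z: "((\<lambda>s. L2_norm (\<lambda>x. f x - f x)) \<longlongrightarrow> 0) ?F" for f :: "real^'n \<Rightarrow> real" by (simp add: L2_norm_def)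
  have "((\<lambda>s. \<Sum>j\<in>UNIV. ip (V j s) (F j t) + ip (V j t) (F j t)) \<longlongrightarrow>
      (\<Sum>j\<in>UNIV. ip (V j t) (F j t) + ip (V j t) (F j t))) ?F"
    by (intro tendsto_sum tendsto_add tendsto_const ip_tendsto z L2_curveD(2,3)[OF V t] L2_curveD(1)[OF V t]
        L2_curveD(1)[OF F t] always_eventually allI)
  moreover have "\<forall>\<^sub>F s in ?F. (\<Sum>j\<in>UNIV. ip (V j s) (F j t) + ip (V j t) (F j t)) = A s"
    unfolding eventually_at_filter A_def
    by (intro always_eventually allI impI sum.cong refl ip_add_left[symmetric])
      (auto intro: L2_curveD(1)[OF V] L2_curveD(1)[OF F t] simp: t[simplified])
  ultimately have A: "(A \<longlongrightarrow> (\<Sum>j\<in>UNIV. ip (V j t) (F j t) + ip (V j t) (F j t))) ?F"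
    by (rule Lim_transform_eventually)
  have "((\<lambda>s. q s + A s) \<longlongrightarrow> 0) ?F"
  proof (rule tendstoI)
    fix e :: real assume e: "e > 0"
    \<comment> \<open>Bounds the gradient norms of \<open>v s + v t\<close> for s near t, where
      \<open>L2_norm (V j s) < L2_norm (V j t) + 1\<close>.\<close>
    define K where "K = (\<Sum>j\<in>(UNIV :: 'n set). 2 * L2_norm (V j t) + 1)"
    have K: "K \<ge> 0" unfolding K_def by (intro sum_nonneg) simp
    define \<eta> where "\<eta> = e / (K + 1)"
    have \<eta>: "\<eta> > 0" "\<eta> * K < e" using e K by (auto simp: \<eta>_def field_simps)
    have "\<forall>\<^sub>F s in ?F. \<forall>j\<in>UNIV. L2_norm (\<lambda>x. F j s x - F j t x) < \<eta>"
      by (intro eventually_ball_finite ballI order_tendstoD(2)[OF L2_curveD(2)[OF F t] \<eta>(1)]) auto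
    then obtain d where d: "d > 0" "\<And>s j. s \<in> {0..T} \<Longrightarrow> s \<noteq> t \<Longrightarrow> dist s t < d \<Longrightarrow> L2_norm (\<lambda>x. F j s x - F j t x) < \<eta>"
      unfolding eventually_at by auto
    have d': "L2_norm (\<lambda>x. F j s x - F j t x) \<le> \<eta>" if "s \<in> {0..T}" "\<bar>s - t\<bar> < d" for s j
      using d(2)[of s j] that \<eta>(1) by (cases "s = t") (auto simp: dist_real_def L2_norm_def less_imp_le)
    have "\<forall>\<^sub>F s in ?F. \<forall>j\<in>UNIV. L2_norm (V j s) < L2_norm (V j t) + 1"
      by (intro eventually_ball_finite ballI order_tendstoD(2)[OF L2_norm_tendsto[OF L2_curveD(3)[OF V t] L2_curveD(1)[OF V t] L2_curveD(2)[OF V t]]]) auto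
    moreover have "\<forall>\<^sub>F s in ?F. s \<in> {0..T} \<and> s \<noteq> t \<and> \<bar>s - t\<bar> < d"
      using d(1) unfolding eventually_at by (auto simp: dist_real_def)
    ultimately show "\<forall>\<^sub>F s in ?F. dist (q s + A s) 0 < e"
    proof eventually_elim
      case (elim s)
      then have s: "s \<in> {0..T}" and st: "s \<noteq> t" and sd: "\<bar>s - t\<bar> < d" and Vs: "\<And>j. L2_norm (V j s) < L2_norm (V j t) + 1"
        by auto
      note Lv = L2_curveD(1)[OF v s] L2_curveD(1)[OF v t]
      note LV = L2_curveD(1)[OF V s] L2_curveD(1)[OF V t]
      have sum: "(\<Sum>j\<in>UNIV. L2_norm (\<lambda>x. V j s x + V j t x)) \<le> K"
        unfolding K_def
      proof (rule sum_mono)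
        fix j show "L2_norm (\<lambda>x. V j s x + V j t x) \<le> 2 * L2_norm (V j t) + 1"
          using L2_norm_triangle[OF LV(1)[of j] LV(2)[of j]] Vs[of j] by linarith
      qed
      have "\<bar>ip (\<lambda>x. v s x + v t x) (v s) - ip (\<lambda>x. v s x + v t x) (v t) + (s - t) * A s\<bar>
          \<le> \<bar>s - t\<bar> * (\<eta> * (\<Sum>j\<in>UNIV. L2_norm (\<lambda>x. V j s x + V j t x)))"
        unfolding A_def
      proof (rule weak_equation_increment[OF m eq])
        show "L2_norm (\<lambda>x. F j \<tau> x - F j t x) \<le> \<eta>" if "\<tau> \<in> {0..T}" "\<bar>\<tau> - t\<bar> \<le> \<bar>s - t\<bar>" for j \<tau>
          using that sd by (intro d') auto
      qed (use L2_curveD(1)[OF v] L2_curveD(1)[OF F] s t Lv LV w in \<open>auto intro: L2_add has_weak_partial_add\<close>)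
      also have "\<dots> \<le> \<bar>s - t\<bar> * (\<eta> * K)" using sum \<eta>(1) by (intro mult_left_mono) auto
      \<comment> \<open>Testing with the sum turns the increment of v into the difference of the
        squared norms.\<close>
      also have "ip (\<lambda>x. v s x + v t x) (v s) - ip (\<lambda>x. v s x + v t x) (v t) = (s - t) * q s"
        using st by (simp add: q_def ip_add_left Lv ip_commute[of "v t" "v s"])
      finally have "\<bar>s - t\<bar> * \<bar>q s + A s\<bar> \<le> \<bar>s - t\<bar> * (\<eta> * K)"
        by (simp add: abs_mult[symmetric] distrib_left)
      then have "\<bar>q s + A s\<bar> \<le> \<eta> * K" using st by simp
      then show ?case using \<eta>(2) by (simp add: dist_real_def)
    qed
  qed
  from tendsto_diff[OF this A]
  show "((\<lambda>s. (ip (v s) (v s) - ip (v t) (v t)) / (s - t)) \<longlongrightarrow> - 2 * (\<Sum>j\<in>UNIV. ip (V j t) (F j t))) ?F"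
    by (simp add: q_def sum.distrib sum_distrib_left sum_negf)
qed

text \<open>The function \<open>G\<close> is nonincreasing, because its derivative is at most a (exp
  (-s) - 1) and s is nonnegative. The mean value theorem on [0,t] copes with the one-sided
  derivatives at the end points. The growth rate 1 is the one produced by the energy below.\<close>

lemma gronwall:
  fixes Q :: "real \<Rightarrow> real"
  assumes Q: "\<And>t. t \<in> {0..T} \<Longrightarrow> (Q has_real_derivative Q' t) (at t within {0..T})"
    and le: "\<And>t. t \<in> {0..T} \<Longrightarrow> Q' t \<le> a + Q t" and a: "a \<ge> 0" and t: "t \<in> {0..T}"
  shows "Q t \<le> exp t * (Q 0 + a * t)"
proof (cases "t = 0")
  case False
  then have t0: "0 < t" using t by simp
  define G where "G s = Q s * exp (- s) - a * s" for s
  have "\<exists>x\<in>{0<..<t}. G t - G 0 = (\<lambda>h. ((Q' x - Q x) * exp (- x) - a) * h) (t - 0)"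
  proof (rule mvt_simple[OF t0])
    fix x assume "0 \<le> x" "x \<le> t"
    then have x: "x \<in> {0..T}" and sub: "{0..t} \<subseteq> {0..T}" using t by auto
    have "(G has_real_derivative ((Q' x - Q x) * exp (- x) - a)) (at x within {0..t})"
      unfolding G_def[abs_def]
      by (auto intro!: derivative_eq_intros DERIV_subset[OF Q[OF x] sub] simp: algebra_simps)
    then show "(G has_derivative (\<lambda>h. ((Q' x - Q x) * exp (- x) - a) * h)) (at x within {0..t})"
      by (simp add: has_field_derivative_def)
  qed
  then obtain x where x: "0 < x" "x < t" and eq: "G t - G 0 = ((Q' x - Q x) * exp (- x) - a) * t" by auto
  have "(Q' x - Q x) * exp (- x) \<le> a * 1"
  proof (rule order_trans)
    show "(Q' x - Q x) * exp (- x) \<le> a * exp (- x)" using le[of x] x t by (intro mult_right_mono) auto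
    show "a * exp (- x) \<le> a * 1" using a x by (intro mult_left_mono) auto
  qed
  then have "((Q' x - Q x) * exp (- x) - a) * t \<le> 0" using t0 by (intro mult_nonpos_nonneg) auto
  then have "Q t * exp (- t) \<le> Q 0 + a * t" using eq by (simp add: G_def)
  then have "exp t * (Q t * exp (- t)) \<le> exp t * (Q 0 + a * t)" by (intro mult_left_mono) auto
  then show ?thesis by (simp add: exp_minus field_simps)
qed simp

section \<open>The energy estimate\<close>

text \<open>\<open>V j\<close> is both the time derivative of \<open>U j\<close> and the weak
  derivative of v, so differentiation in time and in space commute by construction. Carrying the
  gradients as explicit curves fixes one representative at each time.\<close>

definition weak_wave ::
    "real \<Rightarrow> ('n \<Rightarrow> real ^ 'n \<Rightarrow> real) \<Rightarrow> (real \<Rightarrow> real ^ 'n \<Rightarrow> real) \<Rightarrow> (real \<Rightarrow> real ^ 'n \<Rightarrow> real) \<Rightarrow>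
      ('n \<Rightarrow> real \<Rightarrow> real ^ 'n \<Rightarrow> real) \<Rightarrow> ('n \<Rightarrow> real \<Rightarrow> real ^ 'n \<Rightarrow> real) \<Rightarrow> bool" where
  "weak_wave T h u v U V \<longleftrightarrow> L2_C1_curve T u v \<and> (\<forall>j. L2_C1_curve T (U j) (V j)) \<and>
     (\<forall>j. \<forall>t\<in>{0..T}. has_weak_partial j (v t) (V j t)) \<and>
     weak_equation T v (\<lambda>j t x. h j x * U j t x)"

lemma ip_weight_lower:
  assumes p: "L2 p" and k: "k \<in> borel_measurable borel" "AE x in lborel. \<bar>k x\<bar> \<le> M" and c: "AE x in lborel. c \<le> k x"
  shows "c * (L2_norm p)\<^sup>2 \<le> ip p (\<lambda>x. k x * p x)"
proof -
  have "ip p (\<lambda>x. c * p x) \<le> ip p (\<lambda>x. k x * p x)"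
    unfolding ip_def
  proof (rule integral_mono_AE)
    show "integrable lborel (\<lambda>x. p x * (c * p x))" "integrable lborel (\<lambda>x. p x * (k x * p x))"
      by (intro L2_integrable_mult p L2_scale L2_weight(1)[OF p k])+
    show "AE x in lborel. p x * (c * p x) \<le> p x * (k x * p x)"
      using c
    proof eventually_elim
      case (elim x)
      have "c * (p x * p x) \<le> k x * (p x * p x)" by (intro mult_right_mono elim) simp
      then show ?case by (simp add: mult_ac)
    qed
  qed
  then show ?thesis by (simp add: ip_scale_right L2_norm_ip)
qed

text \<open>The term \<open>\<langle>g \<partial>\<^sub>j u, \<partial>\<^sub>j w\<rangle>\<close> in the energy \<open>Q\<close> absorbs the source
  \<open>\<partial>\<^sub>j (g \<partial>\<^sub>j u)\<close> with \<open>g = k - h\<close>, so that only the size of \<open>g\<close>, not of its gradient,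
  enters the estimate.\<close>

lemma energy_estimate:
  fixes h k :: "'n \<Rightarrow> real ^ 'n \<Rightarrow> real"
  assumes m: "mollifier (\<psi> :: real ^ 'n \<Rightarrow> real)"
    and W: "weak_wave T h u v U V" and W': "weak_wave T k u' v' U' V'"
    and h: "\<And>j. h j \<in> borel_measurable borel" "\<And>j. AE x in lborel. \<bar>h j x\<bar> \<le> M"
    and k: "\<And>j. k j \<in> borel_measurable borel" "\<And>j. AE x in lborel. \<bar>k j x - h j x\<bar> \<le> \<delta>"
      "\<And>j. AE x in lborel. c \<le> k j x"
    and B: "\<And>j t. t \<in> {0..T} \<Longrightarrow> L2_norm (U j t) \<le> B" "\<And>j t. t \<in> {0..T} \<Longrightarrow> L2_norm (V j t) \<le> B"
    and nonneg: "0 \<le> \<delta>" "0 \<le> B" and small: "4 * (\<delta> * B) \<le> c" and t: "t \<in> {0..T}"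
  shows "(L2_norm (\<lambda>x. u' t x - u t x))\<^sup>2 \<le> 2 * exp T *
    ((L2_norm (\<lambda>x. v' 0 x - v 0 x))\<^sup>2 / 2
     + (\<Sum>j\<in>UNIV. (M + \<delta>) * (L2_norm (\<lambda>x. U' j 0 x - U j 0 x))\<^sup>2 / 2 + \<delta> * B * L2_norm (\<lambda>x. U' j 0 x - U j 0 x))
     + (L2_norm (\<lambda>x. u' 0 x - u 0 x))\<^sup>2 / 2 + \<delta> * B * real CARD('n) + \<delta> * B * real CARD('n) * T)"
proof -
  define w z where "w = (\<lambda>t x. u' t x - u t x)" and "z = (\<lambda>t x. v' t x - v t x)"
  define p q where "p = (\<lambda>j t x. U' j t x - U j t x)" and "q = (\<lambda>j t x. V' j t x - V j t x)"
  define g where "g = (\<lambda>j x. k j x - h j x)"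
  \<comment> \<open>Flux of the difference, equal to
    \<open>k j x * p j t x + g j x * U j t x\<close>; the second term is the source.\<close>
  define F where "F = (\<lambda>j t x. k j x * U' j t x - h j x * U j t x)"
  \<comment> \<open>\<open>a\<close> collects the constants lost when the terms
    \<open>\<delta> * B * L2_norm (p j t)\<close> are bounded by quadratic ones,
    \<open>\<delta> * B\<close> for each direction.\<close>
  define a where "a = \<delta> * B * real CARD('n)"
  have T: "0 \<in> {0..T}" using t by simp
  have cw: "L2_C1_curve T w z" and cp: "L2_C1_curve T (p j) (q j)" for j
    using W W' unfolding w_def z_def p_def q_def weak_wave_def by (auto intro: L2_C1_curve_diff)
  have cU: "L2_C1_curve T (U j) (V j)" and cU': "L2_C1_curve T (U' j) (V' j)" for j
    using W W' by (auto simp: weak_wave_def)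
  have cv: "L2_curve T v" "L2_curve T v'" using W W' L2_C1_curveD by (auto simp: weak_wave_def)
  have kM: "AE x in lborel. \<bar>k j x\<bar> \<le> M + \<delta>" for j
    using h(2)[of j] k(2)[of j] by eventually_elim linarith
  have gm: "g j \<in> borel_measurable borel" for j unfolding g_def using h k by simp
  have gd: "AE x in lborel. \<bar>g j x\<bar> \<le> \<delta>" for j unfolding g_def by (rule k)
  have cgU: "L2_C1_curve T (\<lambda>t x. g j x * U j t x) (\<lambda>t x. g j x * V j t x)" for j
    by (rule L2_C1_curve_weight[OF cU gm gd])
  have ckp: "L2_C1_curve T (\<lambda>t x. k j x * p j t x) (\<lambda>t x. k j x * q j t x)" for j
    by (rule L2_C1_curve_weight[OF cp k(1) kM])
  have ckU': "L2_curve T (\<lambda>t x. k j x * U' j t x)" for j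
    by (rule L2_curve_weight[OF L2_C1_curveD(1)[OF cU'] k(1) kM])
  have chU: "L2_curve T (\<lambda>t x. h j x * U j t x)" for j
    by (rule L2_curve_weight[OF L2_C1_curveD(1)[OF cU] h])
  have cF: "L2_curve T (F j)" for j unfolding F_def by (rule L2_curve_diff[OF ckU' chU])
  note L = L2_C1_curveD(1,2)[OF cw, THEN L2_curveD(1)] L2_C1_curveD(1,2)[OF cp, THEN L2_curveD(1)]
    L2_C1_curveD(1,2)[OF cgU, THEN L2_curveD(1)] L2_C1_curveD(1,2)[OF ckp, THEN L2_curveD(1)]
    L2_C1_curveD(1,2)[OF cU, THEN L2_curveD(1)]
  have eq: "weak_equation T z F"
    unfolding weak_equation_def
  proof (intro allI impI ballI)
    fix \<phi> :: "real ^ 'n \<Rightarrow> real" and t assume \<phi>: "test_function \<phi>" and t: "t \<in> {0..T}"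
    have "((\<lambda>s. ip \<phi> (v' s) - ip \<phi> (v s)) has_real_derivative
        - (\<Sum>j\<in>UNIV. ip (partial_deriv j \<phi>) (\<lambda>x. k j x * U' j t x))
        - - (\<Sum>j\<in>UNIV. ip (partial_deriv j \<phi>) (\<lambda>x. h j x * U j t x))) (at t within {0..T})"
      using W W' \<phi> t by (intro DERIV_diff) (auto simp: weak_wave_def weak_equation_def)
    moreover have "- (\<Sum>j\<in>UNIV. ip (partial_deriv j \<phi>) (\<lambda>x. k j x * U' j t x))
        - - (\<Sum>j\<in>UNIV. ip (partial_deriv j \<phi>) (\<lambda>x. h j x * U j t x)) = - (\<Sum>j\<in>UNIV. ip (partial_deriv j \<phi>) (F j t))"
    proof -
      have "ip (partial_deriv j \<phi>) (F j t) = ip (partial_deriv j \<phi>) (\<lambda>x. k j x * U' j t x)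
          - ip (partial_deriv j \<phi>) (\<lambda>x. h j x * U j t x)" for j
        unfolding F_def by (intro ip_diff_right L2_test test_function_partial \<phi> L2_curveD(1)[OF ckU' t] L2_curveD(1)[OF chU t])
      then show ?thesis by (simp add: sum_subtractf)
    qed
    ultimately have d: "((\<lambda>s. ip \<phi> (v' s) - ip \<phi> (v s)) has_real_derivative
        - (\<Sum>j\<in>UNIV. ip (partial_deriv j \<phi>) (F j t))) (at t within {0..T})" by simp
    have "ip \<phi> (v' s) - ip \<phi> (v s) = ip \<phi> (z s)" if "s \<in> {0..T}" for s
      unfolding z_def by (intro ip_diff_right[symmetric] L2_test \<phi> L2_curveD(1)[OF cv(1) that] L2_curveD(1)[OF cv(2) that])
    then show "((\<lambda>s. ip \<phi> (z s)) has_real_derivative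
        - (\<Sum>j\<in>UNIV. ip (partial_deriv j \<phi>) (F j t))) (at t within {0..T})"
      by (rule has_field_derivative_transform_within[OF d zero_less_one t])
  qed
  have kin: "((\<lambda>s. ip (z s) (z s)) has_real_derivative - 2 * (\<Sum>j\<in>UNIV. ip (q j t) (F j t))) (at t within {0..T})"
    if t: "t \<in> {0..T}" for t
  proof (rule kinetic_energy_derivative[OF m eq])
    show "has_weak_partial j (z t) (q j t)" if "t \<in> {0..T}" for j t
      unfolding z_def q_def using W W' that by (intro has_weak_partial_diff) (auto simp: weak_wave_def)
  qed (use L2_C1_curveD[OF cw] L2_C1_curveD[OF cp] cF t in auto)
  \<comment> \<open>The half square of \<open>w\<close> lets \<open>Q\<close> control the L2 norm of
    \<open>w\<close> directly; adding \<open>a\<close> keeps \<open>Q\<close> nonnegative despite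
    the indefinite cross term.\<close>
  define Q where "Q t = 1/2 * ip (z t) (z t)
    + (\<Sum>j\<in>UNIV. 1/2 * ip (p j t) (\<lambda>x. k j x * p j t x) + ip (\<lambda>x. g j x * U j t x) (p j t))
    + 1/2 * ip (w t) (w t) + a" for t
  define Q' where "Q' t = (\<Sum>j\<in>UNIV. ip (\<lambda>x. g j x * V j t x) (p j t)) + ip (z t) (w t)" for t
  have dQ: "(Q has_real_derivative Q' t) (at t within {0..T})" if t: "t \<in> {0..T}" for t
  proof -
    have "(Q has_real_derivative 1/2 * (- 2 * (\<Sum>j\<in>UNIV. ip (q j t) (F j t)))
      + (\<Sum>j\<in>UNIV. 1/2 * (ip (q j t) (\<lambda>x. k j x * p j t x) + ip (p j t) (\<lambda>x. k j x * q j t x))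
          + (ip (\<lambda>x. g j x * V j t x) (p j t) + ip (\<lambda>x. g j x * U j t x) (q j t)))
      + 1/2 * (ip (z t) (w t) + ip (w t) (z t)) + 0) (at t within {0..T})"
      unfolding Q_def[abs_def]
      by (intro DERIV_add DERIV_sum DERIV_cmult DERIV_const kin ip_has_derivative[OF cp ckp t]
          ip_has_derivative[OF cgU cp t] ip_has_derivative[OF cw cw t] t)
    \<comment> \<open>All terms containing \<open>q\<close> cancel against the kinetic part:
      symmetry of the weight removes the factor 1/2, and the decomposition of \<open>F\<close>
      matches the rest.\<close>
    moreover have "ip (p j t) (\<lambda>x. k j x * q j t x) = ip (q j t) (\<lambda>x. k j x * p j t x)" for j
      by (simp add: ip_def mult_ac)
    moreover have "ip (q j t) (F j t) = ip (q j t) (\<lambda>x. k j x * p j t x) + ip (\<lambda>x. g j x * U j t x) (q j t)" for j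
    proof -
      have "F j t = (\<lambda>x. k j x * p j t x + g j x * U j t x)"
        by (rule ext) (simp add: F_def p_def g_def algebra_simps)
      then show ?thesis using ip_add_right[of "\<lambda>x. k j x * p j t x" "\<lambda>x. g j x * U j t x" "q j t"] L t
        by (simp add: ip_commute[of "q j t" "\<lambda>x. g j x * U j t x"])
    qed
    ultimately show ?thesis
      by (simp add: Q'_def ip_commute[of "w t" "z t"] sum.distrib sum_distrib_left[symmetric] algebra_simps)
  qed
  \<comment> \<open>A form of Young's inequality that makes linear terms quadratic up to a
    constant.\<close>
  have lin: "L2_norm f \<le> 1 + (L2_norm f)\<^sup>2" for f :: "real^'n \<Rightarrow> real"
  proof -
    have "0 \<le> (L2_norm f - 1)\<^sup>2" by simp
    then have "2 * L2_norm f \<le> 1 + (L2_norm f)\<^sup>2" by (simp add: power2_diff)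
    then show ?thesis using L2_norm_ge0[of f] by linarith
  qed
  have gb: "\<bar>ip (\<lambda>x. g j x * f x) (p j t)\<bar> \<le> \<delta> * B * L2_norm (p j t)"
    if t: "t \<in> {0..T}" and f: "L2 f" "L2_norm f \<le> B" for j t f
  proof -
    have Lp: "L2 (p j t)" by (rule L2_curveD(1)[OF L2_C1_curveD(1)[OF cp] t])
    have "L2_norm (\<lambda>x. g j x * f x) \<le> \<delta> * L2_norm f" by (rule L2_weight(2)[OF f(1) gm gd])
    moreover have "\<delta> * L2_norm f \<le> \<delta> * B" by (intro mult_left_mono f nonneg)
    ultimately have "L2_norm (\<lambda>x. g j x * f x) * L2_norm (p j t) \<le> \<delta> * B * L2_norm (p j t)"
      by (intro mult_right_mono) auto
    then show ?thesis using ip_bound[OF L2_weight(1)[OF f(1) gm gd] Lp] by (rule order_trans[rotated])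
  qed
  have gb2: "\<delta> * B * L2_norm f \<le> \<delta> * B + \<delta> * B * (L2_norm f)\<^sup>2" for f :: "real^'n \<Rightarrow> real"
    using mult_left_mono[OF lin[of f], of "\<delta> * B"] nonneg by (simp add: distrib_left)
  have lower: "1/2 * (L2_norm (z t))\<^sup>2 + 1/2 * (L2_norm (w t))\<^sup>2 + (\<Sum>j\<in>UNIV. \<delta> * B * (L2_norm (p j t))\<^sup>2) \<le> Q t"
    if t: "t \<in> {0..T}" for t
  proof -
    have "\<delta> * B * (L2_norm (p j t))\<^sup>2 - \<delta> * B \<le> 1/2 * ip (p j t) (\<lambda>x. k j x * p j t x) + ip (\<lambda>x. g j x * U j t x) (p j t)" for j
    proof -
      have "c * (L2_norm (p j t))\<^sup>2 \<le> ip (p j t) (\<lambda>x. k j x * p j t x)"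
        by (rule ip_weight_lower[OF _ k(1) kM k(3)]) (use L t in auto)
      moreover have "\<bar>ip (\<lambda>x. g j x * U j t x) (p j t)\<bar> \<le> \<delta> * B * L2_norm (p j t)"
        by (intro gb t L B)
      \<comment> \<open>Half of this gives two units of \<open>\<delta> * B\<close>: one pays for
        the cross term through \<open>gb2\<close>, the other remains in the lower bound and is what
        the bound of \<open>Q'\<close> consumes. This is the origin of the 4.\<close>
      moreover have "4 * (\<delta> * B) * (L2_norm (p j t))\<^sup>2 \<le> c * (L2_norm (p j t))\<^sup>2"
        by (intro mult_right_mono small) simp
      ultimately show ?thesis using gb2[of "p j t"] by linarith
    qed
    then have "(\<Sum>j\<in>(UNIV::'n set). \<delta> * B * (L2_norm (p j t))\<^sup>2 - \<delta> * B)
      \<le> (\<Sum>j\<in>UNIV. 1/2 * ip (p j t) (\<lambda>x. k j x * p j t x) + ip (\<lambda>x. g j x * U j t x) (p j t))"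
      by (intro sum_mono)
    then show ?thesis unfolding Q_def L2_norm_ip a_def by (simp add: sum_subtractf mult_ac)
  qed
  have upper: "Q' t \<le> a + Q t" if t: "t \<in> {0..T}" for t
  proof -
    have "ip (\<lambda>x. g j x * V j t x) (p j t) \<le> \<delta> * B + \<delta> * B * (L2_norm (p j t))\<^sup>2" for j
    proof -
      have "\<bar>ip (\<lambda>x. g j x * V j t x) (p j t)\<bar> \<le> \<delta> * B * L2_norm (p j t)"
        by (intro gb t L B)
      then show ?thesis using gb2[of "p j t"] by linarith
    qed
    then have "(\<Sum>j\<in>UNIV. ip (\<lambda>x. g j x * V j t x) (p j t)) \<le> (\<Sum>j\<in>(UNIV::'n set). \<delta> * B + \<delta> * B * (L2_norm (p j t))\<^sup>2)"
      by (intro sum_mono)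
    then have "(\<Sum>j\<in>UNIV. ip (\<lambda>x. g j x * V j t x) (p j t)) \<le> a + (\<Sum>j\<in>(UNIV::'n set). \<delta> * B * (L2_norm (p j t))\<^sup>2)"
      by (simp add: sum.distrib a_def mult_ac)
    moreover have "ip (z t) (w t) \<le> 1/2 * (L2_norm (z t))\<^sup>2 + 1/2 * (L2_norm (w t))\<^sup>2"
    proof -
      have "0 \<le> (L2_norm (z t) - L2_norm (w t))\<^sup>2" by simp
      then have "2 * (L2_norm (z t) * L2_norm (w t)) \<le> (L2_norm (z t))\<^sup>2 + (L2_norm (w t))\<^sup>2"
        by (simp add: power2_diff)
      moreover have "\<bar>ip (z t) (w t)\<bar> \<le> L2_norm (z t) * L2_norm (w t)" by (intro ip_bound L t)
      ultimately show ?thesis by linarith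
    qed
    ultimately show ?thesis using lower[OF t] unfolding Q'_def by linarith
  qed
  have a0: "a \<ge> 0" using nonneg by (simp add: a_def)
  have Qt: "Q t \<le> exp t * (Q 0 + a * t)" by (rule gronwall[OF dQ upper a0 t])
  have sum0: "0 \<le> (\<Sum>j\<in>UNIV. \<delta> * B * (L2_norm (p j t))\<^sup>2)" for t
    using nonneg by (intro sum_nonneg) simp
  have sq: "0 \<le> (L2_norm (z t))\<^sup>2" "0 \<le> (L2_norm (w t))\<^sup>2" for t by simp_all
  \<comment> \<open>The sign matters when \<open>exp t\<close> is replaced by
    \<open>exp T\<close>.\<close>
  have Q0: "0 \<le> Q 0" using lower[OF T] sum0[of 0] sq[of 0] by linarith
  have "exp t * (Q 0 + a * t) \<le> exp T * (Q 0 + a * T)"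
  proof (rule mult_mono)
    show "Q 0 + a * t \<le> Q 0 + a * T" using mult_left_mono[of t T a] t a0 by simp
    show "0 \<le> Q 0 + a * t" using Q0 a0 t by simp
  qed (use t in auto)
  then have QT: "Q t \<le> exp T * (Q 0 + a * T)" using Qt by linarith
  have Q0X: "Q 0 \<le> (L2_norm (z 0))\<^sup>2 / 2
     + (\<Sum>j\<in>UNIV. (M + \<delta>) * (L2_norm (p j 0))\<^sup>2 / 2 + \<delta> * B * L2_norm (p j 0))
     + (L2_norm (w 0))\<^sup>2 / 2 + a"
  proof -
    have "1/2 * ip (p j 0) (\<lambda>x. k j x * p j 0 x) + ip (\<lambda>x. g j x * U j 0 x) (p j 0)
        \<le> (M + \<delta>) * (L2_norm (p j 0))\<^sup>2 / 2 + \<delta> * B * L2_norm (p j 0)" for j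
    proof -
      have "\<bar>ip (p j 0) (\<lambda>x. k j x * p j 0 x)\<bar> \<le> L2_norm (p j 0) * L2_norm (\<lambda>x. k j x * p j 0 x)"
        by (intro ip_bound L T)
      also have "\<dots> \<le> L2_norm (p j 0) * ((M + \<delta>) * L2_norm (p j 0))"
        by (intro mult_left_mono L2_weight(2)[OF _ k(1) kM] L T) simp
      finally have "ip (p j 0) (\<lambda>x. k j x * p j 0 x) \<le> (M + \<delta>) * (L2_norm (p j 0))\<^sup>2"
        by (simp add: power2_eq_square mult_ac)
      moreover have "\<bar>ip (\<lambda>x. g j x * U j 0 x) (p j 0)\<bar> \<le> \<delta> * B * L2_norm (p j 0)"
        by (intro gb T L B)
      ultimately show ?thesis by linarith
    qed
    then have "(\<Sum>j\<in>UNIV. 1/2 * ip (p j 0) (\<lambda>x. k j x * p j 0 x) + ip (\<lambda>x. g j x * U j 0 x) (p j 0))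
        \<le> (\<Sum>j\<in>UNIV. (M + \<delta>) * (L2_norm (p j 0))\<^sup>2 / 2 + \<delta> * B * L2_norm (p j 0))"
      by (intro sum_mono)
    then show ?thesis unfolding Q_def L2_norm_ip by simp
  qed
  have "Q t \<le> exp T * ((L2_norm (z 0))\<^sup>2 / 2
     + (\<Sum>j\<in>UNIV. (M + \<delta>) * (L2_norm (p j 0))\<^sup>2 / 2 + \<delta> * B * L2_norm (p j 0))
     + (L2_norm (w 0))\<^sup>2 / 2 + a + a * T)"
    by (rule order_trans[OF QT mult_left_mono]) (use Q0X in auto)
  moreover have "(L2_norm (w t))\<^sup>2 \<le> 2 * Q t" using lower[OF t] sum0[of t] sq[of t] by linarith
  ultimately have "(L2_norm (w t))\<^sup>2 \<le> 2 * (exp T * ((L2_norm (z 0))\<^sup>2 / 2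
     + (\<Sum>j\<in>UNIV. (M + \<delta>) * (L2_norm (p j 0))\<^sup>2 / 2 + \<delta> * B * L2_norm (p j 0))
     + (L2_norm (w 0))\<^sup>2 / 2 + a + a * T))" by linarith
  then show ?thesis by (simp only: w_def z_def p_def a_def mult.assoc)
qed

section \<open>Components of vector-valued solutions\<close>

lemma H1D:
  assumes "H1 f"
  shows "has_weak_partial j f (weak_partial j f)" "L2 f" "L2 (weak_partial j f)"
  using assms has_weak_partial_weak_partial unfolding H1_def weakly_differentiable_def by blast+

lemma L2_norm_le_H1_norm: "L2_norm f \<le> H1_norm f" "L2_norm (weak_partial j f) \<le> H1_norm f"
proof -
  have "(L2_norm (weak_partial j f))\<^sup>2 \<le> (\<Sum>j\<in>UNIV. (L2_norm (weak_partial j f))\<^sup>2)"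
    by (rule member_le_sum) auto
  moreover have "0 \<le> (L2_norm f)\<^sup>2" "0 \<le> (\<Sum>j\<in>UNIV. (L2_norm (weak_partial j f))\<^sup>2)"
    by (simp_all add: sum_nonneg)
  ultimately show "L2_norm f \<le> H1_norm f" "L2_norm (weak_partial j f) \<le> H1_norm f"
    unfolding H1_norm_def by (intro real_le_rsqrt; linarith)+
qed

lemma L2_norm_cong_AE:
  assumes "f \<in> borel_measurable borel" "g \<in> borel_measurable borel" "AE x in lborel. f x = g x"
  shows "L2_norm f = L2_norm g"
  unfolding L2_norm_def using assms by (intro arg_cong[of _ _ sqrt] integral_cong_AE) auto

text \<open>\<open>H1_norm\<close> is built from the representative chosen by
  \<open>weak_partial\<close>; uniqueness almost everywhere lets it bound any other representative
  g.\<close>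

lemma L2_norm_weak_partial_component_le:
  fixes f g :: "real ^ 'n \<Rightarrow> 'b::euclidean_space"
  assumes m: "mollifier (\<psi> :: real ^ 'n \<Rightarrow> real)" and w: "has_weak_partial j f g" and g: "L2 g" and b: "b \<in> Basis"
  shows "L2_norm (\<lambda>x. g x \<bullet> b) \<le> H1_norm f"
proof -
  have w': "has_weak_partial j f (weak_partial j f)" by (rule has_weak_partial_weak_partial[OF w])
  have "L2_norm (\<lambda>x. g x \<bullet> b) \<le> L2_norm g" by (rule L2_component(2)[OF g b])
  also have "L2_norm g = L2_norm (weak_partial j f)"
    using w w' has_weak_partial_unique[OF m w w']
    by (intro L2_norm_cong_AE) (auto simp: has_weak_partial_def locally_integrable_def)
  also have "\<dots> \<le> H1_norm f" by (rule L2_norm_le_H1_norm)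
  finally show ?thesis .
qed

text \<open>\<open>weak_partial\<close> is a choice, hence not linear as an operation on functions:
  the chosen derivative of a difference need not be the difference of the chosen ones. The relation
  \<open>R\<close> is linear instead, and \<open>N\<close> dominates the L2 norm of a component of
  anything related. It is instantiated with equality for values and with
  \<open>has_weak_partial\<close> for gradients.\<close>

lemma C1_curve_component:
  fixes u v D E :: "real \<Rightarrow> real ^ 'n \<Rightarrow> 'b::euclidean_space"
  assumes u: "C1_curve X N T u v"
    and rel: "\<And>t. t \<in> {0..T} \<Longrightarrow> R (u t) (D t)" "\<And>t. t \<in> {0..T} \<Longrightarrow> R (v t) (E t)"
    and diff: "\<And>f g f' g'. R f g \<Longrightarrow> R f' g' \<Longrightarrow> R (\<lambda>x. f x - f' x) (\<lambda>x. g x - g' x)"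
    and scale: "\<And>f g c. R f g \<Longrightarrow> R (\<lambda>x. c *\<^sub>R f x) (\<lambda>x. c *\<^sub>R g x)"
    and L2: "\<And>f g. R f g \<Longrightarrow> L2 (\<lambda>x. g x \<bullet> b)"
    and le: "\<And>f g. R f g \<Longrightarrow> L2_norm (\<lambda>x. g x \<bullet> b) \<le> N f"
  shows "L2_C1_curve T (\<lambda>t x. D t x \<bullet> b) (\<lambda>t x. E t x \<bullet> b)"
  unfolding C1_curve_def has_curve_deriv_real
proof (intro conjI ballI)
  have c: "C_curve X N T u" "C_curve X N T v" "has_curve_deriv N T u v" using u by (auto simp: C1_curve_def)
  have curve: "L2_curve T (\<lambda>t x. F t x \<bullet> b)"
    if w: "C_curve X N T w" and F: "\<And>t. t \<in> {0..T} \<Longrightarrow> R (w t) (F t)" for w F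
    unfolding C_curve_def
  proof (intro ballI conjI)
    fix t assume t: "t \<in> {0..T}"
    show "L2 (\<lambda>x. F t x \<bullet> b)" by (rule L2[OF F[OF t]])
    have lim: "((\<lambda>s. N (\<lambda>x. w s x - w t x)) \<longlongrightarrow> 0) (at t within {0..T})"
      using w t by (simp add: C_curve_def)
    have "L2_norm (\<lambda>x. F s x \<bullet> b - F t x \<bullet> b) \<le> N (\<lambda>x. w s x - w t x)" if "s \<in> {0..T}" for s
      using le[OF diff[OF F[OF that] F[OF t]]] by (simp add: inner_diff_left)
    then show "((\<lambda>s. L2_norm (\<lambda>x. F s x \<bullet> b - F t x \<bullet> b)) \<longlongrightarrow> 0) (at t within {0..T})"
      by (intro Lim_null_comparison[OF _ lim]) (auto simp: eventually_at_filter)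
  qed
  show "L2_curve T (\<lambda>t x. D t x \<bullet> b)" by (rule curve[OF c(1) rel(1)])
  show "L2_curve T (\<lambda>t x. E t x \<bullet> b)" by (rule curve[OF c(2) rel(2)])
  fix t assume t: "t \<in> {0..T}"
  have lim: "((\<lambda>s. N (\<lambda>x. (u s x - u t x) /\<^sub>R (s - t) - v t x)) \<longlongrightarrow> 0) (at t within {0..T})"
    using c(3) t by (simp add: has_curve_deriv_def)
  have "L2_norm (\<lambda>x. (D s x \<bullet> b - D t x \<bullet> b) * inverse (s - t) - E t x \<bullet> b)
      \<le> N (\<lambda>x. (u s x - u t x) /\<^sub>R (s - t) - v t x)" if "s \<in> {0..T}" for s
    using le[OF diff[OF scale[OF diff[OF rel(1)[OF that] rel(1)[OF t]], of "inverse (s - t)"] rel(2)[OF t]]]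
    by (simp add: inner_diff_left mult.commute)
  then show "((\<lambda>s. L2_norm (\<lambda>x. (D s x \<bullet> b - D t x \<bullet> b) * inverse (s - t) - E t x \<bullet> b)) \<longlongrightarrow> 0)
      (at t within {0..T})"
    by (intro Lim_null_comparison[OF _ lim]) (auto simp: eventually_at_filter)
qed

lemma C1_curve_L2_component:
  fixes u v :: "real \<Rightarrow> real ^ 'n \<Rightarrow> 'b::euclidean_space"
  assumes u: "C1_curve L2 L2_norm T u v" and b: "b \<in> Basis"
  shows "L2_C1_curve T (\<lambda>t x. u t x \<bullet> b) (\<lambda>t x. v t x \<bullet> b)"
  by (rule C1_curve_component[OF u, where R = "\<lambda>f g. f = g \<and> L2 g"])
    (use u b in \<open>auto simp: C1_curve_def C_curve_def L2_component L2_euclidean_diff L2_euclidean_scaleR\<close>)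

lemma C1_curve_H1_component:
  fixes u v :: "real \<Rightarrow> real ^ 'n \<Rightarrow> 'b::euclidean_space"
  assumes m: "mollifier (\<psi> :: real ^ 'n \<Rightarrow> real)" and u: "C1_curve H1 H1_norm T u v" and b: "b \<in> Basis"
  shows "L2_C1_curve T (\<lambda>t x. u t x \<bullet> b) (\<lambda>t x. v t x \<bullet> b)"
    and "L2_C1_curve T (\<lambda>t x. weak_partial j (u t) x \<bullet> b) (\<lambda>t x. weak_partial j (v t) x \<bullet> b)"
proof -
  have H: "H1 (u t)" "H1 (v t)" if "t \<in> {0..T}" for t using u that by (auto simp: C1_curve_def C_curve_def)
  show "L2_C1_curve T (\<lambda>t x. u t x \<bullet> b) (\<lambda>t x. v t x \<bullet> b)"
    by (rule C1_curve_component[OF u, where R = "\<lambda>f g. f = g \<and> L2 g"])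
      (use H b in \<open>auto simp: H1D L2_component L2_euclidean_diff L2_euclidean_scaleR
        intro: order_trans[OF L2_component(2) L2_norm_le_H1_norm(1)]\<close>)
  show "L2_C1_curve T (\<lambda>t x. weak_partial j (u t) x \<bullet> b) (\<lambda>t x. weak_partial j (v t) x \<bullet> b)"
    by (rule C1_curve_component[OF u, where R = "\<lambda>f g. has_weak_partial j f g \<and> L2 g"])
      (use H b in \<open>auto simp: H1D L2_component L2_euclidean_diff L2_euclidean_scaleR has_weak_partial_diff
        has_weak_partial_scaleR intro: L2_norm_weak_partial_component_le[OF m]\<close>)
qed

lemma L2_norm_eq_0_AE:
  fixes f :: "real ^ 'n \<Rightarrow> real"
  assumes f: "L2 f" and z: "L2_norm f = 0"
  shows "AE x in lborel. f x = 0"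
proof -
  have "(LINT x|lborel. (f x)\<^sup>2) = 0" using z by (simp flip: L2_norm_real)
  moreover have "integrable lborel (\<lambda>x. (f x)\<^sup>2)" using f by (simp add: L2_real_iff)
  ultimately have "AE x in lborel. (f x)\<^sup>2 = 0"
    by (subst (asm) integral_nonneg_eq_0_iff_AE) auto
  then show ?thesis by eventually_elim simp
qed

text \<open>The regularity class and the equation each provide a time derivative existentially; this
  identifies the two. Positive T makes t a limit point of the interval, so the limit of the
  difference quotients is unique.\<close>

lemma L2_C1_curve_deriv_unique:
  assumes v: "L2_C1_curve T u v" and v': "L2_C1_curve T u v'" and T: "T > 0" and t: "t \<in> {0..T}"
  shows "AE x in lborel. v t x = v' t x"
proof -
  let ?F = "at t within {0..T}"
  note c = L2_C1_curveD(1,2)[OF v] L2_C1_curveD(2)[OF v']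
  note L = c[THEN L2_curveD(1), OF t]
  define a where "a s x = (u s x - u t x) * inverse (s - t)" for s x
  have la: "((\<lambda>s. L2_norm (\<lambda>x. a s x - v t x)) \<longlongrightarrow> 0) ?F" "((\<lambda>s. L2_norm (\<lambda>x. a s x - v' t x)) \<longlongrightarrow> 0) ?F"
    unfolding a_def by (rule L2_C1_curveD(3)[OF v t], rule L2_C1_curveD(3)[OF v' t])
  have "\<forall>\<^sub>F s in ?F. L2_norm (\<lambda>x. v t x - v' t x) \<le> L2_norm (\<lambda>x. a s x - v' t x) + L2_norm (\<lambda>x. a s x - v t x)"
    using L2_curveD(3)[OF c(1) t]
  proof eventually_elim
    case (elim s)
    have a: "L2 (a s)"
      unfolding a_def[abs_def] mult.commute[of _ "inverse (s - t)"] using elim L by (auto intro!: L2_diff L2_scale)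
    show ?case using L2_norm_triangle_diff[OF L2_diff[OF a L(3)] L2_diff[OF a L(2)]] by simp
  qed
  moreover have "?F \<noteq> bot" using T t by (simp add: trivial_limit_within islimpt_Icc)
  ultimately have "L2_norm (\<lambda>x. v t x - v' t x) \<le> 0"
    using tendsto_lowerbound[OF tendsto_add_zero[OF la(2,1)]] by blast
  then have "L2_norm (\<lambda>x. v t x - v' t x) = 0" using L2_norm_ge0 by (rule order_antisym)
  from L2_norm_eq_0_AE[OF L2_diff[OF L(2,3)] this] show ?thesis by eventually_elim simp
qed

text \<open>The derivative \<open>v\<close> in H1 has a weak gradient, while the equation is stated
  for the derivative \<open>v'\<close> in L2; their components agree almost everywhere, so the
  equation is moved to \<open>v\<close>. Pairing with the basis vector b commutes with integrals and
  derivatives and leaves a real-valued problem.\<close>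

lemma weak_wave_component:
  fixes u :: "real \<Rightarrow> real ^ 'n \<Rightarrow> 'b::euclidean_space"
  assumes m: "mollifier (\<psi> :: real ^ 'n \<Rightarrow> real)" and b: "b \<in> Basis" and T: "T > 0"
    and reg: "C_H2_C1_H1 T u" and sol: "solves_wave_eq T h f g u"
    and h: "\<And>j. h j \<in> borel_measurable borel" "\<And>j. AE x in lborel. \<bar>h j x\<bar> \<le> M"
  obtains v V where
    "weak_wave T h (\<lambda>t x. u t x \<bullet> b) v (\<lambda>j t x. weak_partial j (u t) x \<bullet> b) V"
    "AE x in lborel. u 0 x = f x" "AE x in lborel. v 0 x = g x \<bullet> b" "H1 (u 0)"
proof -
  obtain v where v: "C1_curve H1 H1_norm T u v" using reg by (auto simp: C_H2_C1_H1_def)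
  obtain v' where v': "C1_curve L2 L2_norm T u v'" and f: "AE x in lborel. u 0 x = f x"
    and g: "AE x in lborel. v' 0 x = g x"
    and eq: "\<And>\<phi> t. test_function \<phi> \<Longrightarrow> t \<in> {0..T} \<Longrightarrow>
      ((\<lambda>s. LINT x|lborel. \<phi> x *\<^sub>R v' s x) has_vector_derivative
        - (\<Sum>j\<in>UNIV. LINT x|lborel. partial_deriv j \<phi> x *\<^sub>R (h j x *\<^sub>R weak_partial j (u t) x)))
          (at t within {0..T})"
    using sol unfolding solves_wave_eq_def by blast
  have H: "H1 (u t)" "H1 (v t)" if "t \<in> {0..T}" for t using v that by (auto simp: C1_curve_def C_curve_def)
  have Lv': "L2 (v' t)" if "t \<in> {0..T}" for t using v' that by (auto simp: C1_curve_def C_curve_def)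
  have c: "L2_C1_curve T (\<lambda>t x. u t x \<bullet> b) (\<lambda>t x. v t x \<bullet> b)" by (rule C1_curve_H1_component(1)[OF m v b])
  have c': "L2_C1_curve T (\<lambda>t x. u t x \<bullet> b) (\<lambda>t x. v' t x \<bullet> b)" by (rule C1_curve_L2_component[OF v' b])
  have vv': "AE x in lborel. v t x \<bullet> b = v' t x \<bullet> b" if "t \<in> {0..T}" for t
    by (rule L2_C1_curve_deriv_unique[OF c c' T that])
  have "weak_wave T h (\<lambda>t x. u t x \<bullet> b) (\<lambda>t x. v t x \<bullet> b)
      (\<lambda>j t x. weak_partial j (u t) x \<bullet> b) (\<lambda>j t x. weak_partial j (v t) x \<bullet> b)"
    unfolding weak_wave_def weak_equation_def
  proof (intro conjI allI ballI impI)
    show "L2_C1_curve T (\<lambda>t x. u t x \<bullet> b) (\<lambda>t x. v t x \<bullet> b)" by (rule c)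
    show "L2_C1_curve T (\<lambda>t x. weak_partial j (u t) x \<bullet> b) (\<lambda>t x. weak_partial j (v t) x \<bullet> b)" for j
      by (rule C1_curve_H1_component(2)[OF m v b])
    show "has_weak_partial j (\<lambda>x. v t x \<bullet> b) (\<lambda>x. weak_partial j (v t) x \<bullet> b)" if "t \<in> {0..T}" for j t
      by (rule has_weak_partial_inner[OF H1D(1)[OF H(2)[OF that]]])
  next
    fix \<phi> :: "real ^ 'n \<Rightarrow> real" and t assume p: "test_function \<phi>" and t: "t \<in> {0..T}"
    have ipv: "(LINT x|lborel. \<phi> x *\<^sub>R v' s x) \<bullet> b = ip \<phi> (\<lambda>x. v s x \<bullet> b)" if s: "s \<in> {0..T}" for s
    proof -
      have i: "integrable lborel (\<lambda>x. \<phi> x *\<^sub>R v' s x)"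
        by (rule integrable_test_scaleR[OF L2_euclidean_locally_integrable[OF Lv'[OF s]] p])
      have mv: "(\<lambda>x. v s x \<bullet> b) \<in> borel_measurable borel" "(\<lambda>x. v' s x \<bullet> b) \<in> borel_measurable borel"
        using L2_component(1)[OF H1D(2)[OF H(2)[OF s]] b] L2_component(1)[OF Lv'[OF s] b]
        by (auto simp: L2_real_iff)
      have "(LINT x|lborel. \<phi> x *\<^sub>R v' s x) \<bullet> b = (LINT x|lborel. (\<phi> x *\<^sub>R v' s x) \<bullet> b)"
        by (rule integral_inner_left[OF i, symmetric])
      also have "\<dots> = (LINT x|lborel. \<phi> x * (v s x \<bullet> b))"
      proof (rule integral_cong_AE)
        show "AE x in lborel. (\<phi> x *\<^sub>R v' s x) \<bullet> b = \<phi> x * (v s x \<bullet> b)"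
          using vv'[OF s] by eventually_elim simp
      qed (use test_function_measurable[OF p] mv in auto)
      finally show ?thesis by (simp add: ip_def)
    qed
    have ipU: "(LINT x|lborel. partial_deriv j \<phi> x *\<^sub>R (h j x *\<^sub>R weak_partial j (u t) x)) \<bullet> b
        = ip (partial_deriv j \<phi>) (\<lambda>x. h j x * (weak_partial j (u t) x \<bullet> b))" for j
    proof -
      have lU: "locally_integrable (weak_partial j (u t))"
        by (rule L2_euclidean_locally_integrable[OF H1D(3)[OF H(1)[OF t]]])
      note [measurable] = test_function_measurable[OF test_function_partial[OF p, of j]] h(1)[of j]
        locally_integrable_measurable[OF lU]
      have i: "integrable lborel (\<lambda>x. M *\<^sub>R (partial_deriv j \<phi> x *\<^sub>R weak_partial j (u t) x))"
        by (intro integrable_scaleR_right integrable_test_scaleR lU test_function_partial p)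
      have "integrable lborel (\<lambda>x. partial_deriv j \<phi> x *\<^sub>R (h j x *\<^sub>R weak_partial j (u t) x))"
      proof (rule Bochner_Integration.integrable_bound[OF i])
        show "AE x in lborel. norm (partial_deriv j \<phi> x *\<^sub>R (h j x *\<^sub>R weak_partial j (u t) x))
            \<le> norm (M *\<^sub>R (partial_deriv j \<phi> x *\<^sub>R weak_partial j (u t) x))"
          using h(2)[of j]
        proof eventually_elim
          case (elim x)
          then have "\<bar>h j x\<bar> * (\<bar>partial_deriv j \<phi> x\<bar> * norm (weak_partial j (u t) x))
              \<le> \<bar>M\<bar> * (\<bar>partial_deriv j \<phi> x\<bar> * norm (weak_partial j (u t) x))"
            by (intro mult_right_mono) auto
          then show ?case by (simp add: abs_mult mult_ac)
        qed
      qed measurable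
      from integral_inner_left[OF this, of b] show ?thesis by (simp add: ip_def mult.assoc)
    qed
    have "((\<lambda>s. (LINT x|lborel. \<phi> x *\<^sub>R v' s x) \<bullet> b) has_vector_derivative
        (- (\<Sum>j\<in>UNIV. LINT x|lborel. partial_deriv j \<phi> x *\<^sub>R (h j x *\<^sub>R weak_partial j (u t) x))) \<bullet> b)
          (at t within {0..T})"
      by (rule bounded_linear.has_vector_derivative[OF bounded_linear_inner_left eq[OF p t]])
    then have d: "((\<lambda>s. (LINT x|lborel. \<phi> x *\<^sub>R v' s x) \<bullet> b) has_real_derivative
        - (\<Sum>j\<in>UNIV. ip (partial_deriv j \<phi>) (\<lambda>x. h j x * (weak_partial j (u t) x \<bullet> b)))) (at t within {0..T})"
      unfolding has_real_derivative_iff_has_vector_derivative inner_minus_left inner_sum_left ipU .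
    show "((\<lambda>s. ip \<phi> (\<lambda>x. v s x \<bullet> b)) has_real_derivative
        - (\<Sum>j\<in>UNIV. ip (partial_deriv j \<phi>) (\<lambda>x. h j x * (weak_partial j (u t) x \<bullet> b)))) (at t within {0..T})"
      by (rule has_field_derivative_transform_within[OF d zero_less_one t]) (rule ipv)
  qed
  moreover have "AE x in lborel. v 0 x \<bullet> b = g x \<bullet> b"
    using vv'[of 0] g T by (auto elim: eventually_elim2)
  moreover have "H1 (u 0)" using H(1)[of 0] T by simp
  ultimately show ?thesis using f that by blast
qed

section \<open>Initial data and convergence of a single component\<close>

lemma has_weak_partial_cong_AE:
  fixes f f' :: "real ^ 'n \<Rightarrow> real"
  assumes w: "has_weak_partial j f g" and f': "locally_integrable f'" and ae: "AE x in lborel. f x = f' x"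
  shows "has_weak_partial j f' g"
  unfolding has_weak_partial_def
proof (intro conjI allI impI f')
  show "locally_integrable g" using w by (simp add: has_weak_partial_def)
  fix \<phi> :: "real ^ 'n \<Rightarrow> real" assume p: "test_function \<phi>"
  have "(LINT x|lborel. partial_deriv j \<phi> x *\<^sub>R f' x) = (LINT x|lborel. partial_deriv j \<phi> x *\<^sub>R f x)"
  proof (rule integral_cong_AE)
    show "AE x in lborel. partial_deriv j \<phi> x *\<^sub>R f' x = partial_deriv j \<phi> x *\<^sub>R f x"
      using ae by eventually_elim simp
  qed (use test_function_measurable[OF test_function_partial[OF p, of j]] locally_integrable_measurable[OF f'] w in
      \<open>auto simp: has_weak_partial_def dest: locally_integrable_measurable\<close>)
  then show "(LINT x|lborel. partial_deriv j \<phi> x *\<^sub>R f' x) = - (LINT x|lborel. \<phi> x *\<^sub>R g x)"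
    using w p by (simp add: has_weak_partial_def)
qed

lemma convol_component:
  fixes f :: "real ^ 'n \<Rightarrow> 'b::euclidean_space"
  assumes f: "locally_integrable f" and p: "test_function p"
  shows "convol f p x \<bullet> b = convol (\<lambda>x. f x \<bullet> b) p x"
  unfolding convol_def by (subst integral_inner_left[OF integrable_convol[OF f p], symmetric]) simp

lemma L2_curve_bounded:
  assumes u: "L2_curve T u"
  obtains B where "\<And>t. t \<in> {0..T} \<Longrightarrow> L2_norm (u t) \<le> B"
proof -
  have "continuous_on {0..T} (\<lambda>t. L2_norm (u t))"
    unfolding continuous_on_def
    by (intro ballI L2_norm_tendsto L2_curveD[OF u])
  then have "bounded ((\<lambda>t. L2_norm (u t)) ` {0..T})"
    by (intro compact_imp_bounded compact_continuous_image) auto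
  then obtain B where "\<forall>t\<in>{0..T}. L2_norm (u t) \<le> B"
    unfolding bounded_iff by auto
  then show ?thesis using that by blast
qed

text \<open>The initial conditions hold only almost everywhere, so neither gradient at time 0 is
  known literally. Uniqueness of weak derivatives identifies them with the gradient of
  \<open>u0\<close> and with its mollification.\<close>

lemma initial_gradient_error:
  fixes u0 u u' :: "real ^ 'n \<Rightarrow> 'b::euclidean_space"
  assumes m: "mollifier (\<psi> :: real ^ 'n \<Rightarrow> real)" and b: "b \<in> Basis" and u0: "H1 u0" and u: "H1 u" and u': "H1 u'"
    and ae: "AE x in lborel. u x = u0 x" and ae': "AE x in lborel. u' x = convol u0 \<psi> x"
  shows "L2_norm (\<lambda>x. weak_partial j u' x \<bullet> b - weak_partial j u x \<bullet> b)
    = L2_norm (\<lambda>x. convol (\<lambda>x. weak_partial j u0 x \<bullet> b) \<psi> x - weak_partial j u0 x \<bullet> b)"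
proof -
  have t: "test_function \<psi>" using m by (simp add: mollifier_def)
  let ?f = "\<lambda>x. u0 x \<bullet> b" and ?g = "\<lambda>x. weak_partial j u0 x \<bullet> b"
  have w0: "has_weak_partial j ?f ?g" by (rule has_weak_partial_inner[OF H1D(1)[OF u0]])
  have L: "L2 ?f" "L2 ?g" using H1D[OF u0] b by (auto intro: L2_component)
  have wc: "has_weak_partial j (convol ?f \<psi>) (convol ?g \<psi>)" by (rule has_weak_partial_convol[OF w0 t])
  have wu: "has_weak_partial j (\<lambda>x. u x \<bullet> b) (\<lambda>x. weak_partial j u x \<bullet> b)"
    by (rule has_weak_partial_inner[OF H1D(1)[OF u]])
  have wu': "has_weak_partial j (\<lambda>x. u' x \<bullet> b) (\<lambda>x. weak_partial j u' x \<bullet> b)"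
    by (rule has_weak_partial_inner[OF H1D(1)[OF u']])
  have "has_weak_partial j ?f (\<lambda>x. weak_partial j u x \<bullet> b)"
    by (rule has_weak_partial_cong_AE[OF wu L2_locally_integrable[OF L(1)]]) (use ae in \<open>eventually_elim, simp\<close>)
  then have 1: "AE x in lborel. weak_partial j u x \<bullet> b = ?g x" by (rule has_weak_partial_unique[OF m _ w0])
  have "has_weak_partial j (convol ?f \<psi>) (\<lambda>x. weak_partial j u' x \<bullet> b)"
    by (rule has_weak_partial_cong_AE[OF wu' L2_locally_integrable[OF convol_L2[OF L(1) m]]])
      (use ae' in \<open>eventually_elim, simp add: convol_component[OF L2_euclidean_locally_integrable[OF H1D(2)[OF u0]] t]\<close>)
  then have 2: "AE x in lborel. weak_partial j u' x \<bullet> b = convol ?g \<psi> x" by (rule has_weak_partial_unique[OF m _ wc])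
  have M: "L2 (\<lambda>x. weak_partial j u' x \<bullet> b - weak_partial j u x \<bullet> b)" "L2 (\<lambda>x. convol ?g \<psi> x - ?g x)"
    using H1D(3)[OF u] H1D(3)[OF u'] b L convol_L2[OF L(2) m] by (auto intro!: L2_diff L2_component)
  show ?thesis
  proof (rule L2_norm_cong_AE[OF M[THEN L2_measurable]])
    show "AE x in lborel. weak_partial j u' x \<bullet> b - weak_partial j u x \<bullet> b = convol ?g \<psi> x - ?g x"
      using 1 2 by eventually_elim simp
  qed
qed

text \<open>The energy estimate is applied with \<delta> = C \<epsilon> and with \<open>B\<close>
  taken from the classical solution, so its right side depends on \<epsilon> only through \<delta>
  and the mollification errors of the data.\<close>

lemma component_convergence:
  fixes h :: "'n \<Rightarrow> real ^ 'n \<Rightarrow> real"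
    and u0 u1 :: "real ^ 'n \<Rightarrow> 'b::euclidean_space"
  assumes T: "T > 0" and h: "\<And>j. W1inf (h j)" and pos: "positive_coeffs h" and u0: "H1 u0" and u1: "L2 u1"
    and m1: "mollifier \<psi>1" and m2: "mollifier \<psi>2" and m3: "mollifier \<psi>3"
    and reg: "C_H2_C1_H1 T u" and sol: "solves_wave_eq T h u0 u1 u"
    and reg_net: "\<And>\<epsilon>. \<epsilon> \<in> {0<..1} \<Longrightarrow> C_H2_C1_H1 T (u_net \<epsilon>)"
    and sol_net: "\<And>\<epsilon>. \<epsilon> \<in> {0<..1} \<Longrightarrow> solves_wave_eq T (\<lambda>j. convol (h j) (scaled \<psi>1 \<epsilon>))
           (convol u0 (scaled \<psi>2 \<epsilon>)) (convol u1 (scaled \<psi>3 \<epsilon>)) (u_net \<epsilon>)"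
    and t: "t \<in> {0..T}" and b: "b \<in> Basis"
  shows "((\<lambda>\<epsilon>. L2_norm (\<lambda>x. u_net \<epsilon> t x \<bullet> b - u t x \<bullet> b)) \<longlongrightarrow> 0) (at_right 0)"
proof -
  \<comment> \<open>Packing all properties of the constant into one predicate allows a simultaneous
    choice over the directions \<open>j\<close>.\<close>
  define P where "P j C \<longleftrightarrow> 0 \<le> C \<and> h j \<in> borel_measurable borel \<and> (AE x in lborel. \<bar>h j x\<bar> \<le> C) \<and>
    (\<forall>\<epsilon>. 0 < \<epsilon> \<longrightarrow> \<epsilon> \<le> 1 \<longrightarrow> (AE x in lborel. \<bar>convol (h j) (scaled \<psi>1 \<epsilon>) x - h j x\<bar> \<le> C * \<epsilon>))" for j C
  have "\<exists>C. P j C" for j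
  proof (rule W1inf_mollify[OF h[of j] m1])
    fix C assume "C \<ge> 0" "h j \<in> borel_measurable borel" "AE x in lborel. \<bar>h j x\<bar> \<le> C"
      "\<And>\<epsilon>. 0 < \<epsilon> \<Longrightarrow> \<epsilon> \<le> 1 \<Longrightarrow> AE x in lborel. \<bar>convol (h j) (scaled \<psi>1 \<epsilon>) x - h j x\<bar> \<le> C * \<epsilon>"
    then show ?thesis unfolding P_def by (intro exI[of _ C] conjI allI impI)
  qed
  then obtain Cf where P: "\<And>j. P j (Cf j)" by metis
  define C where "C = (\<Sum>j\<in>UNIV. Cf j)"
  have Cf: "0 \<le> Cf j" and hm: "h j \<in> borel_measurable borel" for j
    using P[of j] by (auto simp: P_def)
  have C0: "0 \<le> C" unfolding C_def by (intro sum_nonneg Cf)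
  have le_C: "Cf j \<le> C" for j unfolding C_def by (rule member_le_sum) (auto simp: Cf)
  have "AE x in lborel. \<bar>h j x\<bar> \<le> Cf j" for j using P[of j] by (simp add: P_def)
  then have hC: "AE x in lborel. \<bar>h j x\<bar> \<le> C" for j
    by (rule eventually_mono) (use le_C in \<open>blast intro: order_trans\<close>)
  have hd: "AE x in lborel. \<bar>convol (h j) (scaled \<psi>1 \<epsilon>) x - h j x\<bar> \<le> C * \<epsilon>" if e: "0 < \<epsilon>" "\<epsilon> \<le> 1" for j \<epsilon>
  proof -
    have le: "Cf j * \<epsilon> \<le> C * \<epsilon>" using le_C e by (intro mult_right_mono) auto
    have "AE x in lborel. \<bar>convol (h j) (scaled \<psi>1 \<epsilon>) x - h j x\<bar> \<le> Cf j * \<epsilon>"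
      using P[of j] e by (simp add: P_def)
    then show ?thesis by eventually_elim (use le in linarith)
  qed
  obtain c where c: "0 < c" "\<And>j. AE x in lborel. c \<le> h j x" using pos by (auto simp: positive_coeffs_def)
  obtain v V where W: "weak_wave T h (\<lambda>t x. u t x \<bullet> b) v (\<lambda>j t x. weak_partial j (u t) x \<bullet> b) V"
    and ae_u: "AE x in lborel. u 0 x = u0 x" and ae_v: "AE x in lborel. v 0 x = u1 x \<bullet> b" and H1u: "H1 (u 0)"
    by (rule weak_wave_component[OF m1 b T reg sol hm hC])
  have cUV: "L2_C1_curve T (\<lambda>t x. weak_partial j (u t) x \<bullet> b) (V j)" and cv: "L2_C1_curve T (\<lambda>t x. u t x \<bullet> b) v" for j
    using W by (auto simp: weak_wave_def)
  define bd where "bd w A \<longleftrightarrow> (\<forall>t\<in>{0..T}. L2_norm (w t) \<le> A)" for w :: "real \<Rightarrow> real ^ 'n \<Rightarrow> real" and A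
  have bd: "\<exists>A. bd w A" if "L2_curve T w" for w
  proof (rule L2_curve_bounded[OF that])
    fix A assume "\<And>t. t \<in> {0..T} \<Longrightarrow> L2_norm (w t) \<le> A"
    then have "bd w A" by (simp add: bd_def)
    then show ?thesis by blast
  qed
  have "\<exists>A A'. bd (\<lambda>t x. weak_partial j (u t) x \<bullet> b) A \<and> bd (V j) A'" for j
    using bd[OF L2_C1_curveD(1)[OF cUV[of j]]] bd[OF L2_C1_curveD(2)[OF cUV[of j]]] by blast
  then obtain BU BV where "\<And>j. bd (\<lambda>t x. weak_partial j (u t) x \<bullet> b) (BU j) \<and> bd (V j) (BV j)" by metis
  then have BU: "L2_norm (\<lambda>x. weak_partial j (u t) x \<bullet> b) \<le> BU j" and BV: "L2_norm (V j t) \<le> BV j"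
    if "t \<in> {0..T}" for j t using that by (auto simp: bd_def)
  \<comment> \<open>Absolute values make the summands nonnegative, so the sum bounds each of
    them.\<close>
  define B where "B = (\<Sum>j\<in>UNIV. \<bar>BU j\<bar> + \<bar>BV j\<bar>)"
  have B0: "0 \<le> B" unfolding B_def by (intro sum_nonneg) auto
  have le_B: "\<bar>BU j\<bar> + \<bar>BV j\<bar> \<le> B" for j unfolding B_def by (rule member_le_sum) auto
  have B: "L2_norm (\<lambda>x. weak_partial j (u t) x \<bullet> b) \<le> B" "L2_norm (V j t) \<le> B" if "t \<in> {0..T}" for j t
    using BU[OF that, of j] BV[OF that, of j] le_B[of j] by linarith+
  define N1 where "N1 \<epsilon> = L2_norm (\<lambda>x. convol (\<lambda>x. u1 x \<bullet> b) (scaled \<psi>3 \<epsilon>) x - u1 x \<bullet> b)" for \<epsilon>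
  define N2 where "N2 j \<epsilon> = L2_norm (\<lambda>x. convol (\<lambda>x. weak_partial j u0 x \<bullet> b) (scaled \<psi>2 \<epsilon>) x - weak_partial j u0 x \<bullet> b)" for j \<epsilon>
  define N3 where "N3 \<epsilon> = L2_norm (\<lambda>x. convol (\<lambda>x. u0 x \<bullet> b) (scaled \<psi>2 \<epsilon>) x - u0 x \<bullet> b)" for \<epsilon>
  have L: "L2 (\<lambda>x. u1 x \<bullet> b)" "L2 (\<lambda>x. u0 x \<bullet> b)" "L2 (\<lambda>x. weak_partial j u0 x \<bullet> b)" for j
    using u1 H1D[OF u0] b by (auto intro: L2_component)
  have N: "(N1 \<longlongrightarrow> 0) (at_right 0)" "(N2 j \<longlongrightarrow> 0) (at_right 0)" "(N3 \<longlongrightarrow> 0) (at_right 0)" for j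
    unfolding N1_def[abs_def] N2_def[abs_def] N3_def[abs_def]
    by (rule convol_L2_tendsto[OF L(1) m3], rule convol_L2_tendsto[OF L(3) m2], rule convol_L2_tendsto[OF L(2) m2])
  \<comment> \<open>Right side of the energy estimate for M = C and \<delta> = C \<epsilon>; each
    term carries \<epsilon> or one of the errors \<open>N1\<close>, \<open>N2\<close>,
    \<open>N3\<close>.\<close>
  define R where "R \<epsilon> = 2 * exp T * ((N1 \<epsilon>)\<^sup>2 / 2
     + (\<Sum>j\<in>UNIV. (C + C * \<epsilon>) * (N2 j \<epsilon>)\<^sup>2 / 2 + C * \<epsilon> * B * N2 j \<epsilon>)
     + (N3 \<epsilon>)\<^sup>2 / 2 + C * \<epsilon> * B * real CARD('n) + C * \<epsilon> * B * real CARD('n) * T)" for \<epsilon>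
  have "(R \<longlongrightarrow> 2 * exp T * (0\<^sup>2 / 2 + (\<Sum>j\<in>(UNIV::'n set). (C + C * 0) * 0\<^sup>2 / 2 + C * 0 * B * 0)
     + 0\<^sup>2 / 2 + C * 0 * B * real CARD('n) + C * 0 * B * real CARD('n) * T)) (at_right 0)"
    unfolding R_def[abs_def] by (intro tendsto_intros N) auto
  then have R: "(R \<longlongrightarrow> 0) (at_right 0)" by simp
  \<comment> \<open>The first threshold lets the mollified coefficients inherit the lower bound
    \<open>c / 2\<close>; the second is the smallness condition of the energy estimate with
    \<open>c / 2\<close> as ellipticity constant.\<close>
  have bound: "(L2_norm (\<lambda>x. u_net \<epsilon> t x \<bullet> b - u t x \<bullet> b))\<^sup>2 \<le> R \<epsilon>"
    if e: "0 < \<epsilon>" "\<epsilon> \<le> 1" and small: "C * \<epsilon> \<le> c / 2" "4 * (C * \<epsilon> * B) \<le> c / 2" for \<epsilon>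
  proof -
    let ?k = "\<lambda>j. convol (h j) (scaled \<psi>1 \<epsilon>)"
    have e': "\<epsilon> \<in> {0<..1}" using e by simp
    have m1e: "mollifier (scaled \<psi>1 \<epsilon>)" and m2e: "mollifier (scaled \<psi>2 \<epsilon>)" and m3e: "mollifier (scaled \<psi>3 \<epsilon>)"
      using mollifier_scaled e m1 m2 m3 by auto
    have km: "?k j \<in> borel_measurable borel" for j
      using m1e by (intro convol_measurable hm test_function_measurable) (simp add: mollifier_def)
    have kc: "AE x in lborel. c / 2 \<le> ?k j x" for j
      using c(2)[of j] hd[OF e, of j] by eventually_elim (use small in linarith)
    have kM: "AE x in lborel. \<bar>?k j x\<bar> \<le> C + C * \<epsilon>" for j
      using hC[of j] hd[OF e, of j] by eventually_elim linarith
    obtain v' V' where W': "weak_wave T ?k (\<lambda>t x. u_net \<epsilon> t x \<bullet> b) v' (\<lambda>j t x. weak_partial j (u_net \<epsilon> t) x \<bullet> b) V'"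
      and ae_u': "AE x in lborel. u_net \<epsilon> 0 x = convol u0 (scaled \<psi>2 \<epsilon>) x"
      and ae_v': "AE x in lborel. v' 0 x = convol u1 (scaled \<psi>3 \<epsilon>) x \<bullet> b" and H1u': "H1 (u_net \<epsilon> 0)"
      by (rule weak_wave_component[OF m1 b T reg_net[OF e'] sol_net[OF e'] km kM])
    have cv': "L2_C1_curve T (\<lambda>t x. u_net \<epsilon> t x \<bullet> b) v'" using W' by (simp add: weak_wave_def)
    have T0: "0 \<in> {0..T}" using T by simp
    note Lc = L2_C1_curveD(1,2)[OF cv, THEN L2_curveD(1), OF T0] L2_C1_curveD(1,2)[OF cv', THEN L2_curveD(1), OF T0]
    have comp: "convol f p x \<bullet> b = convol (\<lambda>x. f x \<bullet> b) p x" if "L2 f" "mollifier p" for f :: "real^'n \<Rightarrow> 'b" and p x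
      using that by (intro convol_component L2_euclidean_locally_integrable) (simp_all add: mollifier_def)
    have "L2_norm (\<lambda>x. v' 0 x - v 0 x) = N1 \<epsilon>"
      unfolding N1_def
    proof (rule L2_norm_cong_AE)
      show "AE x in lborel. v' 0 x - v 0 x = convol (\<lambda>x. u1 x \<bullet> b) (scaled \<psi>3 \<epsilon>) x - u1 x \<bullet> b"
        using ae_v ae_v' by eventually_elim (simp add: comp[OF u1 m3e])
    qed (intro L2_measurable L2_diff Lc L convol_L2 m3e)+
    moreover have "L2_norm (\<lambda>x. u_net \<epsilon> 0 x \<bullet> b - u 0 x \<bullet> b) = N3 \<epsilon>"
      unfolding N3_def
    proof (rule L2_norm_cong_AE)
      show "AE x in lborel. u_net \<epsilon> 0 x \<bullet> b - u 0 x \<bullet> b = convol (\<lambda>x. u0 x \<bullet> b) (scaled \<psi>2 \<epsilon>) x - u0 x \<bullet> b"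
        using ae_u ae_u' by eventually_elim (simp add: comp[OF H1D(2)[OF u0] m2e])
    qed (intro L2_measurable L2_diff Lc L convol_L2 m2e)+
    moreover have "L2_norm (\<lambda>x. weak_partial j (u_net \<epsilon> 0) x \<bullet> b - weak_partial j (u 0) x \<bullet> b) = N2 j \<epsilon>" for j
      unfolding N2_def by (rule initial_gradient_error[OF m2e b u0 H1u H1u' ae_u ae_u'])
    moreover have "0 \<le> C * \<epsilon>" using C0 e by simp
    ultimately show ?thesis
      using energy_estimate[OF m1 W W' hm hC km hd[OF e] kc B _ B0 small(2) t] unfolding R_def by simp
  qed
  have ev: "\<forall>\<^sub>F \<epsilon> in at_right 0. norm ((L2_norm (\<lambda>x. u_net \<epsilon> t x \<bullet> b - u t x \<bullet> b))\<^sup>2) \<le> R \<epsilon>"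
  proof -
    have "((\<lambda>\<epsilon>. C * \<epsilon>) \<longlongrightarrow> C * 0) (at_right 0)" "((\<lambda>\<epsilon>. 4 * (C * \<epsilon> * B)) \<longlongrightarrow> 4 * (C * 0 * B)) (at_right 0)"
      by (intro tendsto_intros)+
    then have "\<forall>\<^sub>F \<epsilon> in at_right 0. C * \<epsilon> < c / 2" "\<forall>\<^sub>F \<epsilon> in at_right 0. 4 * (C * \<epsilon> * B) < c / 2"
      using order_tendstoD(2) c(1) by (metis half_gt_zero mult_zero_left mult_zero_right)+
    moreover have "\<forall>\<^sub>F \<epsilon>::real in at_right 0. \<epsilon> < 1" by (rule order_tendstoD(2)[OF tendsto_ident_at]) simp
    moreover have "\<forall>\<^sub>F \<epsilon>::real in at_right 0. 0 < \<epsilon>" by (rule eventually_at_right_less)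
    ultimately show ?thesis by eventually_elim (simp add: bound)
  qed
  have "((\<lambda>\<epsilon>. (L2_norm (\<lambda>x. u_net \<epsilon> t x \<bullet> b - u t x \<bullet> b))\<^sup>2) \<longlongrightarrow> 0) (at_right 0)"
    by (rule Lim_null_comparison[OF ev R])
  from tendsto_real_sqrt[OF this] show ?thesis by simp
qed

theorem theorem2p6:
  fixes T :: real
    and h :: "'n \<Rightarrow> real ^ 'n::finite \<Rightarrow> real"
    and u0 u1 :: "real ^ 'n \<Rightarrow> 'b::{real_normed_field, euclidean_space}"
    and u :: "real \<Rightarrow> real ^ 'n \<Rightarrow> 'b"
    and \<psi>1 \<psi>2 \<psi>3 :: "real ^ 'n \<Rightarrow> real"
    and u_net :: "real \<Rightarrow> real \<Rightarrow> real ^ 'n \<Rightarrow> 'b"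
  assumes "T > 0"
    and "\<forall>j. W1inf (h j)" and "positive_coeffs h"
    and "H2 u0" and "H1 u1"
    and "mollifier \<psi>1" and "mollifier \<psi>2" and "mollifier \<psi>3"
    and "very_weak_solution T
           (\<lambda>j \<epsilon>. convol (h j) (scaled \<psi>1 \<epsilon>))
           (\<lambda>\<epsilon>. convol u0 (scaled \<psi>2 \<epsilon>))
           (\<lambda>\<epsilon>. convol u1 (scaled \<psi>3 \<epsilon>))
           u_net"
    and "classical_solution T h u0 u1 u"
  shows "\<forall>t\<in>{0..T}. ((\<lambda>\<epsilon>. L2_norm (\<lambda>x. u_net \<epsilon> t x - u t x)) \<longlongrightarrow> 0) (at_right 0)"
proof
  fix t assume t: "t \<in> {0..T}"
  have sol: "C_H2_C1_H1 T u" "solves_wave_eq T h u0 u1 u"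
    using assms(10) by (auto simp: classical_solution_def)
  have sol_net: "C_H2_C1_H1 T (u_net \<epsilon>)"
    "solves_wave_eq T (\<lambda>j. convol (h j) (scaled \<psi>1 \<epsilon>)) (convol u0 (scaled \<psi>2 \<epsilon>)) (convol u1 (scaled \<psi>3 \<epsilon>)) (u_net \<epsilon>)"
    if "\<epsilon> \<in> {0<..1}" for \<epsilon>
    using assms(9) that by (auto simp: very_weak_solution_def C1_moderate_def)
  have "H1 u0" using assms(4) by (simp add: H2_def)
  note conv = component_convergence[OF assms(1) assms(2)[rule_format] assms(3) this H1D(2)[OF assms(5)] assms(6-8)
      sol sol_net t]
  have L2_t: "L2 (f t)" if "C_H2_C1_H1 T f" for f :: "real \<Rightarrow> real ^ 'n \<Rightarrow> 'b"
  proof -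
    have "H1 (f t)" using that t by (auto simp: C_H2_C1_H1_def C_curve_def H2_def)
    then show ?thesis by (rule H1D(2))
  qed
  \<comment> \<open>The squared L2 norm of a vector-valued function is the sum of the squared norms
    of its finitely many components.\<close>
  have "((\<lambda>\<epsilon>. sqrt (\<Sum>b\<in>Basis. (L2_norm (\<lambda>x. u_net \<epsilon> t x \<bullet> b - u t x \<bullet> b))\<^sup>2)) \<longlongrightarrow>
      sqrt (\<Sum>b\<in>(Basis :: 'b set). 0\<^sup>2)) (at_right 0)"
    by (intro tendsto_real_sqrt tendsto_sum tendsto_power conv)
  \<comment> \<open>The identity is proved for functions in L2, and the net is known to lie there
    only for \<epsilon> in (0,1]; to the right of 0 this holds eventually.\<close>
  moreover have "\<forall>\<^sub>F \<epsilon> in at_right 0.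
      sqrt (\<Sum>b\<in>Basis. (L2_norm (\<lambda>x. u_net \<epsilon> t x \<bullet> b - u t x \<bullet> b))\<^sup>2) = L2_norm (\<lambda>x. u_net \<epsilon> t x - u t x)"
  proof -
    have "\<forall>\<^sub>F \<epsilon>::real in at_right 0. \<epsilon> < 1" by (rule order_tendstoD(2)[OF tendsto_ident_at]) simp
    moreover have "\<forall>\<^sub>F \<epsilon>::real in at_right 0. 0 < \<epsilon>" by (rule eventually_at_right_less)
    ultimately show ?thesis
    proof eventually_elim
      case (elim \<epsilon>)
      then have "L2 (\<lambda>x. u_net \<epsilon> t x - u t x)" by (intro L2_euclidean_diff L2_t sol sol_net) simp
      from L2_componentsI(2)[OF L2_component(1)[OF this]]
      have "(L2_norm (\<lambda>x. u_net \<epsilon> t x - u t x))\<^sup>2 = (\<Sum>b\<in>Basis. (L2_norm (\<lambda>x. u_net \<epsilon> t x \<bullet> b - u t x \<bullet> b))\<^sup>2)"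
        by (simp add: inner_diff_left)
      then show ?case by (metis L2_norm_ge0 real_sqrt_unique)
    qed
  qed
  ultimately have "((\<lambda>\<epsilon>. L2_norm (\<lambda>x. u_net \<epsilon> t x - u t x)) \<longlongrightarrow> sqrt (\<Sum>b\<in>(Basis :: 'b set). 0\<^sup>2)) (at_right 0)"
    by (rule Lim_transform_eventually)
  then show "((\<lambda>\<epsilon>. L2_norm (\<lambda>x. u_net \<epsilon> t x - u t x)) \<longlongrightarrow> 0) (at_right 0)" by simp
qed

end
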